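(* Let $K$ be a field. Each of the Lie superalgebra $\mathbf Q$, the associative algebra $\mathbf A$, and the Poisson superalgebra without unit $\mathbf P^o$ (and, when $\operatorname{char}K\ne2$, the Jordan superalgebras without unit $\mathbf J^o$ and $\mathbf K^o$) decomposes as a direct sum of two locally nilpotent subalgebras: $$\mathbf Q=\mathbf Q_+\oplus\mathbf Q_-,\quad\mathbf A=\mathbf A_+\oplus\mathbf A_-,\quad\mathbf P^o=\mathbf P_+\oplus\mathbf P_-,\quad\mathbf J^o=\mathbf J_+\oplus\mathbf J_-,\quad\mathbf K^o=\mathbf K_+\oplus\mathbf K_-,$$ and for each of these algebras there are continuum many different such decompositions.
   Context: $\Lambda$ is the Grassmann algebra over $K$ on odd $x_0,x_1,\dots$ ($x_i$ acting by left multiplication), $\partial_i$ the superderivation with $\partial_i(x_j)=\delta_{ij}$, $v_i=\sum_{k\ge0}\big(\prod_{n=0}^{k-1}x_{i+3n}x_{i+3n+1}\big)\partial_{i+3k}$. $\mathbf Q$ is the Lie subsuperalgebra of $(\operatorname{End}\Lambda)^{(-)}$ generated by $v_0,v_1,v_2$ (closed under squares of odd elements in characteristic $2$); $\mathbf A$ is the associative subalgebra of $\operatorname{End}\Lambda$ generated by $v_0,v_1,v_2$. $H_\infty=\Lambda(x_i,y_i\mid i\ge0)$ (odd generators) with Poisson bracket $\{y_i,x_j\}=\delta_{ij}$, $\{x_i,x_j\}=\{y_i,y_j\}=0$; $\widetilde H$ its completion by formal sums $c\cdot1+\sum\lambda_{\alpha,\beta}x^\alpha y^\beta$ over monomials with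 $\beta\ne0$ and (largest index in $\alpha$) $<$ (largest index in $\beta$); $V_i=\sum_{k\ge0}\big(\prod_{n=0}^{k-1}x_{i+3n}x_{i+3n+1}\big)y_{i+3k}$; $\mathbf P$ is the smallest unital subalgebra of $\widetilde H$ containing $V_0,V_1,V_2$ closed under product, bracket and (in characteristic $2$) the formal square of odd elements ($m^{[2]}=0$ for odd monomials, $(f+g)^{[2]}=f^{[2]}+\{f,g\}+g^{[2]}$); $\mathbf P^o$ is the span of its elements without constant term (its ideal without unit). $\mathbf J=\mathrm{Kan}(\mathbf P)=\mathbf P\oplus\bar{\mathbf P}$ with $|\bar a|=1-|a|$ and $a\bullet b=ab$, $\bar a\bullet b=(-1)^{|b|}\overline{ab}$, $a\bullet\bar b=\overline{ab}$, $\bar a\bullet\bar b=(-1)^{|b|}\{a,b\}$; $\mathbf J^o=\mathbf P^o\oplus\bar{\mathbf P}$. $\mathbf K=K1\oplus\mathbf Q\oplus K\bar1\oplus\bar{\mathbf Q}$ with only nonzero products (besides the unit $1$) $\bar x\bullet\bar y=[x,y]$, $x\bullet\bar1=(-1)^{|x|}\bar1\bullet x=\bar x$; $\mathbf K^o=\mathbf Q\oplus K\bar1\oplus\bar{\mathbf Q}$. An algebra is locally nilpotent if every finitely generated subalgebra is nilpotent. *)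

theory Defs
  imports Complex_Main
begin

text \<open>Vectors over a field 'k are coefficient functions 'i => 'k on a basis 'i.\<close>

definition z0 :: "'i \<Rightarrow> 'k::field" where "z0 = (\<lambda>_. 0)"
definition vadd :: "('i \<Rightarrow> 'k::field) \<Rightarrow> ('i \<Rightarrow> 'k) \<Rightarrow> 'i \<Rightarrow> 'k" where
  "vadd a b = (\<lambda>i. a i + b i)"
definition vsub :: "('i \<Rightarrow> 'k::field) \<Rightarrow> ('i \<Rightarrow> 'k) \<Rightarrow> 'i \<Rightarrow> 'k" where
  "vsub a b = (\<lambda>i. a i - b i)"
definition vsc :: "'k::field \<Rightarrow> ('i \<Rightarrow> 'k) \<Rightarrow> 'i \<Rightarrow> 'k" where
  "vsc c a = (\<lambda>i. c * a i)"

definition lin_sub :: "('i \<Rightarrow> 'k::field) set \<Rightarrow> bool" where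
  "lin_sub S \<longleftrightarrow> z0 \<in> S \<and> (\<forall>a\<in>S. \<forall>b\<in>S. vadd a b \<in> S) \<and> (\<forall>c a. a \<in> S \<longrightarrow> vsc c a \<in> S)"

text \<open>A (super)algebra structure is given by: the projection pe onto the even part,
  a list of bilinear operations, and a square operation on odd elements
  (the square map is the zero map for algebras without squares).
  A subalgebra is a graded subspace closed under the operations and under squares of odd elements.\<close>

definition is_subalg ::
  "(('i \<Rightarrow> 'k::field) \<Rightarrow> ('i \<Rightarrow> 'k)) \<Rightarrow> (('i \<Rightarrow> 'k) \<Rightarrow> ('i \<Rightarrow> 'k) \<Rightarrow> ('i \<Rightarrow> 'k)) list
    \<Rightarrow> (('i \<Rightarrow> 'k) \<Rightarrow> ('i \<Rightarrow> 'k)) \<Rightarrow> ('i \<Rightarrow> 'k) set \<Rightarrow> bool" where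
  "is_subalg pe ops sq S \<longleftrightarrow> lin_sub S \<and> (\<forall>a\<in>S. pe a \<in> S)
     \<and> (\<forall>f\<in>set ops. \<forall>a\<in>S. \<forall>b\<in>S. f a b \<in> S)
     \<and> (\<forall>a\<in>S. pe a = z0 \<longrightarrow> sq a \<in> S)"

definition generated ::
  "(('i \<Rightarrow> 'k::field) \<Rightarrow> ('i \<Rightarrow> 'k)) \<Rightarrow> (('i \<Rightarrow> 'k) \<Rightarrow> ('i \<Rightarrow> 'k) \<Rightarrow> ('i \<Rightarrow> 'k)) list
    \<Rightarrow> (('i \<Rightarrow> 'k) \<Rightarrow> ('i \<Rightarrow> 'k)) \<Rightarrow> ('i \<Rightarrow> 'k) set \<Rightarrow> ('i \<Rightarrow> 'k) set" where
  "generated pe ops sq G = \<Inter>{S. is_subalg pe ops sq S \<and> G \<subseteq> S}"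

definition homog :: "(('i \<Rightarrow> 'k::field) \<Rightarrow> ('i \<Rightarrow> 'k)) \<Rightarrow> ('i \<Rightarrow> 'k) \<Rightarrow> bool" where
  "homog pe x \<longleftrightarrow> pe x = x \<or> pe x = z0"

text \<open>Monomials (all bracketings, with squares of odd monomials) in a set X of homogeneous
  elements, tagged with their degree and parity (True = odd).\<close>

inductive_set mons ::
  "(('i \<Rightarrow> 'k::field) \<Rightarrow> ('i \<Rightarrow> 'k)) \<Rightarrow> (('i \<Rightarrow> 'k) \<Rightarrow> ('i \<Rightarrow> 'k) \<Rightarrow> ('i \<Rightarrow> 'k)) list
    \<Rightarrow> (('i \<Rightarrow> 'k) \<Rightarrow> ('i \<Rightarrow> 'k)) \<Rightarrow> ('i \<Rightarrow> 'k) set \<Rightarrow> (('i \<Rightarrow> 'k) \<times> nat \<times> bool) set"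
  for pe ops sq X where
  mgen: "x \<in> X \<Longrightarrow> pe x = (if p then z0 else x) \<Longrightarrow> (x, 1, p) \<in> mons pe ops sq X"
| mop: "(a, m, p) \<in> mons pe ops sq X \<Longrightarrow> (b, n, q) \<in> mons pe ops sq X \<Longrightarrow> f \<in> set ops
         \<Longrightarrow> (f a b, m + n, p \<noteq> q) \<in> mons pe ops sq X"
| msq: "(a, m, True) \<in> mons pe ops sq X \<Longrightarrow> (sq a, 2 * m, False) \<in> mons pe ops sq X"

text \<open>Locally nilpotent: the subalgebra generated by any finite set (w.l.o.g. of homogeneous
  elements) is nilpotent, i.e. all products of degree at least N in the generators vanish.\<close>

definition loc_nilp ::
  "(('i \<Rightarrow> 'k::field) \<Rightarrow> ('i \<Rightarrow> 'k)) \<Rightarrow> (('i \<Rightarrow> 'k) \<Rightarrow> ('i \<Rightarrow> 'k) \<Rightarrow> ('i \<Rightarrow> 'k)) list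
    \<Rightarrow> (('i \<Rightarrow> 'k) \<Rightarrow> ('i \<Rightarrow> 'k)) \<Rightarrow> ('i \<Rightarrow> 'k) set \<Rightarrow> bool" where
  "loc_nilp pe ops sq L \<longleftrightarrow> (\<forall>X. finite X \<and> X \<subseteq> L \<and> (\<forall>x\<in>X. homog pe x) \<longrightarrow>
      (\<exists>N. \<forall>w n p. (w, n, p) \<in> mons pe ops sq X \<and> N \<le> n \<longrightarrow> w = z0))"

definition is_decomp ::
  "(('i \<Rightarrow> 'k::field) \<Rightarrow> ('i \<Rightarrow> 'k)) \<Rightarrow> (('i \<Rightarrow> 'k) \<Rightarrow> ('i \<Rightarrow> 'k) \<Rightarrow> ('i \<Rightarrow> 'k)) list
    \<Rightarrow> (('i \<Rightarrow> 'k) \<Rightarrow> ('i \<Rightarrow> 'k)) \<Rightarrow> ('i \<Rightarrow> 'k) set \<Rightarrow> ('i \<Rightarrow> 'k) set \<Rightarrow> ('i \<Rightarrow> 'k) set \<Rightarrow> bool" where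
  "is_decomp pe ops sq L B1 B2 \<longleftrightarrow>
     B1 \<subseteq> L \<and> B2 \<subseteq> L \<and> is_subalg pe ops sq B1 \<and> is_subalg pe ops sq B2
     \<and> B1 \<inter> B2 = {z0} \<and> (\<forall>x\<in>L. \<exists>b1\<in>B1. \<exists>b2\<in>B2. x = vadd b1 b2)
     \<and> loc_nilp pe ops sq B1 \<and> loc_nilp pe ops sq B2"

definition continuum_decomps ::
  "(('i \<Rightarrow> 'k::field) \<Rightarrow> ('i \<Rightarrow> 'k)) \<Rightarrow> (('i \<Rightarrow> 'k) \<Rightarrow> ('i \<Rightarrow> 'k) \<Rightarrow> ('i \<Rightarrow> 'k)) list
    \<Rightarrow> (('i \<Rightarrow> 'k) \<Rightarrow> ('i \<Rightarrow> 'k)) \<Rightarrow> ('i \<Rightarrow> 'k) set \<Rightarrow> bool" where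
  "continuum_decomps pe ops sq L \<longleftrightarrow>
     (\<exists>D. D \<subseteq> {(B1, B2). is_decomp pe ops sq L B1 B2} \<and> (\<exists>f::real \<Rightarrow> _. bij_betw f UNIV D))"

text \<open>Basis of Lambda: x^T for finite T (increasing product). Sign of x^A x^B = sgn * x^(A Un B).\<close>

definition gsgn :: "nat set \<Rightarrow> nat set \<Rightarrow> 'k::field" where
  "gsgn A B = (-1) ^ card {(a, b). a \<in> A \<and> b \<in> B \<and> b < a}"

text \<open>An endomorphism a of Lambda is given by its matrix: a (T,S) is the coefficient of x^S
  in the image of x^T.\<close>

type_synonym 'k endo = "nat set \<times> nat set \<Rightarrow> 'k"

definition ocomp :: "'k::field endo \<Rightarrow> 'k endo \<Rightarrow> 'k endo" where
  "ocomp a b = (\<lambda>(T, S). \<Sum>U\<in>{U. b (T, U) \<noteq> 0}. b (T, U) * a (U, S))"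

definition lmulop :: "nat set \<Rightarrow> 'k::field endo" where
  "lmulop W = (\<lambda>(T, S). if finite T \<and> W \<inter> T = {} \<and> S = W \<union> T then gsgn W T else 0)"

definition dop :: "nat \<Rightarrow> 'k::field endo" where
  "dop i = (\<lambda>(T, S). if finite T \<and> i \<in> T \<and> S = T - {i} then (-1) ^ card {t\<in>T. t < i} else 0)"

definition Wset :: "nat \<Rightarrow> nat \<Rightarrow> nat set" where
  "Wset i k = {i + 3 * n | n. n < k} \<union> {i + 3 * n + 1 | n. n < k}"

text \<open>v_i = sum_k (prod_{n<k} x_(i+3n) x_(i+3n+1)) d_(i+3k); the sum is finite on each x^T.\<close>

definition vop :: "nat \<Rightarrow> 'k::field endo" where
  "vop i = (\<lambda>(T, S). \<Sum>k\<in>{k. i + 3 * k \<in> T}. ocomp (lmulop (Wset i k)) (dop (i + 3 * k)) (T, S))"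

definition pe_op :: "'k::field endo \<Rightarrow> 'k endo" where
  "pe_op a = (\<lambda>(T, S). if even (card T + card S) then a (T, S) else 0)"

text \<open>Supercommutator [a,b] = sum over homogeneous components a_p b_q - (-1)^(pq) b_q a_p,
  which equals ab - ba + 2 b_1 a_1.\<close>

definition bracket_op :: "'k::field endo \<Rightarrow> 'k endo \<Rightarrow> 'k endo" where
  "bracket_op a b = vadd (vsub (ocomp a b) (ocomp b a))
      (vsc 2 (ocomp (vsub b (pe_op b)) (vsub a (pe_op a))))"

definition twist_op :: "'k::field endo \<Rightarrow> 'k endo" where
  "twist_op x = vsub (vsc 2 (pe_op x)) x"

definition Qalg :: "'k::field endo set" where
  "Qalg = generated pe_op [bracket_op] (\<lambda>a. ocomp a a) {vop 0, vop 1, vop 2}"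

definition Aalg :: "'k::field endo set" where
  "Aalg = generated id [ocomp] (\<lambda>_. z0) {vop 0, vop 1, vop 2}"

text \<open>Elements of the completion are coefficient functions on monomials x^alpha y^beta
  (x's increasing, then y's increasing), encoded as (alpha, beta).\<close>

type_synonym 'k hel = "nat set \<times> nat set \<Rightarrow> 'k"

definition hmul_mono :: "nat set \<times> nat set \<Rightarrow> nat set \<times> nat set \<Rightarrow> nat set \<times> nat set \<Rightarrow> 'k::field" where
  "hmul_mono m1 m2 t = (case (m1, m2, t) of ((a1, b1), (a2, b2), (A, B)) \<Rightarrow>
     if a1 \<inter> a2 = {} \<and> b1 \<inter> b2 = {} \<and> A = a1 \<union> a2 \<and> B = b1 \<union> b2
     then (-1) ^ (card b1 * card a2) * gsgn a1 a2 * gsgn b1 b2 else 0)"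

text \<open>Poisson bracket of monomials:
  {f,g} = sum_i (f d/dy_i from the right)(d/dx_i g from the left) + (f d/dx_i right)(d/dy_i g left).\<close>

definition br_mono :: "nat set \<times> nat set \<Rightarrow> nat set \<times> nat set \<Rightarrow> nat set \<times> nat set \<Rightarrow> 'k::field" where
  "br_mono m1 m2 t = (case (m1, m2) of ((a1, b1), (a2, b2)) \<Rightarrow>
     (\<Sum>i\<in>b1 \<inter> a2. (-1) ^ card {b\<in>b1. i < b} * (-1) ^ card {a\<in>a2. a < i}
                     * hmul_mono (a1, b1 - {i}) (a2 - {i}, b2) t)
   + (\<Sum>i\<in>a1 \<inter> b2. (-1) ^ (card {a\<in>a1. i < a} + card b1) * (-1) ^ (card a2 + card {b\<in>b2. b < i})
                     * hmul_mono (a1 - {i}, b1) (a2, b2 - {i}) t))"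

text \<open>Bilinear extension to formal sums (coefficientwise finite on the completion).\<close>

definition bil :: "('m \<Rightarrow> 'm \<Rightarrow> 'm \<Rightarrow> 'k::field) \<Rightarrow> ('m \<Rightarrow> 'k) \<Rightarrow> ('m \<Rightarrow> 'k) \<Rightarrow> 'm \<Rightarrow> 'k" where
  "bil F f g t = (\<Sum>p\<in>{(m1, m2). f m1 * g m2 * F m1 m2 t \<noteq> 0}.
                    f (fst p) * g (snd p) * F (fst p) (snd p) t)"

definition hmul :: "'k::field hel \<Rightarrow> 'k hel \<Rightarrow> 'k hel" where
  "hmul f g = bil hmul_mono f g"

definition hbr :: "'k::field hel \<Rightarrow> 'k hel \<Rightarrow> 'k hel" where
  "hbr f g = bil br_mono f g"

text \<open>A total order on monomials (via an injective code) used for the formal square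
  f^[2] = sum_{m < m'} f_m f_m' {m,m'} of an odd element (m^[2] = 0 for odd monomials).\<close>

definition mcode :: "nat set \<times> nat set \<Rightarrow> nat" where
  "mcode m = (\<Sum>x\<in>fst m. 2 ^ (2 * x)) + (\<Sum>x\<in>snd m. 2 ^ (2 * x + 1))"

definition hsq :: "'k::field hel \<Rightarrow> 'k hel" where
  "hsq f t = (\<Sum>p\<in>{(m1, m2). mcode m1 < mcode m2 \<and> f m1 * f m2 * br_mono m1 m2 t \<noteq> 0}.
               f (fst p) * f (snd p) * br_mono (fst p) (snd p) t)"

definition pe_H :: "'k::field hel \<Rightarrow> 'k hel" where
  "pe_H h = (\<lambda>(a, b). if even (card a + card b) then h (a, b) else 0)"

definition twist_H :: "'k::field hel \<Rightarrow> 'k hel" where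
  "twist_H x = vsub (vsc 2 (pe_H x)) x"

definition Vgen :: "nat \<Rightarrow> 'k::field hel" where
  "Vgen i = (\<lambda>(a, b). if \<exists>k. a = Wset i k \<and> b = {i + 3 * k} then 1 else 0)"

definition hone :: "'k::field hel" where
  "hone = (\<lambda>m. if m = ({}, {}) then 1 else 0)"

definition Palg :: "'k::field hel set" where
  "Palg = generated pe_H [hmul, hbr] hsq {hone, Vgen 0, Vgen 1, Vgen 2}"

definition Po :: "'k::field hel set" where
  "Po = {f \<in> Palg. f ({}, {}) = 0}"

section \<open>The Kantor double J = Kan(P)\<close>

text \<open>An element a + bbar is encoded by z with z (False, m) = a m and z (True, m) = b m.\<close>

type_synonym 'k jel = "bool \<times> nat set \<times> nat set \<Rightarrow> 'k"

definition jpart :: "'k jel \<Rightarrow> bool \<Rightarrow> 'k hel" where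
  "jpart z c = (\<lambda>m. z (c, m))"

definition mkJ :: "'k hel \<Rightarrow> 'k hel \<Rightarrow> 'k jel" where
  "mkJ a b = (\<lambda>(c, m). if c then b m else a m)"

definition jmul :: "'k::field jel \<Rightarrow> 'k jel \<Rightarrow> 'k jel" where
  "jmul z w = mkJ
     (vadd (hmul (jpart z False) (jpart w False)) (hbr (jpart z True) (twist_H (jpart w True))))
     (vadd (hmul (jpart z False) (jpart w True)) (hmul (jpart z True) (twist_H (jpart w False))))"

definition pe_J :: "'k::field jel \<Rightarrow> 'k jel" where
  "pe_J z = mkJ (pe_H (jpart z False)) (vsub (jpart z True) (pe_H (jpart z True)))"

definition Jo :: "'k::field jel set" where
  "Jo = {z. jpart z False \<in> Po \<and> jpart z True \<in> Palg}"

type_synonym 'k kel = "bool \<times> (nat set \<times> nat set) option \<Rightarrow> 'k"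

definition kc :: "'k kel \<Rightarrow> 'k" where "kc z = z (False, None)"
definition kx :: "'k kel \<Rightarrow> 'k endo" where "kx z = (\<lambda>p. z (False, Some p))"
definition kd :: "'k kel \<Rightarrow> 'k" where "kd z = z (True, None)"
definition ky :: "'k kel \<Rightarrow> 'k endo" where "ky z = (\<lambda>p. z (True, Some p))"

text \<open>mkK c x d y stands for c*1 + x + d*1bar + ybar.\<close>

definition mkK :: "'k \<Rightarrow> 'k endo \<Rightarrow> 'k \<Rightarrow> 'k endo \<Rightarrow> 'k kel" where
  "mkK c x d y = (\<lambda>(b, oo). case oo of None \<Rightarrow> (if b then d else c) | Some p \<Rightarrow> (if b then y p else x p))"

definition kmul :: "'k::field kel \<Rightarrow> 'k kel \<Rightarrow> 'k kel" where
  "kmul z w = mkK (kc z * kc w)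
     (vadd (vadd (vsc (kc z) (kx w)) (vsc (kc w) (kx z))) (bracket_op (ky z) (ky w)))
     (kc z * kd w + kc w * kd z)
     (vadd (vadd (vsc (kc z) (ky w)) (vsc (kc w) (ky z)))
           (vadd (vsc (kd w) (kx z)) (vsc (kd z) (twist_op (kx w)))))"

definition pe_K :: "'k::field kel \<Rightarrow> 'k kel" where
  "pe_K z = mkK (kc z) (pe_op (kx z)) 0 (vsub (ky z) (pe_op (ky z)))"

definition Ko :: "'k::field kel set" where
  "Ko = {z. kc z = 0 \<and> kx z \<in> Qalg \<and> ky z \<in> Qalg}"

end

theory Submission
  imports Defs "HOL-Analysis.Analysis"
begin

text \<open>
  Give \<open>v\<^sub>n\<close> the weight \<open>a\<^sub>n\<close>, where \<open>a\<^sub>n\<^sub>+\<^sub>3 = 2 a\<^sub>n + a\<^sub>n\<^sub>+\<^sub>1\<close>; then all five algebras are graded by \<open>\<int>\<^sup>3\<close>. The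
  polynomial \<open>t\<^sup>3 - t - 2\<close> is irreducible, with a real root \<open>lam\<close> and complex roots \<open>mu\<close>, \<open>cnj mu\<close>
  such that \<open>|mu|\<^sup>2 < lam\<close>. Realising \<open>a\<^sub>n\<close> as \<open>(mu\<^sup>n, lam\<^sup>n)\<close>, every nonzero component has a weight \<open>(z, r)\<close>
  with \<open>|z|\<^sup>2 \<le> C r\<close>: all components lie in a paraboloid around the axis \<open>z = 0\<close>. A plane through this
  axis that avoids the nonzero lattice points cuts each algebra into two subalgebras. In a half, a
  product of \<open>n\<close> factors lies at distance at least \<open>n d\<close> from the plane and has \<open>r = O(n)\<close>, so it leaves
  the paraboloid for large \<open>n\<close>: the halves are locally nilpotent. Each algebra contains \<open>\<plusminus>v\<^sub>n\<close> for all
  \<open>n\<close>, and the arguments of \<open>mu\<^sup>n\<close> are dense because no power of \<open>mu\<close> is real, so different planes give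
  different decompositions.
\<close>

section \<open>The roots of \<open>t\<^sup>3 = t + 2\<close>\<close>

text \<open>The recursion for the weights is forced: \<open>x_i\<close> weighs \<open>- a_i\<close>,
  and the two terms of \<open>v_n = d_n + x_n x_(n+1) v_(n+3)\<close> must weigh the same, so
  \<open>a_n = a_(n+3) - a_n - a_(n+1)\<close>. The paraboloid rests on square-freeness: a monomial
  contains each index with coefficient -1, 0 or 1. So from one tail of the weight to the next,
  \<open>z\<close> is multiplied by \<open>mu\<close> and \<open>r\<close> by \<open>lam\<close> up
  to bounded errors, and \<open>|mu|^2 < lam\<close> makes \<open>|z|^2 / r\<close> contract. A
  plane at first cuts only the ambient space of coefficient functions. For the two parts of an
  element to stay in the algebra, each element must be a finite sum of homogeneous elements of the
  algebra. Two obstacles shape this step: the operations are sums with value 0 as soon as infinitely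
  many terms are nonzero, so additivity needs finiteness conditions (\<open>admE\<close>,
  \<open>admH\<close>); and squares are not additive, so their polar form must be one of the
  operations (\<open>sq_add\<close>). In characteristic-free form the elements \<open>v_n\<close>
  are recovered as \<open>[v_(n+1), v_n^2] = v_(n+3)\<close> up to sign, which needs the square as
  an element of the algebra.\<close>

definition lam :: real where
  "lam = (SOME x. 3/2 < x \<and> x < 153/100 \<and> x ^ 3 = x + 2)"

text \<open>The root is about 1.5214. The upper bound 153/100 is tight enough for the contraction
  factor 877/1000 in \<open>square_bound_step\<close>.\<close>

lemma lam: "3/2 < lam" "lam < 153/100" "lam ^ 3 = lam + 2"
proof -
  let ?g = "\<lambda>x::real. x ^ 3 - x - 2"
  have "\<exists>x. 3/2 \<le> x \<and> x \<le> 153/100 \<and> ?g x = 0"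
    by (rule IVT') (auto intro!: continuous_intros simp: power3_eq_cube)
  then obtain x where x: "3/2 \<le> x" "x \<le> 153/100" "?g x = 0" by blast
  have "?g (3/2) \<noteq> 0" "?g (153/100) \<noteq> 0" by (simp_all add: power3_eq_cube)
  with x(3) have "x \<noteq> 3/2" "x \<noteq> 153/100" by metis+
  with x have "\<exists>x::real. 3/2 < x \<and> x < 153/100 \<and> x ^ 3 = x + 2"
    by (intro exI[of _ x]) auto
  from someI_ex[OF this] show "3/2 < lam" "lam < 153/100" "lam ^ 3 = lam + 2"
    unfolding lam_def by auto
qed

lemma lam_sq: "9/4 < lam\<^sup>2" "lam\<^sup>2 < 2341/1000"
proof -
  have "(3/2) * (3/2) < lam * lam" using lam by (intro mult_strict_mono) auto
  then show "9/4 < lam\<^sup>2" by (simp add: power2_eq_square)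
  have "lam * lam < (153/100) * (153/100)" using lam by (intro mult_strict_mono) auto
  then show "lam\<^sup>2 < 2341/1000" by (simp add: power2_eq_square)
qed

text \<open>A rational root of a monic integer polynomial is an integer, and none lies strictly
  between 1 and 2.\<close>

lemma lam_irrational: "lam \<notin> \<rat>"
proof
  assume "lam \<in> \<rat>"
  then obtain m n :: nat where mn: "n \<noteq> 0" "\<bar>lam\<bar> = real m / real n" "coprime m n"
    by (rule Rats_abs_nat_div_natE)
  then have l: "lam = real m / real n" using lam by simp
  have "real m ^ 3 = real m * real n ^ 2 + 2 * real n ^ 3"
    using lam(3) mn(1) unfolding l by (simp add: field_simps power3_eq_cube power2_eq_square)
  then have "real (m ^ 3) = real (m * n ^ 2 + 2 * n ^ 3)" by simp
  then have eq: "m ^ 3 = m * n ^ 2 + 2 * n ^ 3" by (simp only: of_nat_eq_iff)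
  have "n dvd m ^ 3" unfolding eq by (simp add: power3_eq_cube power2_eq_square)
  moreover have "coprime n (m ^ 3)" using mn(3) by (simp add: coprime_commute)
  ultimately have "n = 1" by (metis coprime_common_divisor_nat dvd_refl)
  with l lam(1,2) have "1 < real m" "real m < 2" by auto
  then show False by simp
qed

text \<open>The root in the upper half plane of \<open>t^2 + lam * t + (lam^2 - 1)\<close>, the
  quotient of \<open>t^3 - t - 2\<close> by \<open>t - lam\<close>.\<close>

definition mu :: complex where
  "mu = Complex (- lam / 2) (sqrt (3 * lam\<^sup>2 - 4) / 2)"

lemma Im_mu_pos: "0 < Im mu" and Re_mu: "Re mu = - lam / 2"
  using lam_sq by (auto simp: mu_def)

lemma cmod_mu_sq: "(cmod mu)\<^sup>2 = lam\<^sup>2 - 1"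
  using lam_sq by (simp add: cmod_power2 mu_def power_divide field_simps)

lemma mu_sq: "mu\<^sup>2 = - (of_real lam * mu) - of_real (lam\<^sup>2 - 1)"
proof -
  have "(Im mu)\<^sup>2 = (3 * lam\<^sup>2 - 4) / 4"
    using lam_sq by (simp add: mu_def power_divide)
  then show ?thesis
    by (simp add: complex_eq_iff Re_mu power2_eq_square field_simps)
qed

lemma mu_cubed: "mu ^ 3 = mu + 2"
proof -
  define L where "L = complex_of_real lam"
  have "mu\<^sup>2 + L * mu + (L\<^sup>2 - 1) = 0" using mu_sq by (simp add: L_def)
  moreover have "L ^ 3 = L + 2"
    unfolding L_def of_real_power[symmetric] lam(3) by simp
  moreover have "mu ^ 3 - mu - 2 = (mu - L) * (mu\<^sup>2 + L * mu + (L\<^sup>2 - 1)) + (L ^ 3 - L - 2)"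
    by (simp add: algebra_simps power2_eq_square power3_eq_cube)
  ultimately show ?thesis by (simp add: algebra_simps)
qed

lemma int_eq_lam_mult:
  fixes q r :: int
  assumes "of_int q = of_int r * lam"
  shows "q = 0 \<and> r = 0"
proof (cases "r = 0")
  case False
  then have "lam = of_int q / of_int r" using assms by (simp add: field_simps)
  then have "lam \<in> \<rat>" by (metis Rats_divide Rats_of_int)
  with lam_irrational show ?thesis by blast
qed (use assms in auto)

text \<open>Since \<open>Re mu = - lam / 2\<close>, the imaginary part of \<open>mu^2\<close> is
  \<open>- lam * Im mu\<close>. Questions about integer combinations thereby reduce to the
  irrationality of \<open>lam\<close>.\<close>

lemma Im_mu_comb: "Im (of_int p + of_int q * mu + of_int r * mu\<^sup>2) = Im mu * (of_int q - of_int r * lam)"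
  by (simp add: power2_eq_square Re_mu algebra_simps)

lemma mu_independent:
  fixes p q r :: int
  assumes "of_int p + of_int q * mu + of_int r * mu\<^sup>2 = 0"
  shows "p = 0 \<and> q = 0 \<and> r = 0"
proof -
  have "of_int q = of_int r * lam"
    using arg_cong[OF assms, of Im] Im_mu_pos unfolding Im_mu_comb by simp
  then have "q = 0 \<and> r = 0" by (rule int_eq_lam_mult)
  with assms show ?thesis by simp
qed

text \<open>Reduction modulo \<open>t^3 - t - 2\<close> does not see which root is inserted, so both
  powers have the same integer coefficients. This allows a real power of \<open>mu\<close> to be
  compared with the same power of \<open>lam\<close>.\<close>

lemma root_power_expansion:
  "\<exists>a b c :: int. mu ^ m = of_int a + of_int b * mu + of_int c * mu\<^sup>2
      \<and> lam ^ m = of_int a + of_int b * lam + of_int c * lam\<^sup>2"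
proof (induction m)
  case 0
  show ?case by (intro exI[of _ 1] exI[of _ 0]) simp
next
  case (Suc m)
  then obtain a b c :: int where
    *: "mu ^ m = of_int a + of_int b * mu + of_int c * mu\<^sup>2"
       "lam ^ m = of_int a + of_int b * lam + of_int c * lam\<^sup>2" by blast
  have "mu ^ Suc m = of_int a * mu + of_int b * mu\<^sup>2 + of_int c * mu ^ 3"
    by (simp add: * algebra_simps power2_eq_square power3_eq_cube)
  moreover have "lam ^ Suc m = of_int a * lam + of_int b * lam\<^sup>2 + of_int c * lam ^ 3"
    by (simp add: * algebra_simps power2_eq_square power3_eq_cube)
  ultimately show ?case
    unfolding mu_cubed lam(3)
    by (intro exI[of _ "2 * c"] exI[of _ "a + c"] exI[of _ b]) (simp add: algebra_simps)
qed

text \<open>If a power of \<open>mu\<close> were real, it would be an integer, hence equal to the same power of the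
  conjugate root \<open>lam\<close>, which has larger modulus.\<close>

lemma mu_power_not_real:
  assumes "0 < m"
  shows "Im (mu ^ m) \<noteq> 0"
proof
  assume im: "Im (mu ^ m) = 0"
  obtain a b c :: int where
    *: "mu ^ m = of_int a + of_int b * mu + of_int c * mu\<^sup>2"
       "lam ^ m = of_int a + of_int b * lam + of_int c * lam\<^sup>2"
    using root_power_expansion by blast
  have "of_int b = of_int c * lam"
    using im Im_mu_pos unfolding * Im_mu_comb by simp
  then have "b = 0 \<and> c = 0" by (rule int_eq_lam_mult)
  then have "mu ^ m = of_real (lam ^ m)" using * by simp
  then have "cmod mu ^ m = lam ^ m"
    using lam(1) by (metis abs_of_nonneg le_less less_trans norm_of_real norm_power
        zero_le_power zero_less_divide_iff zero_less_numeral)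
  moreover have "cmod mu < lam"
    by (rule power2_less_imp_less) (use cmod_mu_sq lam in auto)
  then have "cmod mu ^ m < lam ^ m" using assms by (intro power_strict_mono) auto
  ultimately show False by simp
qed

text \<open>A negative product means that \<open>mu ^ n\<close> lies on different sides of the lines
  \<open>Re z = s * Im z\<close> and \<open>Re z = s' * Im z\<close>. The directions between two
  lines form a nonempty open set of angles, and the angles of the powers are dense because
  \<open>Arg mu / (2 * pi)\<close> is irrational.\<close>

lemma mu_powers_separate:
  assumes "s < s'"
  obtains n where "(Re (mu ^ n) - s * Im (mu ^ n)) * (Re (mu ^ n) - s' * Im (mu ^ n)) < 0"
proof -
  define \<theta> where "\<theta> = Arg mu / (2 * pi)"
  define g where "g = (\<lambda>x::real. (cos x - s * sin x) * (cos x - s' * sin x))"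
  have mu0: "mu \<noteq> 0" using Im_mu_pos by auto
  have pow: "mu ^ n = of_real (cmod mu ^ n) * cis (real n * Arg mu)" for n
  proof -
    have "mu ^ n = (of_real (cmod mu) * cis (Arg mu)) ^ n"
      using rcis_cmod_Arg[of mu] by (simp add: rcis_def)
    also have "\<dots> = of_real (cmod mu ^ n) * cis (real n * Arg mu)"
      by (simp add: power_mult_distrib Complex.DeMoivre)
    finally show ?thesis .
  qed
  have irr: "\<theta> \<notin> \<rat>"
  proof
    assume "\<theta> \<in> \<rat>"
    then obtain p :: int and q :: nat where pq: "q > 0" "\<theta> = of_int p / of_nat q"
      by (rule Rats_cases') (metis of_int_of_nat_eq zero_less_imp_eq_int)
    then have "real q * Arg mu = 2 * pi * of_int p"
      by (simp add: \<theta>_def field_simps)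
    then have "Im (mu ^ q) = 0" unfolding pow by simp
    with mu_power_not_real pq(1) show False by blast
  qed
  \<comment> \<open>A direction between the two lines: there the linear forms take the opposite
    values \<open>(s' - s) / 2\<close> and \<open>- (s' - s) / 2\<close>.\<close>
  define \<alpha> where "\<alpha> = Arg (Complex ((s + s') / 2) 1)"
  define w where "w = Complex ((s + s') / 2) 1"
  have w: "w = of_real (cmod w) * cis \<alpha>"
    using rcis_cmod_Arg[of w] by (simp add: rcis_def \<alpha>_def w_def)
  have w0: "cmod w > 0" by (auto simp: w_def complex_eq_iff)
  have "(Re w - s * Im w) * (Re w - s' * Im w) = - (((s' - s) / 2)\<^sup>2)"
    by (simp add: w_def power2_eq_square field_simps)
  then have "(Re w - s * Im w) * (Re w - s' * Im w) < 0"
    using assms by simp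
  moreover have "(Re w - s * Im w) * (Re w - s' * Im w) = (cmod w)\<^sup>2 * g \<alpha>"
    by (subst (1 2 3 4) w) (simp add: g_def power2_eq_square algebra_simps)
  ultimately have g\<alpha>: "g \<alpha> < 0" using w0 by (simp add: mult_less_0_iff)
  have "isCont g \<alpha>" unfolding g_def by (intro continuous_intros)
  \<comment> \<open>With tolerance \<open>- g \<alpha>\<close>, the function \<open>g\<close> stays
    negative on the whole neighbourhood.\<close>
  then obtain d where d: "d > 0" "\<And>x. \<bar>x - \<alpha>\<bar> < d \<Longrightarrow> \<bar>g x - g \<alpha>\<bar> < - g \<alpha>"
    using g\<alpha> unfolding continuous_at_eps_delta dist_real_def by (metis neg_0_less_iff_less)
  obtain h :: int and k where hk: "k > 0" "\<bar>of_int k * \<theta> - of_int h - \<alpha> / (2 * pi)\<bar> < d / (2 * pi)"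
    using sequence_of_fractional_parts_is_dense[OF irr, of "d / (2 * pi)" "\<alpha> / (2 * pi)"] d(1) pi_gt_zero by (metis divide_pos_pos mult_pos_pos zero_less_numeral)
  define n where "n = nat k"
  have "\<bar>2 * pi * (of_int k * \<theta> - of_int h - \<alpha> / (2 * pi))\<bar> < d"
    using hk(2) unfolding abs_mult by (simp add: pos_less_divide_eq mult.commute)
  moreover have "2 * pi * (of_int k * \<theta> - of_int h - \<alpha> / (2 * pi)) = real n * Arg mu - 2 * pi * of_int h - \<alpha>"
    using hk(1) by (simp add: n_def \<theta>_def field_simps)
  ultimately have "g (real n * Arg mu - 2 * pi * of_int h) < 0"
    using d(2)[of "real n * Arg mu - 2 * pi * of_int h"] by auto
  moreover have "g (real n * Arg mu - 2 * pi * of_int h) = g (real n * Arg mu)"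
    by (simp add: g_def cos_diff sin_diff)
  ultimately have "g (real n * Arg mu) < 0" by simp
  moreover have "(Re (mu ^ n) - s * Im (mu ^ n)) * (Re (mu ^ n) - s' * Im (mu ^ n))
      = (cmod mu ^ n)\<^sup>2 * g (real n * Arg mu)"
    unfolding pow by (simp add: g_def power2_eq_square algebra_simps)
  ultimately show ?thesis using that[of n] mu0 by (simp add: mult_less_0_iff)
qed


section \<open>Weights\<close>

text \<open>The weight of \<open>x\<^sup>A y\<^sup>B\<close> is read off the pair \<open>(A, B)\<close>; the matrix entry of an endomorphism that
  maps \<open>x\<^sup>T\<close> to \<open>x\<^sup>S\<close> is weighted like \<open>(S, T)\<close>.\<close>

definition wsum :: "(nat \<Rightarrow> 'a::ab_group_add) \<Rightarrow> nat set \<times> nat set \<Rightarrow> 'a" where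
  "wsum g m = sum g (snd m) - sum g (fst m)"

text \<open>As an argument of \<open>wsum\<close> it gives the net number of removals of
  \<open>x_i\<close>; these counts determine every other weight.\<close>

definition chi :: "nat \<Rightarrow> nat \<Rightarrow> int" where
  "chi i j = (if j = i then 1 else 0)"

definition zw :: "nat set \<times> nat set \<Rightarrow> complex" where "zw = wsum (\<lambda>i. mu ^ i)"
definition rw :: "nat set \<times> nat set \<Rightarrow> real" where "rw = wsum (\<lambda>i. lam ^ i)"

text \<open>Expand a product of generators by \<open>v\<^sub>i = \<partial>\<^sub>i + x\<^sub>i x\<^sub>i\<^sub>+\<^sub>1 v\<^sub>i\<^sub>+\<^sub>3\<close> and let \<open>n i\<close> be the number of times
  \<open>v\<^sub>i\<close> is met. Then \<open>x\<^sub>i\<close> is removed \<open>n i - n (i + 3)\<close> times and created \<open>n (i + 3) + n (i + 2)\<close> times,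
  whatever the order of the factors. (At \<open>i = 0\<close> there is no \<open>v\<^sub>-\<^sub>1\<close>, so \<open>n 0\<close> exceeds the count by \<open>n 2\<close>.)\<close>

definition wcone_witness :: "nat set \<times> nat set \<Rightarrow> (nat \<Rightarrow> nat) \<Rightarrow> bool" where
  "wcone_witness m n \<longleftrightarrow> (\<exists>N. \<forall>i\<ge>N. n i = 0)
     \<and> (\<forall>i. int (n i) = 2 * int (n (i + 3)) + int (n (i + 2)) + wsum (chi i) m)"

definition wcone :: "nat set \<times> nat set \<Rightarrow> bool" where
  "wcone m \<longleftrightarrow> (\<exists>n. wcone_witness m n)"

text \<open>The recursion for witnesses is linear, so witnesses add. The hypothesis speaks of index
  counts only and thus covers composition, products and brackets alike.\<close>

lemma wcone_add:
  assumes "wcone s" "wcone u" "\<And>i. wsum (chi i) t = wsum (chi i) s + wsum (chi i) u"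
  shows "wcone t"
proof -
  obtain n n' where "wcone_witness s n" "wcone_witness u n'"
    using assms(1,2) unfolding wcone_def by blast
  then obtain N N' where
    n: "\<forall>i\<ge>N. n i = 0" "\<forall>i. int (n i) = 2 * int (n (i + 3)) + int (n (i + 2)) + wsum (chi i) s" and
    n': "\<forall>i\<ge>N'. n' i = 0" "\<forall>i. int (n' i) = 2 * int (n' (i + 3)) + int (n' (i + 2)) + wsum (chi i) u"
    unfolding wcone_witness_def by blast
  have "wcone_witness t (\<lambda>i. n i + n' i)"
    unfolding wcone_witness_def
  proof
    show "\<exists>N. \<forall>i\<ge>N. n i + n' i = 0"
      using n(1) n'(1) by (intro exI[of _ "max N N'"]) auto
    show "\<forall>i. int (n i + n' i) = 2 * int (n (i + 3) + n' (i + 3)) + int (n (i + 2) + n' (i + 2))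
            + wsum (chi i) t"
    proof
      fix i
      show "int (n i + n' i) = 2 * int (n (i + 3) + n' (i + 3)) + int (n (i + 2) + n' (i + 2))
              + wsum (chi i) t"
        using spec[OF n(2), of i] spec[OF n'(2), of i] assms(3)[of i]
        unfolding of_nat_add by algebra
    qed
  qed
  then show ?thesis unfolding wcone_def by blast
qed

lemma wsum_chi:
  "finite (fst m) \<Longrightarrow> finite (snd m) \<Longrightarrow>
    wsum (chi i) m = (if i \<in> snd m then 1 else 0) - (if i \<in> fst m then 1 else 0)"
  by (simp add: wsum_def chi_def sum.delta)

lemma wsum_power_bounded:
  fixes x :: "'a::comm_ring_1"
  assumes "finite (fst m)" "finite (snd m)" "fst m \<union> snd m \<subseteq> {..<J}"
  shows "wsum (\<lambda>i. x ^ i) m = (\<Sum>i<J. of_int (wsum (chi i) m) * x ^ i)"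
proof -
  have ind: "sum (\<lambda>i. x ^ i) C = (\<Sum>i<J. (if i \<in> C then 1 else 0) * x ^ i)" if "C \<subseteq> {..<J}" for C
    using that by (simp add: if_distrib[of "\<lambda>y. y * _"] sum.If_cases Int_absorb1 cong: if_cong)
  have "wsum (\<lambda>i. x ^ i) m = (\<Sum>i<J. ((if i \<in> snd m then 1 else 0) - (if i \<in> fst m then 1 else 0)) * x ^ i)"
    using assms(3) by (simp add: wsum_def ind left_diff_distrib sum_subtractf)
  also have "\<dots> = (\<Sum>i<J. of_int (wsum (chi i) m) * x ^ i)"
    by (intro sum.cong) (auto simp: wsum_chi assms)
  finally show ?thesis .
qed

text \<open>Closed form of the tail sum of \<open>wsum (chi i) m * x ^ (i - j)\<close> over
  \<open>i \<ge> j\<close>. Inserting the recursion of the witness, all \<open>n i\<close> with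
  \<open>i \<ge> j + 3\<close> cancel by \<open>x ^ 3 = x + 2\<close>, and the three boundary terms
  are left.\<close>

definition remainder :: "'a::comm_ring_1 \<Rightarrow> (nat \<Rightarrow> nat) \<Rightarrow> nat \<Rightarrow> 'a" where
  "remainder x n j = of_nat (n j) + x * of_nat (n (j + 1)) + (x\<^sup>2 - 1) * of_nat (n (j + 2))"

lemma remainder_step:
  fixes x :: "'a::comm_ring_1"
  assumes "x ^ 3 = x + 2" "wcone_witness m n"
  shows "remainder x n j = of_int (wsum (chi j) m) + x * remainder x n (j + 1)"
proof -
  have "int (n j) = 2 * int (n (j + 3)) + int (n (j + 2)) + wsum (chi j) m"
    using assms(2) unfolding wcone_witness_def by blast
  from arg_cong[OF this, of "of_int :: int \<Rightarrow> 'a"]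
  have nj: "(of_nat (n j) :: 'a) = 2 * of_nat (n (j + 3)) + of_nat (n (j + 2)) + of_int (wsum (chi j) m)"
    by simp
  have shift: "j + 1 + 1 = j + 2" "j + 1 + 2 = j + 3" by simp_all
  have "x * remainder x n (j + 1)
      = x * of_nat (n (j + 1)) + x\<^sup>2 * of_nat (n (j + 2)) + (x ^ 3 - x) * of_nat (n (j + 3))"
    unfolding remainder_def shift by (simp add: algebra_simps power2_eq_square power3_eq_cube)
  also have "x ^ 3 - x = 2" using assms(1) by simp
  finally show ?thesis unfolding remainder_def nj by (simp add: algebra_simps)
qed

text \<open>Horner's scheme, started beyond all indices of the monomial and of the witness. The
  weight therefore depends only on \<open>n 0\<close>, \<open>n 1\<close> and
  \<open>n 2\<close>.\<close>

lemma wsum_power_eq_remainder: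
  fixes x :: "'a::comm_ring_1"
  assumes "x ^ 3 = x + 2" "wcone_witness m n" "finite (fst m)" "finite (snd m)"
  shows "wsum (\<lambda>i. x ^ i) m = remainder x n 0"
proof -
  obtain N where N: "\<forall>i\<ge>N. n i = 0" using assms(2) unfolding wcone_witness_def by blast
  have "finite (fst m \<union> snd m)" using assms by simp
  then obtain M where M: "fst m \<union> snd m \<subseteq> {..<M}"
    using finite_nat_iff_bounded by blast
  define J where "J = max N M"
  have "remainder x n 0 = (\<Sum>i<J. of_int (wsum (chi i) m) * x ^ i) + x ^ J * remainder x n J" for J
  proof (induction J)
    case (Suc J)
    then show ?case
      by (simp add: remainder_step[OF assms(1,2), of J] algebra_simps)
  qed simp
  moreover have "remainder x n J = 0" using N by (simp add: remainder_def J_def)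
  moreover have "wsum (\<lambda>i. x ^ i) m = (\<Sum>i<J. of_int (wsum (chi i) m) * x ^ i)"
    by (rule wsum_power_bounded) (use M assms J_def in auto)
  ultimately show ?thesis by (metis add.right_neutral mult_zero_right)
qed

text \<open>Here it matters that witnesses take values in \<open>nat\<close>: the coefficients
  \<open>1\<close>, \<open>lam\<close> and \<open>lam^2 - 1\<close> are positive.\<close>

lemma remainder_lam_nonneg: "0 \<le> remainder lam n j"
  using lam lam_sq unfolding remainder_def
  by (intro add_nonneg_nonneg mult_nonneg_nonneg) auto

lemma cmod_mu_bounds: "cmod mu \<le> 2" "cmod (mu\<^sup>2 - 1) \<le> lam\<^sup>2"
proof -
  show "cmod mu \<le> 2"
    by (rule power2_le_imp_le) (use cmod_mu_sq lam_sq in auto)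
  have "cmod (mu\<^sup>2 - 1) \<le> (cmod mu)\<^sup>2 + 1"
    by (metis norm_one norm_power norm_triangle_ineq4)
  then show "cmod (mu\<^sup>2 - 1) \<le> lam\<^sup>2" unfolding cmod_mu_sq by simp
qed

text \<open>Coefficientwise comparison: \<open>|mu| \<le> 2 \<le> 2 * lam\<close> and
  \<open>|mu^2 - 1| \<le> lam^2 \<le> 2 * (lam^2 - 1)\<close>.\<close>

lemma remainder_mu_linear_bound: "cmod (remainder mu n j) \<le> 2 * remainder lam n j"
proof -
  have "cmod (remainder mu n j)
      \<le> real (n j) + cmod mu * real (n (j + 1)) + cmod (mu\<^sup>2 - 1) * real (n (j + 2))"
    using norm_triangle_ineq[of "of_nat (n j) + mu * of_nat (n (j + 1))" "(mu\<^sup>2 - 1) * of_nat (n (j + 2))"]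
      norm_triangle_ineq[of "of_nat (n j) :: complex" "mu * of_nat (n (j + 1))"]
    unfolding remainder_def by (simp only: norm_mult norm_of_nat)
  also have "\<dots> \<le> 2 * real (n j) + (2 * lam) * real (n (j + 1)) + (2 * (lam\<^sup>2 - 1)) * real (n (j + 2))"
    using cmod_mu_bounds lam lam_sq by (intro add_mono mult_right_mono) auto
  also have "\<dots> = 2 * remainder lam n j" by (simp add: remainder_def algebra_simps)
  finally show ?thesis .
qed

text \<open>The step loses a factor \<open>|mu|\<^sup>2 / lam < 1\<close>, which absorbs the error terms once \<open>r\<close> is large;
  for small \<open>r\<close> the linear bound is enough.\<close>

lemma square_bound_step:
  fixes y z r r' :: real
  assumes z: "0 \<le> z" "z \<le> cmod mu * y + 1" "z \<le> 2 * r" and y: "0 \<le> y" "y\<^sup>2 \<le> 130 * r'"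
    and r: "lam * r' \<le> r + 1" "0 \<le> r"
  shows "z\<^sup>2 \<le> 130 * r"
\<comment> \<open>Threshold and constant are matched: below, \<open>4 * 30 \<le> 130\<close>; above,
  \<open>1.1 * 0.877 * 130 * (r + 1) + 11 \<le> 130 * r\<close>.\<close>
proof (cases "r \<le> 30")
  case True
  have "z\<^sup>2 \<le> (2 * r)\<^sup>2" using z by (intro power_mono) auto
  also have "\<dots> = 4 * r * r" by (simp add: power2_eq_square)
  also have "\<dots> \<le> 4 * r * 30" using True r by (intro mult_left_mono) auto
  also have "\<dots> \<le> 130 * r" using r by simp
  finally show ?thesis .
next
  case False
  define a where "a = cmod mu * y"
  have a0: "0 \<le> a" using y by (simp add: a_def)
  have "a\<^sup>2 = (lam\<^sup>2 - 1) * y\<^sup>2" by (simp add: a_def power_mult_distrib cmod_mu_sq)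
  also have "\<dots> \<le> (lam\<^sup>2 - 1) * (130 * r')" using lam_sq y by (intro mult_left_mono) auto
  finally have "lam * a\<^sup>2 \<le> lam * ((lam\<^sup>2 - 1) * (130 * r'))" using lam(1) by (intro mult_left_mono) auto
  also have "\<dots> = (lam\<^sup>2 - 1) * 130 * (lam * r')" by simp
  also have "\<dots> \<le> (lam\<^sup>2 - 1) * 130 * (r + 1)" using r lam_sq by (intro mult_left_mono) auto
  finally have 1: "lam * a\<^sup>2 \<le> (lam\<^sup>2 - 1) * 130 * (r + 1)" .
  \<comment> \<open>This bounds the contraction factor
    \<open>|mu|^2 / lam = (lam^2 - 1) / lam\<close> by 877/1000.\<close>
  have "lam * (lam - 877 / 1000) < (153/100) * (153/100 - 877/1000)"
    using lam by (intro mult_strict_mono) auto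
  then have "lam\<^sup>2 - 1 \<le> (877 / 1000) * lam" by (simp add: power2_eq_square algebra_simps)
  then have "(lam\<^sup>2 - 1) * (130 * (r + 1)) \<le> ((877 / 1000) * lam) * (130 * (r + 1))"
    using r by (intro mult_right_mono) auto
  with 1 have "lam * a\<^sup>2 \<le> ((877 / 1000) * lam) * (130 * (r + 1))"
    unfolding mult.assoc by (rule order_trans)
  also have "\<dots> = lam * ((877 / 1000) * (130 * (r + 1)))" by simp
  finally have 2: "a\<^sup>2 \<le> (877 / 1000) * (130 * (r + 1))" using lam(1) by simp
  have "z\<^sup>2 \<le> (a + 1)\<^sup>2" using z(1,2) by (intro power_mono) (auto simp: a_def)
  \<comment> \<open>Young's inequality \<open>2 * a \<le> a^2 / 10 + 10\<close>: the additive error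
    costs only a factor 11/10, and \<open>1.1 * 0.877 < 1\<close>.\<close>
  also have "\<dots> \<le> (11 / 10) * a\<^sup>2 + 11"
    using zero_le_power2[of "a / 10 - 1"] by (simp add: power2_eq_square algebra_simps)
  also have "\<dots> \<le> 130 * r" using 2 False by simp
  finally show ?thesis .
qed

text \<open>Induction along the tails from level \<open>N\<close>, where both remainders are 0, down
  to level 0. The errors are at most 1 in modulus because a monomial contains each index at most
  once on either side.\<close>

lemma wcone_square_bound:
  assumes "wcone m" "finite (fst m)" "finite (snd m)"
  shows "(cmod (zw m))\<^sup>2 \<le> 130 * rw m"
proof -
  obtain n where n: "wcone_witness m n" using assms(1) unfolding wcone_def by blast
  then obtain N where N: "\<forall>i\<ge>N. n i = 0" unfolding wcone_witness_def by blast
  have eps: "\<bar>wsum (chi j) m\<bar> \<le> 1" for j by (simp add: wsum_chi assms)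
  have "(cmod (remainder mu n (N - k)))\<^sup>2 \<le> 130 * remainder lam n (N - k)" for k
  proof (induction k)
    case 0
    then show ?case using N by (simp add: remainder_def)
  next
    case (Suc k)
    show ?case
    \<comment> \<open>Truncated subtraction: once level 0 is reached, \<open>N - Suc k\<close> is 0
      as well and nothing changes.\<close>
    proof (cases "N - k = 0")
      case False
      define j where "j = N - Suc k"
      have j: "N - k = j + 1" using False by (simp add: j_def)
      have IH: "(cmod (remainder mu n (j + 1)))\<^sup>2 \<le> 130 * remainder lam n (j + 1)"
        using Suc unfolding j .
      have "cmod (of_int (wsum (chi j) m)) \<le> 1" using eps[of j] by simp
      moreover have "cmod (remainder mu n j)
          \<le> cmod (of_int (wsum (chi j) m)) + cmod mu * cmod (remainder mu n (j + 1))"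
        unfolding remainder_step[OF mu_cubed n, of j] by (metis norm_mult norm_triangle_ineq)
      ultimately have 1: "cmod (remainder mu n j) \<le> cmod mu * cmod (remainder mu n (j + 1)) + 1"
        by linarith
      have "\<bar>real_of_int (wsum (chi j) m)\<bar> \<le> 1" using eps[of j] by linarith
      then have 2: "lam * remainder lam n (j + 1) \<le> remainder lam n j + 1"
        unfolding remainder_step[OF lam(3) n, of j] by linarith
      show ?thesis
        using square_bound_step[OF norm_ge_zero 1 remainder_mu_linear_bound norm_ge_zero IH 2 remainder_lam_nonneg]
        unfolding j_def .
    qed (use Suc in auto)
  qed
  from this[of N] show ?thesis
    unfolding zw_def rw_def wsum_power_eq_remainder[OF mu_cubed n assms(2,3)]
      wsum_power_eq_remainder[OF lam(3) n assms(2,3)] by simp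
qed

section \<open>Planes through the axis that avoid the weights\<close>

definition zlattice :: "complex set" where
  "zlattice = (\<lambda>(p, q, r). of_int p + of_int q * mu + of_int r * mu\<^sup>2) ` (UNIV :: (int \<times> int \<times> int) set)"

lemma countable_zlattice: "countable zlattice"
  unfolding zlattice_def by (intro countable_image countableI_type)

text \<open>The weight is the combination of \<open>1, mu, mu^2\<close> with coefficients
  \<open>n 0 - n 2\<close>, \<open>n 1\<close>, \<open>n 2\<close>. If it is 0, independence makes
  these three numbers vanish, and \<open>rw m\<close> is the same combination of powers of
  \<open>lam\<close>.\<close>

lemma wcone_zw:
  assumes "wcone m" "finite (fst m)" "finite (snd m)"
  shows "zw m \<in> zlattice" and "zw m = 0 \<longrightarrow> rw m = 0"
proof -
  obtain n where n: "wcone_witness m n" using assms(1) unfolding wcone_def by blast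
  have z: "zw m = of_int (int (n 0) - int (n 2)) + of_int (int (n 1)) * mu + of_int (int (n 2)) * mu\<^sup>2"
    unfolding zw_def wsum_power_eq_remainder[OF mu_cubed n assms(2,3)]
    by (simp add: remainder_def algebra_simps numeral_2_eq_2[symmetric])
  then show "zw m \<in> zlattice" unfolding zlattice_def
    by (intro image_eqI[where x = "(int (n 0) - int (n 2), int (n 1), int (n 2))"]) simp_all
  show "zw m = 0 \<longrightarrow> rw m = 0"
  proof
    assume "zw m = 0"
    with mu_independent z have "int (n 0) - int (n 2) = 0" "int (n 1) = 0" "int (n 2) = 0" by metis+
    then show "rw m = 0"
      unfolding rw_def wsum_power_eq_remainder[OF lam(3) n assms(2,3)]
      by (simp add: remainder_def numeral_2_eq_2[symmetric])
  qed
qed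

definition lin :: "real \<Rightarrow> complex \<Rightarrow> real" where
  "lin s z = Re z - s * Im z"

lemma lin_add: "lin s (a + b) = lin s a + lin s b"
  by (simp add: lin_def algebra_simps)

lemma lin_bound: "\<bar>lin s z\<bar> \<le> (1 + \<bar>s\<bar>) * cmod z"
proof -
  have "\<bar>lin s z\<bar> \<le> \<bar>Re z\<bar> + \<bar>s\<bar> * \<bar>Im z\<bar>"
    unfolding lin_def by (metis abs_mult abs_triangle_ineq4)
  also have "\<dots> \<le> cmod z + \<bar>s\<bar> * cmod z"
    by (intro add_mono mult_left_mono abs_Re_le_cmod abs_Im_le_cmod) auto
  finally show ?thesis by (simp add: algebra_simps)
qed

text \<open>For \<open>Im z \<noteq> 0\<close> the equation \<open>lin s z = 0\<close> means
  \<open>s = Re z / Im z\<close>, so each such lattice point forbids one slope. Real lattice points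
  contribute 0 by the convention for division by zero.\<close>

definition good_slopes :: "real set" where
  "good_slopes = - ((\<lambda>z. Re z / Im z) ` zlattice)"

lemma lin_good_slope:
  assumes "s \<in> good_slopes" "z \<in> zlattice" "lin s z = 0"
  shows "z = 0"
proof (cases "Im z = 0")
  case False
  then have "s = Re z / Im z" using assms(3) by (simp add: lin_def field_simps)
  with assms(1,2) show ?thesis unfolding good_slopes_def by blast
qed (use assms(3) in \<open>simp add: lin_def complex_eq_iff\<close>)

lemma wcone_lin_nonzero:
  assumes "wcone m" "finite (fst m)" "finite (snd m)" "0 < rw m" "s \<in> good_slopes"
  shows "lin s (zw m) \<noteq> 0"
  using lin_good_slope[OF assms(5) wcone_zw(1)[OF assms(1-3)]] wcone_zw(2)[OF assms(1-3)] assms(4) by auto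

text \<open>If \<open>good_slopes\<close> had fewer elements than the real line, then so would its
  union with the countable complement, which is the whole line.\<close>

lemma injection_into_good_slopes:
  obtains h :: "real \<Rightarrow> real" where "inj h" "range h \<subseteq> good_slopes"
proof -
  let ?B = "(\<lambda>z. Re z / Im z) ` zlattice"
  have B: "countable ?B" using countable_zlattice by blast
  have inf: "infinite (UNIV :: real set)" by (rule infinite_UNIV_char_0)
  have "\<not> (card_of good_slopes, card_of (UNIV :: real set)) \<in> ordLess"
  proof
    assume 1: "(card_of good_slopes, card_of (UNIV :: real set)) \<in> ordLess"
    have "(card_of ?B, card_of (UNIV :: real set)) \<in> ordLess"
    proof (rule ccontr)
      assume "\<not> (card_of ?B, card_of (UNIV :: real set)) \<in> ordLess"
      then have "(card_of (UNIV :: real set), card_of ?B) \<in> ordLeq"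
        by (metis card_of_Well_order not_ordLess_iff_ordLeq)
      then obtain f :: "real \<Rightarrow> real" where "inj_on f UNIV" "f ` UNIV \<subseteq> ?B"
        using card_of_ordLeq[of "UNIV :: real set" ?B] by blast
      then have "countable (UNIV :: real set)"
        using B by (metis countable_image_inj_on countable_subset)
      then show False using uncountable_UNIV_real by blast
    qed
    from card_of_Un_ordLess_infinite[OF inf 1 this]
    have "(card_of (UNIV :: real set), card_of (UNIV :: real set)) \<in> ordLess"
      by (simp add: good_slopes_def)
    then show False using ordLess_irreflexive by blast
  qed
  then have "(card_of (UNIV :: real set), card_of good_slopes) \<in> ordLeq"
    by (metis card_of_Well_order not_ordLess_iff_ordLeq)
  then obtain h :: "real \<Rightarrow> real" where "inj h" "range h \<subseteq> good_slopes"
    using card_of_ordLeq[of "UNIV :: real set" good_slopes] by blast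
  then show ?thesis by (rule that)
qed


section \<open>Decompositions defined by weights\<close>

definition supp :: "('i \<Rightarrow> 'k::zero) \<Rightarrow> 'i set" where
  "supp a = {t. a t \<noteq> 0}"

lemma supp_z0 [simp]: "supp z0 = {}"
  by (simp add: supp_def z0_def)

lemma supp_empty_iff: "supp a = {} \<longleftrightarrow> a = z0"
  by (auto simp: supp_def z0_def)

lemma supp_vadd: "supp (vadd a b) \<subseteq> supp a \<union> supp b"
  by (auto simp: supp_def vadd_def)

lemma supp_vsc: "supp (vsc c a) \<subseteq> supp a"
  by (auto simp: supp_def vsc_def)

lemma vadd_z0 [simp]: "vadd a z0 = a" "vadd z0 a = a"
  by (auto simp: vadd_def z0_def)

lemma generated_incl: "G \<subseteq> generated pe ops sq G"
  by (auto simp: generated_def)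

lemma generated_least: "is_subalg pe ops sq S \<Longrightarrow> G \<subseteq> S \<Longrightarrow> generated pe ops sq G \<subseteq> S"
  by (auto simp: generated_def)

lemma lin_subD:
  assumes "lin_sub S"
  shows "z0 \<in> S" "a \<in> S \<Longrightarrow> b \<in> S \<Longrightarrow> vadd a b \<in> S" "a \<in> S \<Longrightarrow> vsc c a \<in> S"
    "a \<in> S \<Longrightarrow> b \<in> S \<Longrightarrow> vsub a b \<in> S"
proof -
  show 1: "z0 \<in> S" "a \<in> S \<Longrightarrow> b \<in> S \<Longrightarrow> vadd a b \<in> S" "a \<in> S \<Longrightarrow> vsc c a \<in> S" for a b c
    using assms by (auto simp: lin_sub_def)
  have "vsub a b = vadd a (vsc (- 1) b)" by (simp add: vsub_def vadd_def vsc_def)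
  then show "a \<in> S \<Longrightarrow> b \<in> S \<Longrightarrow> vsub a b \<in> S" using 1 by simp
qed

lemma is_subalgD:
  assumes "is_subalg pe ops sq S"
  shows "lin_sub S" "a \<in> S \<Longrightarrow> pe a \<in> S" "f \<in> set ops \<Longrightarrow> a \<in> S \<Longrightarrow> b \<in> S \<Longrightarrow> f a b \<in> S"
    "a \<in> S \<Longrightarrow> pe a = z0 \<Longrightarrow> sq a \<in> S"
  using assms by (auto simp: is_subalg_def)

lemma is_subalg_generated: "is_subalg pe ops sq (generated pe ops sq G)"
proof -
  let ?A = "generated pe ops sq G"
  have A: "x \<in> ?A \<longleftrightarrow> (\<forall>S. is_subalg pe ops sq S \<and> G \<subseteq> S \<longrightarrow> x \<in> S)" for x
    by (auto simp: generated_def)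
  show ?thesis
    unfolding is_subalg_def[of _ _ _ ?A] lin_sub_def[of ?A]
  proof (intro conjI ballI allI impI)
    show "z0 \<in> ?A" unfolding A using lin_subD(1)[OF is_subalgD(1)] by blast
    show "vadd a b \<in> ?A" if "a \<in> ?A" "b \<in> ?A" for a b
      using that unfolding A using lin_subD(2)[OF is_subalgD(1)] by blast
    show "vsc c a \<in> ?A" if "a \<in> ?A" for c a
      using that unfolding A using lin_subD(3)[OF is_subalgD(1)] by blast
    show "pe a \<in> ?A" if "a \<in> ?A" for a
      using that unfolding A using is_subalgD(2)[of pe ops sq _ a] by blast
    show "f a b \<in> ?A" if "f \<in> set ops" "a \<in> ?A" "b \<in> ?A" for f a b
      using that unfolding A using is_subalgD(3)[of pe ops sq _ f a b] by blast
    show "sq a \<in> ?A" if "a \<in> ?A" "pe a = z0" for a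
      using that unfolding A using is_subalgD(4)[of pe ops sq _ a] by blast
  qed
qed

text \<open>Inequalities instead of equalities, because the shifted weights needed for the doubles
  are only superadditive.\<close>

definition superadd_op ::
  "'i set \<Rightarrow> ('i \<Rightarrow> real) \<Rightarrow> ('i \<Rightarrow> real) \<Rightarrow> (('i \<Rightarrow> 'k::field) \<Rightarrow> ('i \<Rightarrow> 'k) \<Rightarrow> 'i \<Rightarrow> 'k) \<Rightarrow> bool" where
  "superadd_op G om r f \<longleftrightarrow> (\<forall>a b t. supp a \<subseteq> G \<longrightarrow> supp b \<subseteq> G \<longrightarrow> t \<in> supp (f a b) \<longrightarrow>
     t \<in> G \<and> (\<exists>s\<in>supp a. \<exists>u\<in>supp b. om s + om u \<le> om t \<and> r t \<le> r s + r u))"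

lemma mons_weight_bounds:
  assumes "(x, n, p) \<in> mons pe ops sq X"
    and op: "\<And>f. f \<in> set ops \<Longrightarrow> superadd_op G om r f"
    and sq: "\<And>a t. supp a \<subseteq> G \<Longrightarrow> t \<in> supp (sq a) \<Longrightarrow>
      t \<in> G \<and> (\<exists>s\<in>supp a. \<exists>u\<in>supp a. om s + om u \<le> om t \<and> r t \<le> r s + r u)"
    and X: "\<And>x t. x \<in> X \<Longrightarrow> t \<in> supp x \<Longrightarrow> t \<in> G \<and> d \<le> om t \<and> r t \<le> R"
  shows "\<forall>t\<in>supp x. t \<in> G \<and> real n * d \<le> om t \<and> r t \<le> real n * R"
  using assms(1)
proof (induction rule: mons.induct)
  case (mgen x p)
  then show ?case using X by auto
next
  case (mop a m p b n q f)
  show ?case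
  proof
    fix t assume t: "t \<in> supp (f a b)"
    have "supp a \<subseteq> G" "supp b \<subseteq> G" using mop.IH by auto
    with op[OF mop.hyps(3)] t obtain s u where "t \<in> G" "s \<in> supp a" "u \<in> supp b"
      "om s + om u \<le> om t" "r t \<le> r s + r u"
      unfolding superadd_op_def by meson
    moreover from this have "real m * d \<le> om s" "real n * d \<le> om u" "r s \<le> real m * R" "r u \<le> real n * R"
      using mop.IH by auto
    ultimately show "t \<in> G \<and> real (m + n) * d \<le> om t \<and> r t \<le> real (m + n) * R"
      by (simp add: distrib_right)
  qed
next
  case (msq a m)
  show ?case
  proof
    fix t assume t: "t \<in> supp (sq a)"
    have "supp a \<subseteq> G" using msq.IH by auto
    with sq t obtain s u where "t \<in> G" "s \<in> supp a" "u \<in> supp a"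
      "om s + om u \<le> om t" "r t \<le> r s + r u" by meson
    moreover from this have "real m * d \<le> om s" "real m * d \<le> om u" "r s \<le> real m * R" "r u \<le> real m * R"
      using msq.IH by auto
    ultimately show "t \<in> G \<and> real (2 * m) * d \<le> om t \<and> r t \<le> real (2 * m) * R"
      by simp
  qed
qed

definition weight_data ::
  "(('i \<Rightarrow> 'k::field) \<Rightarrow> ('i \<Rightarrow> 'k) \<Rightarrow> 'i \<Rightarrow> 'k) list \<Rightarrow> (('i \<Rightarrow> 'k) \<Rightarrow> 'i \<Rightarrow> 'k)
    \<Rightarrow> ('i \<Rightarrow> 'k) set \<Rightarrow> 'i set \<Rightarrow> ('i \<Rightarrow> real) \<Rightarrow> ('i \<Rightarrow> real) \<Rightarrow> real \<Rightarrow> real \<Rightarrow> real \<Rightarrow> bool" where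
  "weight_data ops sq X G om r d R k \<longleftrightarrow> 0 < d
      \<and> (\<forall>f\<in>set ops. superadd_op G om r f)
      \<and> (\<forall>a t. supp a \<subseteq> G \<longrightarrow> t \<in> supp (sq a) \<longrightarrow>
           t \<in> G \<and> (\<exists>s\<in>supp a. \<exists>u\<in>supp a. om s + om u \<le> om t \<and> r t \<le> r s + r u))
      \<and> (\<forall>x\<in>X. \<forall>t\<in>supp x. t \<in> G \<and> d \<le> om t \<and> r t \<le> R)
      \<and> 0 \<le> k \<and> (\<forall>t\<in>G. 0 \<le> om t \<longrightarrow> (om t)\<^sup>2 \<le> k * r t)"

text \<open>A product of \<open>n\<close> generators has \<open>om\<close> at least linear in \<open>n\<close>, but \<open>om\<close> is \<open>O(sqrt n)\<close>.\<close>

lemma loc_nilpI: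
  fixes pe :: "('i \<Rightarrow> 'k::field) \<Rightarrow> ('i \<Rightarrow> 'k)"
  assumes "\<And>X. finite X \<Longrightarrow> X \<subseteq> L \<Longrightarrow> \<exists>G om r d R k. weight_data ops sq X G om r d R k"
  shows "loc_nilp pe ops sq L"
  unfolding loc_nilp_def
proof (intro allI impI)
  fix X assume X: "finite X \<and> X \<subseteq> L \<and> (\<forall>x\<in>X. homog pe x)"
  then obtain G om r d R k where data: "weight_data ops sq X G om r d R k"
    using assms[of X] by blast
  have d: "0 < d" and op: "\<forall>f\<in>set ops. superadd_op G om r f"
    and sq: "\<forall>a t. supp a \<subseteq> G \<longrightarrow> t \<in> supp (sq a) \<longrightarrow>
           t \<in> G \<and> (\<exists>s\<in>supp a. \<exists>u\<in>supp a. om s + om u \<le> om t \<and> r t \<le> r s + r u)"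
    and gen: "\<forall>x\<in>X. \<forall>t\<in>supp x. t \<in> G \<and> d \<le> om t \<and> r t \<le> R"
    and k: "0 \<le> k" "\<forall>t\<in>G. 0 \<le> om t \<longrightarrow> (om t)\<^sup>2 \<le> k * r t"
    using data unfolding weight_data_def by simp_all
  \<comment> \<open>From this degree on, \<open>(n * d)^2 \<le> k * (n * R)\<close> is
    impossible.\<close>
  define N where "N = nat \<lceil>k * R / d\<^sup>2\<rceil> + 1"
  show "\<exists>N. \<forall>w n p. (w, n, p) \<in> mons pe ops sq X \<and> N \<le> n \<longrightarrow> w = z0"
  proof (intro exI[of _ N] allI impI)
    fix w n p assume w: "(w, n, p) \<in> mons pe ops sq X \<and> N \<le> n"
    have "supp w = {}"
    proof (rule ccontr)
      assume "supp w \<noteq> {}"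
      then obtain t where t: "t \<in> supp w" by blast
      have *: "t \<in> G" "real n * d \<le> om t" "r t \<le> real n * R"
        using mons_weight_bounds[of w n p pe ops sq X G om r d R, OF conjunct1[OF w]
            bspec[OF op] mp[OF mp[OF spec[OF spec[OF sq]]]] bspec[OF bspec[OF gen]]] t by simp_all
      have nN: "real N \<le> real n" "0 < real n" using w by (auto simp: N_def)
      have "0 \<le> real n * d" using d by simp
      then have "(real n * d)\<^sup>2 \<le> (om t)\<^sup>2" using * by (intro power_mono) auto
      also have "\<dots> \<le> k * r t" using * \<open>0 \<le> real n * d\<close> by (intro mp[OF bspec[OF k(2)]]) auto
      also have "\<dots> \<le> k * (real n * R)" using * k by (intro mult_left_mono) auto
      finally have "real n * (real n * d\<^sup>2) \<le> real n * (k * R)"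
        by (simp add: power2_eq_square mult_ac)
      then have "real n * d\<^sup>2 \<le> k * R" using nN by simp
      then have "real n \<le> k * R / d\<^sup>2" using d by (simp add: pos_le_divide_eq)
      moreover have "k * R / d\<^sup>2 < real N" unfolding N_def by linarith
      ultimately show False using nN by linarith
    qed
    then show "w = z0" by (simp add: supp_empty_iff)
  qed
qed

text \<open>The substantial hypothesis is \<open>restr\<close>: cutting a coefficient function down
  to some indices need not stay in \<open>L\<close>. It is obtained from the grading of
  \<open>L\<close>.\<close>

lemma is_decomp_split:
  assumes L: "is_subalg pe ops sq L"
    and pe: "\<And>a t. t \<in> supp (pe a) \<Longrightarrow> t \<in> supp a"
    and I: "I1 \<inter> I2 = {}" "\<And>a. a \<in> L \<Longrightarrow> supp a \<subseteq> I1 \<union> I2"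
    and restr: "\<And>a. a \<in> L \<Longrightarrow> (\<lambda>t. if t \<in> I1 then a t else 0) \<in> L"
      "\<And>a. a \<in> L \<Longrightarrow> (\<lambda>t. if t \<in> I2 then a t else 0) \<in> L"
    and op: "\<And>f a b J. f \<in> set ops \<Longrightarrow> J \<in> {I1, I2} \<Longrightarrow> a \<in> L \<Longrightarrow> b \<in> L \<Longrightarrow> supp a \<subseteq> J \<Longrightarrow> supp b \<subseteq> J
        \<Longrightarrow> supp (f a b) \<subseteq> J"
    and sq: "\<And>a J. J \<in> {I1, I2} \<Longrightarrow> a \<in> L \<Longrightarrow> supp a \<subseteq> J \<Longrightarrow> supp (sq a) \<subseteq> J"
    and nilp: "loc_nilp pe ops sq {a \<in> L. supp a \<subseteq> I1}" "loc_nilp pe ops sq {a \<in> L. supp a \<subseteq> I2}"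
  shows "is_decomp pe ops sq L {a \<in> L. supp a \<subseteq> I1} {a \<in> L. supp a \<subseteq> I2}"
  unfolding is_decomp_def
proof (intro conjI nilp ballI)
  have sub: "is_subalg pe ops sq {a \<in> L. supp a \<subseteq> J}" if J: "J \<in> {I1, I2}" for J
    unfolding is_subalg_def lin_sub_def
  proof (intro conjI ballI allI impI)
    show "z0 \<in> {a \<in> L. supp a \<subseteq> J}" using lin_subD(1)[OF is_subalgD(1)[OF L]] by simp
    show "vadd a b \<in> {a \<in> L. supp a \<subseteq> J}"
      if "a \<in> {a \<in> L. supp a \<subseteq> J}" "b \<in> {a \<in> L. supp a \<subseteq> J}" for a b
      using that lin_subD(2)[OF is_subalgD(1)[OF L], of a b] supp_vadd[of a b] by blast
    show "vsc c a \<in> {a \<in> L. supp a \<subseteq> J}" if "a \<in> {a \<in> L. supp a \<subseteq> J}" for c a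
      using that lin_subD(3)[OF is_subalgD(1)[OF L], of a c] supp_vsc[of c a] by blast
    show "pe a \<in> {a \<in> L. supp a \<subseteq> J}" if "a \<in> {a \<in> L. supp a \<subseteq> J}" for a
      using that is_subalgD(2)[OF L, of a] pe[of _ a] by blast
    show "f a b \<in> {a \<in> L. supp a \<subseteq> J}"
      if "f \<in> set ops" "a \<in> {a \<in> L. supp a \<subseteq> J}" "b \<in> {a \<in> L. supp a \<subseteq> J}" for f a b
      using that is_subalgD(3)[OF L, of f a b] op[OF that(1) J, of a b] by blast
    show "sq a \<in> {a \<in> L. supp a \<subseteq> J}" if "a \<in> {a \<in> L. supp a \<subseteq> J}" "pe a = z0" for a
      using that is_subalgD(4)[OF L, of a] sq[OF J, of a] by blast
  qed
  show "is_subalg pe ops sq {a \<in> L. supp a \<subseteq> I1}" "is_subalg pe ops sq {a \<in> L. supp a \<subseteq> I2}"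
    using sub by auto
  show "{a \<in> L. supp a \<subseteq> I1} \<inter> {a \<in> L. supp a \<subseteq> I2} = {z0}"
  proof -
    have "a = z0" if "supp a \<subseteq> I1" "supp a \<subseteq> I2" for a :: "'a \<Rightarrow> 'b"
      using that I(1) supp_empty_iff by blast
    then show ?thesis using lin_subD(1)[OF is_subalgD(1)[OF L]] by auto
  qed
next
  fix x assume x: "x \<in> L"
  show "\<exists>b1\<in>{a \<in> L. supp a \<subseteq> I1}. \<exists>b2\<in>{a \<in> L. supp a \<subseteq> I2}. x = vadd b1 b2"
  proof (intro bexI)
    show "x = vadd (\<lambda>t. if t \<in> I1 then x t else 0) (\<lambda>t. if t \<in> I2 then x t else 0)"
      using I(1) I(2)[OF x] by (auto simp: vadd_def fun_eq_iff supp_def)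
    show "(\<lambda>t. if t \<in> I1 then x t else 0) \<in> {a \<in> L. supp a \<subseteq> I1}"
      "(\<lambda>t. if t \<in> I2 then x t else 0) \<in> {a \<in> L. supp a \<subseteq> I2}"
      using restr x by (auto simp: supp_def split: if_splits)
  qed
qed auto

lemma continuum_decompsI:
  assumes dec: "\<And>s. s \<in> good_slopes \<Longrightarrow> is_decomp pe ops sq L (B1 s) (B2 s)"
    and sep: "\<And>s s'. s \<in> good_slopes \<Longrightarrow> s' \<in> good_slopes \<Longrightarrow> s < s' \<Longrightarrow> B1 s \<noteq> B1 s'"
  shows "continuum_decomps pe ops sq L"
proof -
  obtain h :: "real \<Rightarrow> real" where h: "inj h" "range h \<subseteq> good_slopes"
    by (rule injection_into_good_slopes)
  define f where "f = (\<lambda>x. (B1 (h x), B2 (h x)))"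
  have "inj f"
  proof (rule injI)
    fix x y assume "f x = f y"
    then have "B1 (h x) = B1 (h y)" by (simp add: f_def)
    moreover have "h x \<in> good_slopes" "h y \<in> good_slopes" using h(2) by auto
    ultimately have "h x = h y" using sep by (metis linorder_neqE)
    then show "x = y" using h(1) by (simp add: inj_eq)
  qed
  then have "bij_betw f UNIV (range f)" by (rule inj_on_imp_bij_betw)
  moreover have "range f \<subseteq> {(B1, B2). is_decomp pe ops sq L B1 B2}"
    using dec h(2) by (auto simp: f_def)
  ultimately show ?thesis unfolding continuum_decomps_def by blast
qed

definition additive_op ::
  "'i set \<Rightarrow> ('i \<Rightarrow> 'g::ab_group_add) \<Rightarrow> (('i \<Rightarrow> 'k::field) \<Rightarrow> ('i \<Rightarrow> 'k) \<Rightarrow> 'i \<Rightarrow> 'k) \<Rightarrow> bool" where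
  "additive_op G w f \<longleftrightarrow> (\<forall>a b t. supp a \<subseteq> G \<longrightarrow> supp b \<subseteq> G \<longrightarrow> t \<in> supp (f a b) \<longrightarrow>
     t \<in> G \<and> (\<exists>s\<in>supp a. \<exists>u\<in>supp b. w t = w s + w u))"

lemma additive_opD:
  assumes "additive_op G w f" "supp a \<subseteq> G" "supp b \<subseteq> G" "t \<in> supp (f a b)"
  obtains s u where "t \<in> G" "s \<in> supp a" "u \<in> supp b" "w t = w s + w u"
  using assms unfolding additive_op_def by meson

definition additive_sq ::
  "'i set \<Rightarrow> ('i \<Rightarrow> 'g::ab_group_add) \<Rightarrow> (('i \<Rightarrow> 'k::field) \<Rightarrow> 'i \<Rightarrow> 'k) \<Rightarrow> bool" where
  "additive_sq G w f \<longleftrightarrow> (\<forall>a t. supp a \<subseteq> G \<longrightarrow> t \<in> supp (f a) \<longrightarrow>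
     t \<in> G \<and> (\<exists>s\<in>supp a. \<exists>u\<in>supp a. w t = w s + w u))"

lemma additive_sqD:
  assumes "additive_sq G w f" "supp a \<subseteq> G" "t \<in> supp (f a)"
  obtains s u where "t \<in> G" "s \<in> supp a" "u \<in> supp a" "w t = w s + w u"
  using assms unfolding additive_sq_def by meson

lemma finite_positive_lower_bound:
  fixes g :: "'a \<Rightarrow> real"
  assumes "finite S" "\<And>x. x \<in> S \<Longrightarrow> 0 < g x"
  obtains d where "0 < d" "\<And>x. x \<in> S \<Longrightarrow> d \<le> g x"
proof -
  have "Min (insert 1 (g ` S)) \<in> insert 1 (g ` S)" using assms(1) by (intro Min_in) auto
  then have "0 < Min (insert 1 (g ` S))" using assms(2) by auto
  moreover have "Min (insert 1 (g ` S)) \<le> g x" if "x \<in> S" for x using assms(1) that by (intro Min_le) auto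
  ultimately show ?thesis using that by blast
qed

lemma finite_upper_bound:
  fixes g :: "'a \<Rightarrow> real"
  assumes "finite S"
  obtains R where "\<And>x. x \<in> S \<Longrightarrow> g x \<le> R"
proof -
  have "g x \<le> Max (g ` S)" if "x \<in> S" for x using assms that by (intro Max_ge) auto
  then show ?thesis using that by blast
qed

text \<open>An element all of whose weights equal \<open>mu ^ n\<close> belongs to a half exactly if
  the linear form is positive at \<open>mu ^ n\<close>. For a suitable \<open>n\<close> the forms of
  the two slopes have opposite signs there.\<close>

lemma half_spaces_distinct:
  fixes z :: "'i \<Rightarrow> complex" and L :: "('i \<Rightarrow> 'k::field) set"
  assumes e: "\<And>n. \<exists>e\<in>L. supp e \<noteq> {} \<and> supp e \<subseteq> D \<and> (\<forall>t\<in>supp e. z t = mu ^ n)"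
    and J: "\<And>t. t \<in> D \<Longrightarrow> t \<in> J s \<longleftrightarrow> 0 < lin s (z t)" "\<And>t. t \<in> D \<Longrightarrow> t \<in> J s' \<longleftrightarrow> 0 < lin s' (z t)"
    and "s < s'"
  shows "{a \<in> L. supp a \<subseteq> J s} \<noteq> {a \<in> L. supp a \<subseteq> J s'}"
proof
  assume eq: "{a \<in> L. supp a \<subseteq> J s} = {a \<in> L. supp a \<subseteq> J s'}"
  obtain n where n: "lin s (mu ^ n) * lin s' (mu ^ n) < 0"
    using mu_powers_separate[OF \<open>s < s'\<close>] unfolding lin_def by blast
  obtain e where e: "e \<in> L" "supp e \<noteq> {}" "supp e \<subseteq> D" "\<forall>t\<in>supp e. z t = mu ^ n"
    using e by blast
  have "supp e \<subseteq> J s \<longleftrightarrow> 0 < lin s (mu ^ n)" "supp e \<subseteq> J s' \<longleftrightarrow> 0 < lin s' (mu ^ n)"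
    using e(2-4) J by (metis equals0I subsetD subsetI)+
  moreover have "supp e \<subseteq> J s \<longleftrightarrow> supp e \<subseteq> J s'" using eq e(1) by blast
  ultimately show False using n by (auto simp: mult_less_0_iff)
qed

text \<open>The ways in which an index of a product arises in a double: unbarred times unbarred, a
  bracket of two barred factors, or a mixed product. \<open>U\<close> holds the index of 1-bar,
  which never enters a bracket.\<close>

definition dbl :: "('i \<Rightarrow> bool) \<Rightarrow> ('i \<Rightarrow> complex) \<Rightarrow> ('i \<Rightarrow> real) \<Rightarrow> 'i set \<Rightarrow> 'i \<Rightarrow> 'i \<Rightarrow> 'i \<Rightarrow> bool" where
  "dbl bar zz rr U t s u \<longleftrightarrow> zz t = zz s + zz u \<and> rr t = rr s + rr u \<and>
     (\<not> bar t \<and> \<not> bar s \<and> \<not> bar u \<or> \<not> bar t \<and> bar s \<and> bar u \<and> s \<notin> U \<and> u \<notin> U \<or> bar t \<and> bar s \<noteq> bar u)"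

definition double_op ::
  "'i set \<Rightarrow> ('i \<Rightarrow> bool) \<Rightarrow> ('i \<Rightarrow> complex) \<Rightarrow> ('i \<Rightarrow> real) \<Rightarrow> 'i set
    \<Rightarrow> (('i \<Rightarrow> 'k::field) \<Rightarrow> ('i \<Rightarrow> 'k) \<Rightarrow> 'i \<Rightarrow> 'k) \<Rightarrow> bool" where
  "double_op G bar zz rr U f \<longleftrightarrow> (\<forall>a b t. supp a \<subseteq> G \<longrightarrow> supp b \<subseteq> G \<longrightarrow> t \<in> supp (f a b) \<longrightarrow>
     t \<in> G \<and> (\<exists>s\<in>supp a. \<exists>u\<in>supp b. dbl bar zz rr U t s u))"

definition double_sq ::
  "'i set \<Rightarrow> ('i \<Rightarrow> bool) \<Rightarrow> ('i \<Rightarrow> complex) \<Rightarrow> ('i \<Rightarrow> real) \<Rightarrow> 'i set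
    \<Rightarrow> (('i \<Rightarrow> 'k::field) \<Rightarrow> 'i \<Rightarrow> 'k) \<Rightarrow> bool" where
  "double_sq G bar zz rr U f \<longleftrightarrow> (\<forall>a t. supp a \<subseteq> G \<longrightarrow> t \<in> supp (f a) \<longrightarrow>
     t \<in> G \<and> (\<exists>s\<in>supp a. \<exists>u\<in>supp a. dbl bar zz rr U t s u))"

lemma double_sq_z0: "double_sq G bar zz rr U (\<lambda>_. z0)"
  by (simp add: double_sq_def)

text \<open>A graded algebra without bars counts as a double with no barred index, so that one
  criterion serves all five algebras.\<close>

lemma additive_imp_double:
  "additive_op G w f \<Longrightarrow> double_op G (\<lambda>_. False) (\<lambda>t. fst (w t)) (\<lambda>t. snd (w t)) {} f"
  "additive_sq G w h \<Longrightarrow> double_sq G (\<lambda>_. False) (\<lambda>t. fst (w t)) (\<lambda>t. snd (w t)) {} h"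
  unfolding additive_op_def double_op_def additive_sq_def double_sq_def dbl_def
  by (metis fst_add snd_add)+

text \<open>In the Kantor double the element \<open>1\<close>-bar has weight \<open>0\<close> (the set \<open>U\<close> consists of its index), but
  its product with a barred element vanishes. Shifting the weights by \<open>- 3 * d\<close> (unbarred),
  \<open>- 2 * d\<close> (barred) and \<open>+ d\<close> (\<open>1\<close>-bar) makes all weights positive and keeps superadditivity.\<close>

lemma loc_nilp_double:
  fixes L :: "('i \<Rightarrow> 'k::field) set"
  assumes op: "\<And>f. f \<in> set ops \<Longrightarrow> double_op G bar zz rr U f" and sq: "double_sq G bar zz rr U sq"
    and U: "\<And>t. t \<in> U \<Longrightarrow> bar t \<and> zz t = 0"
    and supp: "\<And>a. a \<in> L \<Longrightarrow> supp a \<subseteq> G"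
    and fin: "\<And>a. a \<in> L \<Longrightarrow> finite (zz ` supp a)" "\<And>a. a \<in> L \<Longrightarrow> finite (rr ` supp a)"
    and bound: "\<And>t. t \<in> G \<Longrightarrow> (cmod (zz t))\<^sup>2 \<le> 130 * rr t"
    and \<sigma>: "\<sigma> = 1 \<or> \<sigma> = - 1"
    and pos: "\<And>a t. a \<in> L \<Longrightarrow> t \<in> supp a \<Longrightarrow> 0 < \<sigma> * lin s (zz t) \<or> t \<in> U"
  shows "loc_nilp pe ops sq L"
proof (rule loc_nilpI)
  fix X assume X: "finite X" "X \<subseteq> L"
  define \<phi> where "\<phi> = (\<lambda>t. \<sigma> * lin s (zz t))"
  define S where "S = {y \<in> (\<Union>x\<in>X. zz ` supp x). 0 < \<sigma> * lin s y}"
  have "finite (\<Union>x\<in>X. zz ` supp x)" using X fin(1) by blast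
  then have S: "finite S" by (rule rev_finite_subset) (auto simp: S_def)
  have "0 < \<sigma> * lin s y" if "y \<in> S" for y using that by (simp add: S_def)
  then obtain d0 where d0: "0 < d0" "\<And>y. y \<in> S \<Longrightarrow> d0 \<le> \<sigma> * lin s y"
    using finite_positive_lower_bound[OF S, of "\<lambda>y. \<sigma> * lin s y"] by blast
  have "finite (\<Union>x\<in>X. rr ` supp x)" using X fin(2) by blast
  then obtain R where R: "\<And>y. y \<in> (\<Union>x\<in>X. rr ` supp x) \<Longrightarrow> y \<le> R"
    using finite_upper_bound[of "\<Union>x\<in>X. rr ` supp x" "\<lambda>y. y"] by blast
  \<comment> \<open>After the largest shift \<open>3 * d\<close>, values of at least
    \<open>d0 = 4 * d\<close> are still at least \<open>d\<close>.\<close>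
  define d where "d = d0 / 4"
  have d: "0 < d" using d0 by (simp add: d_def)
  define om where "om = (\<lambda>t. if t \<in> U then d else \<phi> t - (if bar t then 2 * d else 3 * d))"
  \<comment> \<open>At the index of 1-bar \<open>om\<close> is \<open>d\<close> although
    \<open>rr\<close> may be 0. Adding 1 to \<open>rr\<close>, and \<open>d^2\<close> to the
    constant \<open>k\<close>, restores the quadratic bound there.\<close>
  define r where "r = (\<lambda>t. rr t + 1)"
  define k where "k = (1 + \<bar>s\<bar>)\<^sup>2 * 130 + d\<^sup>2"
  have rr: "0 \<le> rr t" if "t \<in> G" for t
    using bound[OF that] zero_le_power2[of "cmod (zz t)"] by linarith
  have \<phi>U: "\<phi> t = 0" if "t \<in> U" for t using U[OF that] by (simp add: \<phi>_def lin_def)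
  have om_unbar: "om t = \<phi> t - 3 * d" if "\<not> bar t" for t using that U by (auto simp: om_def)
  have om_bar: "\<phi> t - 2 * d \<le> om t" "om t \<le> \<phi> t + d" if "bar t" for t
    using that d \<phi>U by (auto simp: om_def)
  have om_bar': "om t = \<phi> t - 2 * d" if "bar t" "t \<notin> U" for t using that by (simp add: om_def)
  have super: "om u + om v \<le> om t \<and> r t \<le> r u + r v" if "dbl bar zz rr U t u v" for t u v
  proof
    have \<phi>: "\<phi> t = \<phi> u + \<phi> v" using that by (simp add: \<phi>_def dbl_def lin_add distrib_left)
    have "\<not> bar t \<and> \<not> bar u \<and> \<not> bar v \<or> \<not> bar t \<and> bar u \<and> bar v \<and> u \<notin> U \<and> v \<notin> U \<or> bar t \<and> bar u \<noteq> bar v"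
      using that by (simp add: dbl_def)
    then show "om u + om v \<le> om t"
    proof (elim disjE conjE)
      assume "\<not> bar t" "\<not> bar u" "\<not> bar v"
      then show ?thesis using \<phi> d by (simp add: om_unbar)
    next
      assume "\<not> bar t" "bar u" "bar v" "u \<notin> U" "v \<notin> U"
      then show ?thesis using \<phi> d by (simp add: om_unbar om_bar')
    next
      \<comment> \<open>The tight case is 1-bar times an unbarred factor:
        \<open>d - 3 * d = - 2 * d\<close>.\<close>
      assume t: "bar t" and uv: "bar u \<noteq> bar v"
      show ?thesis
      proof (cases "bar u")
        case True
        then show ?thesis using uv om_bar(1)[OF t] om_bar(2)[OF True] om_unbar[of v] \<phi> by linarith
      next
        case False
        then show ?thesis using uv om_bar(1)[OF t] om_bar(2)[of v] om_unbar[of u] \<phi> by linarith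
      qed
    qed
    show "r t \<le> r u + r v" using that by (simp add: r_def dbl_def)
  qed
  have "weight_data ops sq X G om r d (R + 1) k"
    unfolding weight_data_def
  proof (intro conjI ballI)
    show "superadd_op G om r f" if "f \<in> set ops" for f
      using op[OF that] super unfolding superadd_op_def double_op_def by meson
    show "\<forall>a t. supp a \<subseteq> G \<longrightarrow> t \<in> supp (sq a) \<longrightarrow>
        t \<in> G \<and> (\<exists>u\<in>supp a. \<exists>v\<in>supp a. om u + om v \<le> om t \<and> r t \<le> r u + r v)"
      using sq super unfolding double_sq_def by meson
  next
    fix x t assume x: "x \<in> X" and t: "t \<in> supp x"
    have xL: "x \<in> L" using x X by blast
    show "t \<in> G" using supp[OF xL] t by blast
    show "d \<le> om t"
    proof (cases "t \<in> U")
      case False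
      then have "0 < \<sigma> * lin s (zz t)" using pos[OF xL t] by blast
      then have "zz t \<in> S" using x t by (auto simp: S_def)
      then have "d0 \<le> \<phi> t" using d0(2) by (simp add: \<phi>_def)
      then show ?thesis using False d by (auto simp: om_def d_def)
    qed (simp add: om_def)
    show "r t \<le> R + 1" using R[of "rr t"] x t by (auto simp: r_def)
  next
    fix t assume t: "t \<in> G"
    show "0 \<le> om t \<longrightarrow> (om t)\<^sup>2 \<le> k * r t"
    proof
      assume om0: "0 \<le> om t"
      show "(om t)\<^sup>2 \<le> k * r t"
      proof (cases "t \<in> U")
        case True
        have "d\<^sup>2 \<le> k * 1" by (simp add: k_def)
        also have "\<dots> \<le> k * r t" using rr[OF t] by (intro mult_left_mono) (auto simp: r_def k_def)
        finally show ?thesis by (simp add: om_def True)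
      next
        case False
        have "om t \<le> \<phi> t" using False d by (simp add: om_def)
        also have "\<dots> \<le> \<bar>lin s (zz t)\<bar>" using \<sigma> by (auto simp: \<phi>_def)
        also have "\<dots> \<le> (1 + \<bar>s\<bar>) * cmod (zz t)" by (rule lin_bound)
        finally have "(om t)\<^sup>2 \<le> ((1 + \<bar>s\<bar>) * cmod (zz t))\<^sup>2" using om0 by (intro power_mono) auto
        also have "\<dots> = (1 + \<bar>s\<bar>)\<^sup>2 * (cmod (zz t))\<^sup>2" by (simp add: power_mult_distrib)
        also have "\<dots> \<le> (1 + \<bar>s\<bar>)\<^sup>2 * (130 * rr t)" using bound[OF t] by (intro mult_left_mono) auto
        also have "\<dots> = ((1 + \<bar>s\<bar>)\<^sup>2 * 130) * rr t" by simp
        also have "\<dots> \<le> k * r t" using rr[OF t] by (intro mult_mono) (auto simp: k_def r_def)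
        finally show ?thesis .
      qed
    qed
  qed (use d in \<open>auto simp: k_def\<close>)
  then show "\<exists>G om r d R k. weight_data ops sq X G om r d R k" by blast
qed

text \<open>The index of 1-bar has weight 0 and lies on every cutting plane; it is put into the
  positive half by choice.\<close>

definition halfp :: "('i \<Rightarrow> complex) \<Rightarrow> 'i set \<Rightarrow> real \<Rightarrow> 'i set" where
  "halfp zz U s = {t. 0 < lin s (zz t) \<or> t \<in> U}"

definition halfm :: "('i \<Rightarrow> complex) \<Rightarrow> real \<Rightarrow> 'i set" where
  "halfm zz s = {t. 0 < - lin s (zz t)}"

text \<open>\<open>restr\<close> and \<open>nz\<close> make the halves complementary, additivity and
  \<open>bound\<close> make them locally nilpotent, and the elements of pure weight
  \<open>mu ^ n\<close> in \<open>e\<close> tell different slopes apart.\<close>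

lemma double_continuum:
  fixes L :: "('i \<Rightarrow> 'k::field) set"
  assumes L: "is_subalg pe ops sq L"
    and pe: "\<And>a t. t \<in> supp (pe a) \<Longrightarrow> t \<in> supp a"
    and op: "\<And>f. f \<in> set ops \<Longrightarrow> double_op G bar zz rr U f" and sq: "double_sq G bar zz rr U sq"
    and U: "\<And>t. t \<in> U \<Longrightarrow> bar t \<and> zz t = 0"
    and supp: "\<And>a. a \<in> L \<Longrightarrow> supp a \<subseteq> G"
    and fin: "\<And>a. a \<in> L \<Longrightarrow> finite (zz ` supp a)" "\<And>a. a \<in> L \<Longrightarrow> finite (rr ` supp a)"
    and bound: "\<And>t. t \<in> G \<Longrightarrow> (cmod (zz t))\<^sup>2 \<le> 130 * rr t"
    and restr: "\<And>a s. a \<in> L \<Longrightarrow> s \<in> good_slopes \<Longrightarrow> (\<lambda>t. if t \<in> halfp zz U s then a t else 0) \<in> L"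
      "\<And>a s. a \<in> L \<Longrightarrow> s \<in> good_slopes \<Longrightarrow> (\<lambda>t. if t \<in> halfm zz s then a t else 0) \<in> L"
    and nz: "\<And>a t s. a \<in> L \<Longrightarrow> t \<in> supp a \<Longrightarrow> s \<in> good_slopes \<Longrightarrow> t \<in> U \<or> lin s (zz t) \<noteq> 0"
    and e: "\<And>n. \<exists>e\<in>L. supp e \<noteq> {} \<and> supp e \<subseteq> - U \<and> (\<forall>t\<in>supp e. zz t = mu ^ n)"
  shows "continuum_decomps pe ops sq L"
proof (rule continuum_decompsI)
  fix s assume s: "s \<in> good_slopes"
  have linU: "lin s (zz t) = 0" if "t \<in> U" for t using U[OF that] by (simp add: lin_def)
  show "is_decomp pe ops sq L {a \<in> L. supp a \<subseteq> halfp zz U s} {a \<in> L. supp a \<subseteq> halfm zz s}"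
  proof (rule is_decomp_split[OF L pe])
    show "halfp zz U s \<inter> halfm zz s = {}"
      using linU by (auto simp: halfp_def halfm_def)
    show "supp a \<subseteq> halfp zz U s \<union> halfm zz s" if "a \<in> L" for a
      using nz[OF that _ s] by (force simp: halfp_def halfm_def)
    show "(\<lambda>t. if t \<in> halfp zz U s then a t else 0) \<in> L" if "a \<in> L" for a by (rule restr(1)[OF that s])
    show "(\<lambda>t. if t \<in> halfm zz s then a t else 0) \<in> L" if "a \<in> L" for a by (rule restr(2)[OF that s])
    show "loc_nilp pe ops sq {a \<in> L. supp a \<subseteq> halfp zz U s}"
      by (rule loc_nilp_double[where \<sigma> = 1 and s = s, OF op sq U _ _ _ bound])
        (use supp fin in \<open>auto simp: halfp_def\<close>)
    show "loc_nilp pe ops sq {a \<in> L. supp a \<subseteq> halfm zz s}"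
      by (rule loc_nilp_double[where \<sigma> = "- 1" and s = s, OF op sq U _ _ _ bound])
        (use supp fin in \<open>auto simp: halfm_def\<close>)
    fix J assume J: "J \<in> {halfp zz U s, halfm zz s}"
    have JJ: "t \<in> J" if d: "dbl bar zz rr U t u v" and uv: "u \<in> J" "v \<in> J" for t u v
    proof -
      have lin: "lin s (zz t) = lin s (zz u) + lin s (zz v)" using d by (simp add: dbl_def lin_add)
      show "t \<in> J"
      proof (cases "J = halfm zz s")
        case True
        then show ?thesis using uv lin by (simp add: halfm_def)
      next
        case False
        then have J: "J = halfp zz U s" using J by simp
        \<comment> \<open>The product of 1-bar with itself has no component, so at least one factor
          contributes a strictly positive value.\<close>
        have "u \<notin> U \<or> v \<notin> U" using d U unfolding dbl_def by blast
        moreover have "0 < lin s (zz u) \<or> u \<in> U" "0 < lin s (zz v) \<or> v \<in> U"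
          using uv unfolding J halfp_def by simp_all
        ultimately have "0 < lin s (zz t)" using lin linU by (elim disjE) simp_all
        then show ?thesis unfolding J halfp_def by simp
      qed
    qed
    show "supp (g a b) \<subseteq> J" if "g \<in> set ops" "a \<in> L" "b \<in> L" "supp a \<subseteq> J" "supp b \<subseteq> J" for g a b
      using op[OF that(1)] supp[OF that(2)] supp[OF that(3)] that(4,5) JJ
      unfolding double_op_def by (meson subsetD subsetI)
    show "supp (sq a) \<subseteq> J" if "a \<in> L" "supp a \<subseteq> J" for a
      using sq supp[OF that(1)] that(2) JJ unfolding double_sq_def by (meson subsetD subsetI)
  qed
  fix s' assume "s < s'"
  then show "{a \<in> L. supp a \<subseteq> halfp zz U s} \<noteq> {a \<in> L. supp a \<subseteq> halfp zz U s'}"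
    by (rule half_spaces_distinct[rotated 3, where D = "- U" and z = zz and J = "halfp zz U"])
      (use e in \<open>auto simp: halfp_def\<close>)
qed

section \<open>Algebras generated by homogeneous elements\<close>

definition homw :: "('i \<Rightarrow> 'g) \<Rightarrow> ('i \<Rightarrow> 'k::field) \<Rightarrow> bool" where
  "homw w a \<longleftrightarrow> (\<forall>s\<in>supp a. \<forall>t\<in>supp a. w s = w t)"

text \<open>\<open>adm\<close> singles out coefficient functions on which the operations really are
  additive. \<open>sq_add\<close> makes the square a quadratic map on odd elements whose polar form
  \<open>m\<close> is an operation, or zero for algebras without squares.\<close>

locale wgraded =
  fixes E :: "'i \<Rightarrow> bool" and pe :: "('i \<Rightarrow> 'k::field) \<Rightarrow> ('i \<Rightarrow> 'k)"
    and ops :: "(('i \<Rightarrow> 'k) \<Rightarrow> ('i \<Rightarrow> 'k) \<Rightarrow> ('i \<Rightarrow> 'k)) list" and sq :: "('i \<Rightarrow> 'k) \<Rightarrow> ('i \<Rightarrow> 'k)"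
    and Gen :: "('i \<Rightarrow> 'k) set" and w :: "'i \<Rightarrow> 'g::ab_group_add" and G :: "'i set"
    and adm :: "('i \<Rightarrow> 'k) \<Rightarrow> bool"
  assumes pe: "pe a = (\<lambda>t. if E t then a t else 0)"
    and adm_z0: "adm z0" and adm_add: "adm a \<Longrightarrow> adm b \<Longrightarrow> adm (vadd a b)"
    and adm_sub: "adm a \<Longrightarrow> supp b \<subseteq> supp a \<Longrightarrow> adm b"
    and adm_op: "f \<in> set ops \<Longrightarrow> adm a \<Longrightarrow> adm b \<Longrightarrow> adm (f a b)"
    and adm_sq: "adm a \<Longrightarrow> adm (sq a)"
    and adm_supp: "adm a \<Longrightarrow> supp a \<subseteq> G"
    and op_add_left: "f \<in> set ops \<Longrightarrow> adm a \<Longrightarrow> adm a' \<Longrightarrow> adm b \<Longrightarrow> f (vadd a a') b = vadd (f a b) (f a' b)"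
    and op_add_right: "f \<in> set ops \<Longrightarrow> adm a \<Longrightarrow> adm b \<Longrightarrow> adm b' \<Longrightarrow> f a (vadd b b') = vadd (f a b) (f a b')"
    and op_additive: "f \<in> set ops \<Longrightarrow> additive_op G w f"
    and sq_additive: "additive_sq G w sq"
    and sq_add: "adm a \<Longrightarrow> adm b \<Longrightarrow> pe a = z0 \<Longrightarrow> pe b = z0 \<Longrightarrow>
      \<exists>m. (m = (\<lambda>_ _. z0) \<or> m \<in> set ops) \<and> sq (vadd a b) = vadd (sq a) (vadd (m a b) (sq b))"
    and Gen: "g \<in> Gen \<Longrightarrow> adm g \<and> homw w g"
begin

abbreviation L where "L \<equiv> generated pe ops sq Gen"

lemmas L_sub = is_subalg_generated[of pe ops sq Gen]
lemmas L_lin = lin_subD[OF is_subalgD(1)[OF L_sub]]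

text \<open>The summands must lie in \<open>L\<close> and not just in the ambient space; this keeps
  the cut parts of an element in \<open>L\<close>.\<close>

inductive_set hsum :: "('i \<Rightarrow> 'k) set" where
  hsum_z0: "z0 \<in> hsum"
| hsum_Cons: "h \<in> L \<Longrightarrow> adm h \<Longrightarrow> homw w h \<Longrightarrow> a \<in> hsum \<Longrightarrow> vadd h a \<in> hsum"

lemma hsum_hom: "h \<in> L \<Longrightarrow> adm h \<Longrightarrow> homw w h \<Longrightarrow> h \<in> hsum"
  using hsum_Cons[OF _ _ _ hsum_z0] by simp

lemma hsum_props: "a \<in> hsum \<Longrightarrow> a \<in> L \<and> adm a \<and> finite (w ` supp a)"
proof (induction rule: hsum.induct)
  case hsum_z0
  then show ?case using L_lin(1) adm_z0 by simp
next
  case (hsum_Cons h a)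
  have "finite (w ` supp h)"
  proof (cases "supp h = {}")
    case False
    then obtain t0 where "t0 \<in> supp h" by blast
    then have "w ` supp h \<subseteq> {w t0}" using hsum_Cons.hyps(3) unfolding homw_def by blast
    then show ?thesis by (rule finite_subset) simp
  qed simp
  moreover have "w ` supp (vadd h a) \<subseteq> w ` supp h \<union> w ` supp a"
    unfolding image_Un[symmetric] by (rule image_mono[OF supp_vadd])
  ultimately have "finite (w ` supp (vadd h a))" using hsum_Cons.IH by (meson finite_UnI finite_subset)
  then show ?case using hsum_Cons L_lin(2) adm_add by simp
qed

lemma hsum_add: "a \<in> hsum \<Longrightarrow> b \<in> hsum \<Longrightarrow> vadd a b \<in> hsum"
proof (induction rule: hsum.induct)
  case (hsum_Cons h a)
  have "vadd (vadd h a) b = vadd h (vadd a b)" by (simp add: vadd_def add.assoc)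
  then show ?case using hsum_Cons hsum.hsum_Cons by simp
qed simp

lemma homw_subset: "homw w a \<Longrightarrow> supp b \<subseteq> supp a \<Longrightarrow> homw w b"
  unfolding homw_def by blast

lemma hsum_scale: "a \<in> hsum \<Longrightarrow> vsc c a \<in> hsum"
proof (induction rule: hsum.induct)
  case hsum_z0
  have "vsc c z0 = (z0 :: 'i \<Rightarrow> 'k)" by (simp add: vsc_def z0_def)
  then show ?case using hsum.hsum_z0 by simp
next
  case (hsum_Cons h a)
  have "vsc c (vadd h a) = vadd (vsc c h) (vsc c a)" by (simp add: vsc_def vadd_def distrib_left)
  moreover have "vsc c h \<in> L" using hsum_Cons L_lin(3) by simp
  moreover have "adm (vsc c h)" "homw w (vsc c h)"
    using hsum_Cons adm_sub homw_subset supp_vsc by metis+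
  ultimately show ?case using hsum_Cons hsum.hsum_Cons by simp
qed

lemma pe_simps: "pe z0 = z0" "pe (vadd a b) = vadd (pe a) (pe b)" "supp (pe a) \<subseteq> supp a"
  by (auto simp: pe z0_def vadd_def supp_def)

lemma hsum_pe: "a \<in> hsum \<Longrightarrow> pe a \<in> hsum"
proof (induction rule: hsum.induct)
  case hsum_z0
  then show ?case using hsum.hsum_z0 pe_simps by simp
next
  case (hsum_Cons h a)
  have "pe h \<in> L" using hsum_Cons is_subalgD(2)[OF L_sub] by simp
  moreover have "adm (pe h)" "homw w (pe h)"
    using hsum_Cons adm_sub homw_subset pe_simps by metis+
  ultimately show ?case using hsum_Cons hsum.hsum_Cons pe_simps by simp
qed

lemma op_z0: "f \<in> set ops \<Longrightarrow> adm a \<Longrightarrow> f z0 a = z0" "f \<in> set ops \<Longrightarrow> adm a \<Longrightarrow> f a z0 = z0"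
proof -
  assume f: "f \<in> set ops" and a: "adm a"
  have "supp (f z0 a) = {}" "supp (f a z0) = {}"
    using additive_opD[OF op_additive[OF f]] adm_supp[OF a] supp_z0
    by (metis empty_iff empty_subsetI equals0I)+
  then show "f z0 a = z0" "f a z0 = z0" by (simp_all add: supp_empty_iff)
qed

lemma op_hom:
  assumes "f \<in> set ops" "h \<in> L" "adm h" "homw w h" "h' \<in> L" "adm h'" "homw w h'"
  shows "f h h' \<in> hsum"
proof (rule hsum_hom)
  show "f h h' \<in> L" using is_subalgD(3)[OF L_sub] assms by blast
  show "adm (f h h')" using adm_op assms by blast
  show "homw w (f h h')"
    unfolding homw_def
  proof (intro ballI)
    fix s t assume "s \<in> supp (f h h')" "t \<in> supp (f h h')"
    then show "w s = w t"
      using additive_opD[OF op_additive[OF assms(1)] adm_supp[OF assms(3)] adm_supp[OF assms(6)]]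
        assms(4,7) unfolding homw_def by metis
  qed
qed

lemma hsum_op:
  assumes "f \<in> set ops" "a \<in> hsum" "b \<in> hsum"
  shows "f a b \<in> hsum"
  using assms(2)
proof (induction rule: hsum.induct)
  case hsum_z0
  then show ?case using op_z0 assms hsum_props hsum.hsum_z0 by simp
next
  case (hsum_Cons h a)
  have "f h b \<in> hsum" using assms(3)
  proof (induction rule: hsum.induct)
    case hsum_z0
    then show ?case using op_z0 assms hsum_Cons hsum.hsum_z0 by simp
  next
    case (hsum_Cons h' b)
    then show ?case
      using op_add_right assms(1) hsum_props op_hom hsum_add \<open>h \<in> L\<close> \<open>adm h\<close> \<open>homw w h\<close> by simp
  qed
  then show ?case using op_add_left assms hsum_Cons hsum_props hsum_add by simp
qed

text \<open>Subalgebras are closed under squares of odd elements only, but the homogeneous summands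
  of an odd element need not be odd. Passing to the odd part of every summand repairs this without
  changing the sum.\<close>

definition od :: "('i \<Rightarrow> 'k) \<Rightarrow> 'i \<Rightarrow> 'k" where
  "od a = vadd a (vsc (- 1) (pe a))"

lemma od_simps: "od z0 = z0" "od (vadd a b) = vadd (od a) (od b)" "pe (od a) = z0" "supp (od a) \<subseteq> supp a"
  by (auto simp: od_def pe z0_def vadd_def vsc_def supp_def fun_eq_iff)

lemma hsum_sq_od: "a \<in> hsum \<Longrightarrow> sq (od a) \<in> hsum"
proof (induction rule: hsum.induct)
  case hsum_z0
  have "supp (sq z0) = {}"
    using additive_sqD[OF sq_additive] supp_z0 by (metis empty_iff empty_subsetI equals0I)
  then have "sq z0 = z0" by (simp add: supp_empty_iff)
  then show ?case using hsum.hsum_z0 od_simps by simp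
next
  case (hsum_Cons h a)
  have oh: "od h \<in> L" unfolding od_def
    using hsum_Cons L_lin is_subalgD(2)[OF L_sub] by simp
  have ah: "adm (od h)" "homw w (od h)" "adm (od a)"
    using hsum_Cons hsum_props adm_sub homw_subset od_simps(4) by metis+
  have oa: "od a \<in> hsum" unfolding od_def
    using hsum_Cons hsum_add hsum_scale hsum_pe by simp
  have "sq (od h) \<in> hsum"
  proof (rule hsum_hom)
    show "sq (od h) \<in> L" using is_subalgD(4)[OF L_sub] oh od_simps by blast
    show "adm (sq (od h))" using adm_sq ah by blast
    show "homw w (sq (od h))"
      unfolding homw_def
    proof (intro ballI)
      fix s t assume "s \<in> supp (sq (od h))" "t \<in> supp (sq (od h))"
      then show "w s = w t"
        using additive_sqD[OF sq_additive adm_supp[OF ah(1)]] ah(2) unfolding homw_def by metis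
    qed
  qed
  moreover obtain m where m: "m = (\<lambda>_ _. z0) \<or> m \<in> set ops"
    "sq (vadd (od h) (od a)) = vadd (sq (od h)) (vadd (m (od h) (od a)) (sq (od a)))"
    using sq_add[OF ah(1,3)] od_simps by blast
  moreover have "m (od h) (od a) \<in> hsum"
    using m(1) hsum_op[OF _ hsum_hom[OF oh ah(1,2)] oa] hsum.hsum_z0 by auto
  ultimately show ?case using hsum_Cons.IH hsum_add od_simps by simp
qed

lemma L_subset_hsum: "L \<subseteq> hsum"
proof -
  have "is_subalg pe ops sq hsum"
    unfolding is_subalg_def lin_sub_def
  proof (intro conjI ballI allI impI)
    fix a assume a: "a \<in> hsum" "pe a = z0"
    have "od a = a" using a(2) by (simp add: od_def vsc_def vadd_def z0_def)
    then show "sq a \<in> hsum" using hsum_sq_od[OF a(1)] by simp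
  qed (rule hsum_z0 hsum_add hsum_scale hsum_pe hsum_op; assumption)+
  moreover have "Gen \<subseteq> hsum"
  proof
    fix g assume g: "g \<in> Gen"
    then have "g \<in> L" by (rule subsetD[OF generated_incl])
    with Gen[OF g] show "g \<in> hsum" using hsum_hom[of g] by simp
  qed
  ultimately show ?thesis by (rule generated_least)
qed

lemma L_adm: "adm a" and L_finite_weights: "finite (w ` supp a)" if "a \<in> L"
proof -
  have "a \<in> hsum" using that L_subset_hsum by blast
  from hsum_props[OF this] show "adm a" "finite (w ` supp a)" by blast+
qed

lemma L_supp: "a \<in> L \<Longrightarrow> supp a \<subseteq> G"
  by (rule adm_supp[OF L_adm])

text \<open>A condition on the weight keeps or deletes each homogeneous summand as a whole.\<close>

lemma L_restrict:
  assumes "a \<in> L"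
  shows "(\<lambda>t. if P (w t) then a t else 0) \<in> L"
proof -
  have "a \<in> hsum" using assms L_subset_hsum by blast
  then have "(\<lambda>t. if P (w t) then a t else 0) \<in> hsum"
  proof (induction rule: hsum.induct)
    case hsum_z0
    have "(\<lambda>t. if P (w t) then z0 t else 0) = (z0 :: 'i \<Rightarrow> 'k)" by (simp add: z0_def fun_eq_iff)
    then show ?case using hsum.hsum_z0 by simp
  next
    case (hsum_Cons h a)
    have "(\<lambda>t. if P (w t) then vadd h a t else 0)
        = vadd (\<lambda>t. if P (w t) then h t else 0) (\<lambda>t. if P (w t) then a t else 0)"
      by (simp add: vadd_def fun_eq_iff)
    moreover have "(\<lambda>t. if P (w t) then h t else 0) = h \<or> (\<lambda>t. if P (w t) then h t else 0) = z0"
    proof (cases "\<exists>t\<in>supp h. P (w t)")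
      case True
      then have "\<forall>t\<in>supp h. P (w t)" using hsum_Cons.hyps(3) unfolding homw_def by metis
      then show ?thesis by (auto simp: supp_def fun_eq_iff)
    next
      case False
      then show ?thesis by (auto simp: supp_def z0_def fun_eq_iff)
    qed
    moreover have "h \<in> hsum" using hsum_hom hsum_Cons by blast
    ultimately show ?case using hsum_Cons.IH hsum_add hsum.hsum_z0 by auto
  qed
  from hsum_props[OF this] show ?thesis by blast
qed

end


section \<open>The operators \<open>v\<^sub>n\<close>\<close>

lemma mem_Wset: "i \<in> Wset m k \<longleftrightarrow> (\<exists>n<k. i = m + 3 * n \<or> i = m + 3 * n + 1)"
  by (auto simp: Wset_def)

lemma Wset_0 [simp]: "Wset m 0 = {}"
  by (auto simp: mem_Wset)

lemma Wset_Suc: "Wset m (Suc k) = insert m (insert (m + 1) (Wset (m + 3) k))"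
proof (intro set_eqI)
  fix i
  have "(\<exists>n<Suc k. i = m + 3 * n \<or> i = m + 3 * n + 1)
      \<longleftrightarrow> i = m \<or> i = m + 1 \<or> (\<exists>n<k. i = m + 3 + 3 * n \<or> i = m + 3 + 3 * n + 1)"
    by (subst Ex_less_Suc2) (auto simp: algebra_simps)
  then show "i \<in> Wset m (Suc k) \<longleftrightarrow> i \<in> insert m (insert (m + 1) (Wset (m + 3) k))"
    by (simp add: mem_Wset)
qed

lemma Wset_ge: "i \<in> Wset m k \<Longrightarrow> m \<le> i"
  and Wset_less: "i \<in> Wset m k \<Longrightarrow> i < m + 3 * k"
  by (auto simp: mem_Wset)

lemma finite_Wset [simp]: "finite (Wset m k)"
  by (rule finite_subset[of _ "{..<m + 3 * k}"]) (auto dest: Wset_less)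

lemma Wset_notin: "m + 3 * k \<notin> Wset m k" "m \<notin> Wset (m + 3) k" "m + 1 \<notin> Wset (m + 3) k"
  by (auto dest: Wset_ge Wset_less)

lemma card_Wset: "card (Wset m k) = 2 * k"
  by (induction k arbitrary: m) (auto simp: Wset_Suc Wset_notin[simplified])

text \<open>This is the homogeneity of \<open>v_m\<close>: the step from one term to the next is
  \<open>x ^ (m + 3) - x ^ m - x ^ (m + 1) = x ^ m\<close>.\<close>

lemma wsum_power_Wset:
  fixes x :: "'a::comm_ring_1"
  assumes "x ^ 3 = x + 2"
  shows "wsum (\<lambda>i. x ^ i) (Wset m k, {m + 3 * k}) = x ^ m"
proof (induction k arbitrary: m)
  case (Suc k)
  have eq: "m + 3 * Suc k = m + 3 + 3 * k" by simp
  have "wsum (\<lambda>i. x ^ i) (Wset m (Suc k), {m + 3 * Suc k})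
      = wsum (\<lambda>i. x ^ i) (Wset (m + 3) k, {m + 3 + 3 * k}) - x ^ m - x ^ (m + 1)"
    unfolding wsum_def Wset_Suc eq by (simp add: Wset_notin[simplified])
  also have "\<dots> = x ^ m * (x ^ 3 - 1 - x)" unfolding Suc by (simp add: power_add algebra_simps)
  also have "x ^ 3 - 1 - x = 1" using assms by simp
  finally show ?case by simp
qed (simp add: wsum_def)

lemma mem_Wset_add: "r < 3 \<Longrightarrow> m + (3 * q + r) \<in> Wset m k \<longleftrightarrow> q < k \<and> r \<noteq> 2"
proof -
  assume r: "r < 3"
  have "(m + (3 * q + r) = m + 3 * n \<or> m + (3 * q + r) = m + 3 * n + 1) \<longleftrightarrow> n = q \<and> r \<noteq> 2" for n
    using r by presburger
  then show ?thesis unfolding mem_Wset by auto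
qed

text \<open>Reaching the term with index \<open>k\<close> meets each of
  \<open>v_m, v_(m+3), ..., v_(m+3k)\<close> once. The case \<open>m \<le> 2\<close> covers the
  generators.\<close>

lemma wcone_Wset:
  assumes "m \<le> 2"
  shows "wcone (Wset m k, {m + 3 * k})"
proof -
  \<comment> \<open>The additional value at \<open>j = 0\<close> for \<open>m = 2\<close> is forced
    by the recursion at 0, which counts \<open>n 2\<close> although there is no
    \<open>v_(-1)\<close>.\<close>
  define n :: "nat \<Rightarrow> nat" where
    "n = (\<lambda>j. if (m \<le> j \<and> j \<le> m + 3 * k \<and> (j - m) mod 3 = 0) \<or> (m = 2 \<and> j = 0) then 1 else 0)"
  have n_shift: "n (m + d) = (if d \<le> 3 * k \<and> d mod 3 = 0 then 1 else 0)" for d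
    by (auto simp: n_def)
  have "wcone_witness (Wset m k, {m + 3 * k}) n"
    unfolding wcone_witness_def
  proof
    show "\<exists>N. \<forall>i\<ge>N. n i = 0"
      by (rule exI[of _ "m + 3 * k + 1"]) (auto simp: n_def)
    show "\<forall>i. int (n i) = 2 * int (n (i + 3)) + int (n (i + 2)) + wsum (chi i) (Wset m k, {m + 3 * k})"
    proof
      fix i
      have w: "wsum (chi i) (Wset m k, {m + 3 * k})
          = (if i = m + 3 * k then 1 else 0) - (if i \<in> Wset m k then 1 else 0)"
        by (subst wsum_chi) auto
      show "int (n i) = 2 * int (n (i + 3)) + int (n (i + 2)) + wsum (chi i) (Wset m k, {m + 3 * k})"
      proof (cases "m \<le> i")
        case True
        define q r where "q = (i - m) div 3" and "r = (i - m) mod 3"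
        have i: "i = m + (3 * q + r)" and r: "r < 3" using True by (auto simp: q_def r_def)
        have shifts: "i + 3 = m + (3 * (q + 1) + r)" "i + 2 = m + (3 * q + (r + 2))" using i by auto
        consider "r = 0" | "r = 1" | "r = 2" using r by linarith
        then show ?thesis
        proof cases
          case 1
          then have "i \<in> Wset m k \<longleftrightarrow> q < k" "i = m + 3 * k \<longleftrightarrow> q = k" using mem_Wset_add[OF r, of m q k] i by auto
          then show ?thesis unfolding w shifts n_shift unfolding i n_shift by (simp add: 1) presburger
        next
          case 2
          then have "i \<in> Wset m k \<longleftrightarrow> q < k" "i \<noteq> m + 3 * k" using mem_Wset_add[OF r, of m q k] i by presburger+
          then show ?thesis unfolding w shifts n_shift unfolding i n_shift by (auto simp: 2)
        next
          case 3
          then have "i \<notin> Wset m k" "i \<noteq> m + 3 * k" using mem_Wset_add[OF r, of m q k] i by presburger+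
          then show ?thesis unfolding w shifts n_shift unfolding i n_shift by (simp add: 3) presburger
        qed
      next
        case False
        then have "i \<notin> Wset m k" "i \<noteq> m + 3 * k" by (auto dest: Wset_ge)
        then have w0: "wsum (chi i) (Wset m k, {m + 3 * k}) = 0" unfolding w by simp
        have "m = 1 \<and> i = 0 \<or> m = 2 \<and> i = 0 \<or> m = 2 \<and> i = 1" using assms False by presburger
        then consider "m = 1" "i = 0" | "m = 2" "i = 0" | "m = 2" "i = 1" by blast
        then have "n i = 2 * n (i + 3) + n (i + 2)"
        proof cases
          case 1
          then have "n 0 = 0" by (simp add: n_def)
          moreover have e: "i + 3 = m + 2" "i + 2 = m + 1" using 1 by auto
          ultimately show ?thesis unfolding e n_shift using 1 by simp
        next
          case 2
          then have "n 0 = 1" by (simp add: n_def)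
          moreover have e: "i + 3 = m + 1" "i + 2 = m + 0" using 2 by auto
          ultimately show ?thesis unfolding e n_shift using 2 by simp
        next
          case 3
          then have "n 1 = 0" by (simp add: n_def)
          moreover have e: "i + 3 = m + 2" "i + 2 = m + 1" using 3 by auto
          ultimately show ?thesis unfolding e n_shift using 3 by simp
        qed
        then show ?thesis unfolding w0 by simp
      qed
    qed
  qed
  then show ?thesis unfolding wcone_def by blast
qed

text \<open>The matrix positions of the nonzero entries of \<open>v_m\<close>: the term with index
  \<open>k\<close> removes \<open>x_(m+3k)\<close> and multiplies by \<open>Wset m k\<close>, which
  must be disjoint from what is left of \<open>T\<close>.\<close>

definition vpat :: "nat \<Rightarrow> (nat set \<times> nat set) set" where
  "vpat m = {(T, S). finite T \<and>
     (\<exists>k. m + 3 * k \<in> T \<and> Wset m k \<inter> (T - {m + 3 * k}) = {} \<and> S = Wset m k \<union> (T - {m + 3 * k}))}"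

lemma vpatE:
  assumes "(T, S) \<in> vpat m"
  obtains k where "finite T" "m + 3 * k \<in> T" "Wset m k \<inter> (T - {m + 3 * k}) = {}"
    "S = Wset m k \<union> (T - {m + 3 * k})"
  using assms unfolding vpat_def by blast

text \<open>Support version of \<open>v_m = d_m + x_m x_(m+1) v_(m+3)\<close>.\<close>

lemma vpat_rec:
  "(T, S) \<in> vpat m \<longleftrightarrow> finite T \<and> ((m \<in> T \<and> S = T - {m}) \<or>
     (m \<notin> T \<and> m + 1 \<notin> T \<and> (\<exists>U. (T, U) \<in> vpat (m + 3) \<and> S = insert m (insert (m + 1) U))))"
  (is "_ \<longleftrightarrow> ?R")
proof
  assume "(T, S) \<in> vpat m"
  then obtain k where k: "finite T" "m + 3 * k \<in> T" "Wset m k \<inter> (T - {m + 3 * k}) = {}"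
    "S = Wset m k \<union> (T - {m + 3 * k})" by (rule vpatE)
  show ?R
  proof (cases k)
    case 0
    with k show ?thesis by simp
  next
    case (Suc k')
    have eq: "m + 3 * k = m + 3 + 3 * k'" using Suc by simp
    have "m \<notin> T" "m + 1 \<notin> T" "Wset (m + 3) k' \<inter> (T - {m + 3 + 3 * k'}) = {}"
      using k(3) unfolding eq unfolding Suc Wset_Suc by auto
    moreover have "S = insert m (insert (m + 1) (Wset (m + 3) k' \<union> (T - {m + 3 + 3 * k'})))"
      using k(4) unfolding eq unfolding Suc Wset_Suc by auto
    ultimately show ?thesis using k(1,2) unfolding eq vpat_def by blast
  qed
next
  assume R: ?R
  show "(T, S) \<in> vpat m"
  proof (cases "m \<in> T")
    case True
    with R show ?thesis unfolding vpat_def by (auto intro!: exI[of _ 0])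
  next
    case False
    with R obtain k where k: "finite T" "m \<notin> T" "m + 1 \<notin> T" "m + 3 + 3 * k \<in> T"
      "Wset (m + 3) k \<inter> (T - {m + 3 + 3 * k}) = {}"
      "S = insert m (insert (m + 1) (Wset (m + 3) k \<union> (T - {m + 3 + 3 * k})))"
      unfolding vpat_def by blast
    have eq: "m + 3 + 3 * k = m + 3 * Suc k" by simp
    have "m + 3 * Suc k \<in> T" using k(4) unfolding eq .
    moreover have "Wset m (Suc k) \<inter> (T - {m + 3 * Suc k}) = {}"
      using k(2,3,5) unfolding eq Wset_Suc by auto
    moreover have "S = Wset m (Suc k) \<union> (T - {m + 3 * Suc k})"
      using k(6) unfolding eq Wset_Suc by auto
    ultimately show ?thesis unfolding vpat_def using k(1) by blast
  qed
qed

lemma vpat_finite: "(T, S) \<in> vpat m \<Longrightarrow> finite T \<and> finite S"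
  unfolding vpat_def by auto

text \<open>For \<open>k < l\<close> the variable \<open>x_(m+3k)\<close> survives the derivative of
  the term \<open>l\<close> and is also one of its factors, so that term vanishes. Hence only one
  term of \<open>v_m\<close> acts on a given monomial, and nothing cancels.\<close>

lemma vpat_unique_index:
  assumes "m + 3 * k \<in> T" "Wset m k \<inter> (T - {m + 3 * k}) = {}"
    "m + 3 * l \<in> T" "Wset m l \<inter> (T - {m + 3 * l}) = {}"
  shows "k = l"
proof (rule ccontr)
  assume "k \<noteq> l"
  then have "m + 3 * k \<in> Wset m l \<or> m + 3 * l \<in> Wset m k"
    unfolding mem_Wset by (metis linorder_neqE_nat)
  then show False using assms \<open>k \<noteq> l\<close> by auto
qed

lemma vpat_functional:
  assumes "(T, S) \<in> vpat m" "(T, S') \<in> vpat m"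
  shows "S = S'"
  using assms vpat_unique_index[of m _ T] by (elim vpatE) metis

lemma wsum_vpat:
  assumes "finite T" "m + 3 * k \<in> T" "Wset m k \<inter> (T - {m + 3 * k}) = {}"
    "S = Wset m k \<union> (T - {m + 3 * k})"
  shows "wsum g (S, T) = wsum g (Wset m k, {m + 3 * k})"
proof -
  have "sum g S = sum g (Wset m k) + sum g (T - {m + 3 * k})"
    unfolding assms(4) using assms(1,3) by (intro sum.union_disjoint) auto
  moreover have "sum g T = g (m + 3 * k) + sum g (T - {m + 3 * k})"
    using assms(1,2) by (rule sum.remove)
  ultimately show ?thesis by (simp add: wsum_def)
qed

lemma vpat_wsum: "(T, S) \<in> vpat m \<Longrightarrow> \<exists>k. wsum g (S, T) = wsum g (Wset m k, {m + 3 * k})"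
  unfolding vpat_def using wsum_vpat by blast

lemma vpat_zw: "(T, S) \<in> vpat m \<Longrightarrow> zw (S, T) = mu ^ m"
  unfolding zw_def using vpat_wsum wsum_power_Wset[OF mu_cubed] by metis

lemma vpat_rw: "(T, S) \<in> vpat m \<Longrightarrow> rw (S, T) = lam ^ m"
  unfolding rw_def using vpat_wsum wsum_power_Wset[OF lam(3)] by metis

lemma wcone_cong:
  assumes "wcone t" "\<And>i. wsum (chi i) s = wsum (chi i) t"
  shows "wcone s"
  using assms unfolding wcone_def wcone_witness_def by simp

lemma vpat_wcone: "(T, S) \<in> vpat m \<Longrightarrow> m \<le> 2 \<Longrightarrow> wcone (S, T)"
proof -
  assume "(T, S) \<in> vpat m" and m: "m \<le> 2"
  then obtain k where "finite T" "m + 3 * k \<in> T" "Wset m k \<inter> (T - {m + 3 * k}) = {}"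
    "S = Wset m k \<union> (T - {m + 3 * k})" by (elim vpatE)
  from wcone_cong[OF wcone_Wset[OF m] wsum_vpat[OF this]] show ?thesis .
qed

lemma vpat_odd: "(T, S) \<in> vpat m \<Longrightarrow> odd (card T + card S)"
proof -
  assume "(T, S) \<in> vpat m"
  then obtain k where k: "finite T" "m + 3 * k \<in> T" "Wset m k \<inter> (T - {m + 3 * k}) = {}"
    "S = Wset m k \<union> (T - {m + 3 * k})" by (rule vpatE)
  have "card S = 2 * k + card (T - {m + 3 * k})"
    unfolding k(4) using k(1,3) by (subst card_Un_disjoint) (auto simp: card_Wset)
  moreover have "card T = Suc (card (T - {m + 3 * k}))" using k(1,2) by (rule card.remove)
  ultimately show ?thesis by simp
qed

lemma vpat_below: "(T, S) \<in> vpat m \<Longrightarrow> j < m \<Longrightarrow> j \<in> T \<longleftrightarrow> j \<in> S"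
  unfolding vpat_def by (auto dest: Wset_ge)

lemma vpat_insert:
  assumes "(T, S) \<in> vpat m" "j < m"
  shows "(insert j T, insert j S) \<in> vpat m"
proof -
  obtain k where k: "finite T" "m + 3 * k \<in> T" "Wset m k \<inter> (T - {m + 3 * k}) = {}"
    "S = Wset m k \<union> (T - {m + 3 * k})" using assms(1) by (rule vpatE)
  have "j \<notin> Wset m k" "j \<noteq> m + 3 * k" using assms(2) by (auto dest: Wset_ge)
  then have "m + 3 * k \<in> insert j T" "Wset m k \<inter> (insert j T - {m + 3 * k}) = {}"
    "insert j S = Wset m k \<union> (insert j T - {m + 3 * k})" using k by auto
  then show ?thesis unfolding vpat_def using k(1) by blast
qed

lemma vpat_remove:
  assumes "(T, S) \<in> vpat m" "j < m"
  shows "(T - {j}, S - {j}) \<in> vpat m"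
proof -
  obtain k where k: "finite T" "m + 3 * k \<in> T" "Wset m k \<inter> (T - {m + 3 * k}) = {}"
    "S = Wset m k \<union> (T - {m + 3 * k})" using assms(1) by (rule vpatE)
  have "j \<notin> Wset m k" "j \<noteq> m + 3 * k" using assms(2) by (auto dest: Wset_ge)
  then have "m + 3 * k \<in> T - {j}" "Wset m k \<inter> (T - {j} - {m + 3 * k}) = {}"
    "S - {j} = Wset m k \<union> (T - {j} - {m + 3 * k})" using k by auto
  then show ?thesis unfolding vpat_def using k(1) by blast
qed

text \<open>Support version of \<open>v_m^2 = x_(m+1) v_(m+3)\<close>. In the case
  \<open>m \<in> T\<close> the derivative \<open>d_m\<close> acts first, otherwise it acts
  second.\<close>

lemma vpat_sq:
  "(\<exists>U. (T, U) \<in> vpat m \<and> (U, S) \<in> vpat m)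
     \<longleftrightarrow> m + 1 \<notin> T \<and> (\<exists>U. (T, U) \<in> vpat (m + 3) \<and> S = insert (m + 1) U)" (is "?L \<longleftrightarrow> ?R")
proof
  assume ?L
  then obtain U where U: "(T, U) \<in> vpat m" "(U, S) \<in> vpat m" by blast
  show ?R
  proof (cases "m \<in> T")
    case True
    with U(1) have U': "U = T - {m}" using vpat_rec[of T U m] by simp
    with U(2) obtain V where V: "m + 1 \<notin> U" "(U, V) \<in> vpat (m + 3)" "S = insert m (insert (m + 1) V)"
      using vpat_rec[of U S m] by auto
    have "(insert m U, insert m V) \<in> vpat (m + 3)" by (rule vpat_insert[OF V(2)]) simp
    moreover have "insert m U = T" using U' True by auto
    ultimately show ?thesis using V U' by (auto simp: insert_commute)
  next
    case False
    with U(1) obtain V where V: "m + 1 \<notin> T" "(T, V) \<in> vpat (m + 3)" "U = insert m (insert (m + 1) V)"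
      using vpat_rec[of T U m] by blast
    have "m \<notin> V" using vpat_below[OF V(2), of m] False by simp
    moreover have "S = U - {m}" using U(2) V(3) vpat_rec[of U S m] by blast
    ultimately have "S = insert (m + 1) V" using V(3) by auto
    with V show ?thesis by blast
  qed
next
  assume ?R
  then obtain V where V: "m + 1 \<notin> T" "(T, V) \<in> vpat (m + 3)" "S = insert (m + 1) V" by blast
  have fin: "finite T" "finite V" using vpat_finite[OF V(2)] by auto
  show ?L
  proof (cases "m \<in> T")
    case True
    have "m \<in> V" using vpat_below[OF V(2), of m] True by simp
    have "(T - {m}, V - {m}) \<in> vpat (m + 3)" by (rule vpat_remove[OF V(2)]) simp
    moreover have "S = insert m (insert (m + 1) (V - {m}))" using V(3) \<open>m \<in> V\<close> by auto
    ultimately have "(T - {m}, S) \<in> vpat m" using V(1) fin unfolding vpat_rec[of "T - {m}" S m] by auto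
    moreover have "(T, T - {m}) \<in> vpat m" using True fin unfolding vpat_rec[of T _ m] by simp
    ultimately show ?thesis by blast
  next
    case False
    have "m \<notin> V" using vpat_below[OF V(2), of m] False by simp
    have "(T, insert m (insert (m + 1) V)) \<in> vpat m"
      using False V fin unfolding vpat_rec[of T _ m] by blast
    moreover have "(insert m (insert (m + 1) V), S) \<in> vpat m"
      using V(3) \<open>m \<notin> V\<close> fin unfolding vpat_rec[of "insert m (insert (m + 1) V)" S m] by auto
    ultimately show ?thesis by blast
  qed
qed

lemma ocomp_nonzero:
  assumes "ocomp a b (T, S) \<noteq> 0"
  obtains U where "b (T, U) \<noteq> 0" "a (U, S) \<noteq> 0"
proof -
  have "(\<Sum>U\<in>{U. b (T, U) \<noteq> 0}. b (T, U) * a (U, S)) \<noteq> 0" using assms by (simp add: ocomp_def)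
  then obtain U where "b (T, U) * a (U, S) \<noteq> 0" by (meson sum.neutral)
  then show ?thesis using that by auto
qed

lemma ocomp_functional:
  assumes "\<And>T U U'. b (T, U) \<noteq> 0 \<Longrightarrow> b (T, U') \<noteq> 0 \<Longrightarrow> U = U'"
  shows "ocomp a b (T, S) \<noteq> 0 \<longleftrightarrow> (\<exists>U. b (T, U) \<noteq> 0 \<and> a (U, S) \<noteq> 0)"
proof
  assume "\<exists>U. b (T, U) \<noteq> 0 \<and> a (U, S) \<noteq> 0"
  then obtain U where U: "b (T, U) \<noteq> 0" "a (U, S) \<noteq> 0" by blast
  then have "{U. b (T, U) \<noteq> 0} = {U}" using assms by blast
  then show "ocomp a b (T, S) \<noteq> 0" using U by (simp add: ocomp_def)
qed (metis ocomp_nonzero)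

text \<open>Here \<open>a\<close> and \<open>b\<close> are known only up to the values of their
  nonzero entries. Cancellation is excluded all the same: \<open>b a^2\<close> lives on rows with
  \<open>m + 1 \<notin> T\<close> and \<open>a^2 b\<close> on rows with
  \<open>m + 1 \<in> T\<close>.\<close>

lemma supp_commutator_vpat:
  fixes a b :: "'k::field endo"
  assumes a: "supp a = vpat m" and b: "supp b = vpat (m + 1)"
  shows "supp (vsub (ocomp b (ocomp a a)) (ocomp (ocomp a a) b)) = vpat (m + 3)"
proof -
  have a': "a (T, S) \<noteq> 0 \<longleftrightarrow> (T, S) \<in> vpat m" and b': "b (T, S) \<noteq> 0 \<longleftrightarrow> (T, S) \<in> vpat (m + 1)" for T S
    using a b unfolding supp_def by blast+
  have aa: "ocomp a a (T, S) \<noteq> 0 \<longleftrightarrow> m + 1 \<notin> T \<and> (\<exists>U. (T, U) \<in> vpat (m + 3) \<and> S = insert (m + 1) U)" for T S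
    using vpat_sq[of T m S] by (subst ocomp_functional) (auto simp: a' dest: vpat_functional)
  have baa: "ocomp b (ocomp a a) (T, S) \<noteq> 0 \<longleftrightarrow> m + 1 \<notin> T \<and> (T, S) \<in> vpat (m + 3)" for T S
  proof -
    have "(insert (m + 1) U, S) \<in> vpat (m + 1) \<longleftrightarrow> S = U" if "m + 1 \<notin> T" "(T, U) \<in> vpat (m + 3)" for U
    proof -
      have "m + 1 \<notin> U" using vpat_below[OF that(2), of "m + 1"] that(1) by simp
      then show ?thesis
        using vpat_finite[OF that(2)] unfolding vpat_rec[of "insert (m + 1) U" S "m + 1"] by auto
    qed
    then show ?thesis
      by (subst ocomp_functional) (auto simp: aa b' simp del: Suc_eq_plus1 add_Suc_right dest: vpat_functional)
  qed
  have aab: "ocomp (ocomp a a) b (T, S) \<noteq> 0 \<longleftrightarrow> m + 1 \<in> T \<and> (T, S) \<in> vpat (m + 3)" for T S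
  proof -
    have "(\<exists>V. (T, V) \<in> vpat (m + 1) \<and> m + 1 \<notin> V \<and> (\<exists>U. (V, U) \<in> vpat (m + 3) \<and> S = insert (m + 1) U))
        \<longleftrightarrow> m + 1 \<in> T \<and> (T, S) \<in> vpat (m + 3)" (is "?L \<longleftrightarrow> ?R")
    proof
      assume ?L
      then obtain V U where V: "(T, V) \<in> vpat (m + 1)" "m + 1 \<notin> V" "(V, U) \<in> vpat (m + 3)" "S = insert (m + 1) U"
        by blast
      have T: "m + 1 \<in> T" "V = T - {m + 1}" using V(1,2) unfolding vpat_rec[of T V "m + 1"] by auto
      have "(insert (m + 1) V, insert (m + 1) U) \<in> vpat (m + 3)" by (rule vpat_insert[OF V(3)]) simp
      moreover have "insert (m + 1) V = T" using T by auto
      ultimately show ?R using T V(4) by simp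
    next
      assume R: ?R
      have "(T - {m + 1}, S - {m + 1}) \<in> vpat (m + 3)" by (rule vpat_remove) (use R in auto)
      moreover have "m + 1 \<in> S" using R vpat_below[of T S "m + 3" "m + 1"] by simp
      then have "S = insert (m + 1) (S - {m + 1})" by auto
      moreover have "(T, T - {m + 1}) \<in> vpat (m + 1)"
        using R vpat_finite[of T S] unfolding vpat_rec[of T _ "m + 1"] by blast
      ultimately show ?L by blast
    qed
    then show ?thesis by (subst ocomp_functional) (auto simp: aa b' dest: vpat_functional)
  qed
  have "ocomp b (ocomp a a) t - ocomp (ocomp a a) b t \<noteq> 0
      \<longleftrightarrow> ocomp b (ocomp a a) t \<noteq> 0 \<or> ocomp (ocomp a a) b t \<noteq> 0" for t
  proof (cases t)
    case (Pair T S)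
    then show ?thesis using baa[of T S] aab[of T S]
      by (cases "ocomp b (ocomp a a) t = 0"; cases "ocomp (ocomp a a) b t = 0"; simp)
  qed
  note nz = this
  show ?thesis
  proof (intro set_eqI)
    fix t :: "nat set \<times> nat set"
    obtain T S where t: "t = (T, S)" by (cases t)
    have "t \<in> supp (vsub (ocomp b (ocomp a a)) (ocomp (ocomp a a) b))
        \<longleftrightarrow> ocomp b (ocomp a a) t \<noteq> 0 \<or> ocomp (ocomp a a) b t \<noteq> 0"
      using nz[of t] unfolding supp_def vsub_def by blast
    then show "t \<in> supp (vsub (ocomp b (ocomp a a)) (ocomp (ocomp a a) b)) \<longleftrightarrow> t \<in> vpat (m + 3)"
      using baa[of T S] aab[of T S] unfolding t by blast
  qed
qed


section \<open>The Lie superalgebra and the associative algebra\<close>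

lemma ocomp_lmulop_dop:
  assumes "j \<in> T"
  shows "ocomp (lmulop W) (dop j) (T, S) \<noteq> (0 :: 'k::field)
    \<longleftrightarrow> finite T \<and> W \<inter> (T - {j}) = {} \<and> S = W \<union> (T - {j})"
proof -
  have d: "dop j (T, U) \<noteq> (0 :: 'k) \<longleftrightarrow> finite T \<and> U = T - {j}" if "j \<in> T" for T U
    using that by (simp add: dop_def)
  have d0: "dop j (T, U) = (0 :: 'k)" if "j \<notin> T" for T U using that by (simp add: dop_def)
  have "dop j (T, U) \<noteq> (0 :: 'k) \<Longrightarrow> dop j (T, U') \<noteq> (0 :: 'k) \<Longrightarrow> U = U'" for T U U'
    using d[of T U] d[of T U'] d0[of T U] by (cases "j \<in> T") auto
  then have "ocomp (lmulop W) (dop j) (T, S) \<noteq> (0 :: 'k)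
      \<longleftrightarrow> (\<exists>U. dop j (T, U) \<noteq> (0 :: 'k) \<and> lmulop W (U, S) \<noteq> (0 :: 'k))"
    by (rule ocomp_functional)
  also have "\<dots> \<longleftrightarrow> finite T \<and> lmulop W (T - {j}, S) \<noteq> (0 :: 'k)"
    using d[OF assms] by auto
  also have "\<dots> \<longleftrightarrow> finite T \<and> W \<inter> (T - {j}) = {} \<and> S = W \<union> (T - {j})"
    by (auto simp: lmulop_def gsgn_def)
  finally show ?thesis .
qed

lemma supp_vop: "supp (vop m :: 'k::field endo) = vpat m"
proof (intro set_eqI)
  fix t :: "nat set \<times> nat set"
  obtain T S where t: "t = (T, S)" by (cases t)
  define trm where "trm = (\<lambda>k. ocomp (lmulop (Wset m k)) (dop (m + 3 * k)) (T, S) :: 'k)"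
  have v: "vop m t = (\<Sum>k\<in>{k. m + 3 * k \<in> T}. trm k)" by (simp add: vop_def t trm_def)
  have trm: "trm k \<noteq> 0 \<longleftrightarrow> finite T \<and> Wset m k \<inter> (T - {m + 3 * k}) = {} \<and> S = Wset m k \<union> (T - {m + 3 * k})"
    if "m + 3 * k \<in> T" for k unfolding trm_def by (rule ocomp_lmulop_dop[OF that])
  show "t \<in> supp (vop m :: 'k endo) \<longleftrightarrow> t \<in> vpat m"
  proof
    assume "t \<in> supp (vop m :: 'k endo)"
    then have "(\<Sum>k\<in>{k. m + 3 * k \<in> T}. trm k) \<noteq> 0" using v by (simp add: supp_def)
    then obtain k where "m + 3 * k \<in> T" "trm k \<noteq> 0" by (metis (mono_tags, lifting) mem_Collect_eq sum.neutral)
    then show "t \<in> vpat m" using trm unfolding vpat_def t by blast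
  next
    assume "t \<in> vpat m"
    then obtain k where k: "finite T" "m + 3 * k \<in> T" "Wset m k \<inter> (T - {m + 3 * k}) = {}"
      "S = Wset m k \<union> (T - {m + 3 * k})" unfolding vpat_def t by blast
    have fin: "finite {k. m + 3 * k \<in> T}"
      using finite_vimageI[OF k(1), of "\<lambda>k. m + 3 * k"] by (simp add: inj_on_def vimage_def)
    have "trm l = 0" if "m + 3 * l \<in> T" "l \<noteq> k" for l
      using trm[OF that(1)] vpat_unique_index[OF k(2,3) that(1)] that(2) by blast
    then have "vop m t = trm k"
      unfolding v using fin k(2) by (subst sum.remove[of _ k]) (auto intro: sum.neutral)
    then show "t \<in> supp (vop m :: 'k endo)" using trm[OF k(2)] k by (simp add: supp_def)
  qed
qed

definition goodE :: "(nat set \<times> nat set) set" where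
  "goodE = {(T, S). finite T \<and> finite S \<and> wcone (S, T) \<and> 0 < rw (S, T)}"

definition wE :: "nat set \<times> nat set \<Rightarrow> complex \<times> real" where
  "wE t = (zw (snd t, fst t), rw (snd t, fst t))"

lemma wsum_compose: "wsum g (S, T) = wsum g (S, U) + wsum g (U, T)"
  by (simp add: wsum_def)

lemma goodE_compose:
  assumes "(T, U) \<in> goodE" "(U, S) \<in> goodE"
  shows "(T, S) \<in> goodE" "wE (T, S) = wE (U, S) + wE (T, U)"
proof -
  have "wcone (S, T)"
    by (rule wcone_add[of "(S, U)" "(U, T)"]) (use assms in \<open>auto simp: goodE_def intro: wsum_compose\<close>)
  moreover have "rw (S, T) = rw (S, U) + rw (U, T)" unfolding rw_def by (rule wsum_compose)
  ultimately show "(T, S) \<in> goodE" using assms by (auto simp: goodE_def)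
  show "wE (T, S) = wE (U, S) + wE (T, U)"
    using wsum_compose[of "\<lambda>i. mu ^ i" S T U] wsum_compose[of "\<lambda>i. lam ^ i" S T U]
    by (simp add: wE_def zw_def rw_def)
qed

lemma ocomp_supp_weight:
  assumes "supp a \<subseteq> goodE" "supp b \<subseteq> goodE" "t \<in> supp (ocomp a b)"
  shows "t \<in> goodE \<and> (\<exists>s\<in>supp a. \<exists>u\<in>supp b. wE t = wE s + wE u)"
proof -
  obtain T S where t: "t = (T, S)" by (cases t)
  obtain U where U: "b (T, U) \<noteq> 0" "a (U, S) \<noteq> 0"
    using assms(3) unfolding t supp_def by (auto elim: ocomp_nonzero)
  then have in_supp: "(T, U) \<in> supp b" "(U, S) \<in> supp a" by (simp_all add: supp_def)
  then have "(T, U) \<in> goodE" "(U, S) \<in> goodE" using assms by auto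
  from goodE_compose[OF this] show ?thesis unfolding t using in_supp by blast
qed

lemma ocomp_additive: "additive_op goodE wE ocomp"
  unfolding additive_op_def using ocomp_supp_weight by blast

lemma ocomp_sq_additive: "additive_sq goodE wE (\<lambda>a. ocomp a a)"
  unfolding additive_sq_def using ocomp_supp_weight by blast

definition oddE :: "'k::field endo \<Rightarrow> 'k endo" where
  "oddE a = vsub a (pe_op a)"

lemma supp_oddE: "supp (oddE a) \<subseteq> supp a"
  by (auto simp: oddE_def vsub_def pe_op_def supp_def split: if_splits)

lemma bracket_op_eq:
  "bracket_op a b = vadd (vsub (ocomp a b) (ocomp b a)) (vsc 2 (ocomp (oddE b) (oddE a)))"
  by (simp add: bracket_op_def oddE_def)

lemma bracket_op_additive: "additive_op goodE wE bracket_op"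
  unfolding additive_op_def
proof (intro allI impI)
  fix a b :: "'a endo" and t assume *: "supp a \<subseteq> goodE" "supp b \<subseteq> goodE" "t \<in> supp (bracket_op a b)"
  have "supp (bracket_op a b) \<subseteq> supp (ocomp a b) \<union> supp (ocomp b a) \<union> supp (ocomp (oddE b) (oddE a))"
    unfolding bracket_op_eq by (auto simp: supp_def vadd_def vsub_def vsc_def)
  with *(3) consider "t \<in> supp (ocomp a b)" | "t \<in> supp (ocomp b a)" | "t \<in> supp (ocomp (oddE b) (oddE a))"
    by blast
  then show "t \<in> goodE \<and> (\<exists>s\<in>supp a. \<exists>u\<in>supp b. wE t = wE s + wE u)"
  proof cases
    case 1
    with * show ?thesis using ocomp_supp_weight by blast
  next
    case 2
    with * show ?thesis using ocomp_supp_weight[of b a t] by (metis add.commute)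
  next
    case 3
    have "supp (oddE a) \<subseteq> goodE" "supp (oddE b) \<subseteq> goodE" using * supp_oddE by blast+
    from ocomp_supp_weight[OF this(2,1) 3] show ?thesis
      using supp_oddE by (metis add.commute subsetD)
  qed
qed

text \<open>\<open>ocomp a b\<close> sums over the nonzero entries in a row of \<open>b\<close>, and
  the sum is 0 by default if that row is infinite. Finite rows make it additive in
  \<open>b\<close>.\<close>

definition rowfin :: "'k::field endo \<Rightarrow> bool" where
  "rowfin a \<longleftrightarrow> (\<forall>T. finite {U. a (T, U) \<noteq> 0})"

lemma rowfin_subset:
  assumes "rowfin a" "supp b \<subseteq> supp a"
  shows "rowfin b"
  unfolding rowfin_def
proof
  fix T
  have "{U. b (T, U) \<noteq> 0} \<subseteq> {U. a (T, U) \<noteq> 0}" using assms(2) by (auto simp: supp_def)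
  then show "finite {U. b (T, U) \<noteq> 0}" using assms(1) finite_subset unfolding rowfin_def by blast
qed

lemma rowfin_vadd:
  assumes "rowfin a" "rowfin b"
  shows "rowfin (vadd a b)"
  unfolding rowfin_def
proof
  fix T
  have "{U. vadd a b (T, U) \<noteq> 0} \<subseteq> {U. a (T, U) \<noteq> 0} \<union> {U. b (T, U) \<noteq> 0}" by (auto simp: vadd_def)
  moreover have "finite ({U. a (T, U) \<noteq> 0} \<union> {U. b (T, U) \<noteq> 0})" using assms by (simp add: rowfin_def)
  ultimately show "finite {U. vadd a b (T, U) \<noteq> 0}" by (rule finite_subset)
qed

lemma rowfin_ocomp:
  assumes "rowfin a" "rowfin b"
  shows "rowfin (ocomp a b)"
  unfolding rowfin_def
proof
  fix T
  have "{S. ocomp a b (T, S) \<noteq> 0} \<subseteq> (\<Union>U\<in>{U. b (T, U) \<noteq> 0}. {S. a (U, S) \<noteq> 0})"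
    by (auto elim!: ocomp_nonzero)
  moreover have "finite (\<Union>U\<in>{U. b (T, U) \<noteq> 0}. {S. a (U, S) \<noteq> 0})"
    using assms unfolding rowfin_def by (intro finite_UN_I) auto
  ultimately show "finite {S. ocomp a b (T, S) \<noteq> 0}" by (rule finite_subset)
qed

lemma rowfin_vop: "rowfin (vop m)"
  unfolding rowfin_def
proof
  fix T
  have v: "vop m (T, U) \<noteq> (0 :: 'a) \<longleftrightarrow> (T, U) \<in> vpat m" for U
    using supp_vop[of m, where 'k = 'a] by (auto simp: supp_def)
  show "finite {U. vop m (T, U) \<noteq> (0 :: 'a)}"
  proof (cases "\<exists>U. (T, U) \<in> vpat m")
    case True
    then obtain U where "(T, U) \<in> vpat m" by blast
    then have "{U. vop m (T, U) \<noteq> (0 :: 'a)} \<subseteq> {U}" using v vpat_functional by blast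
    then show ?thesis by (rule finite_subset) simp
  next
    case False
    then have "{U. vop m (T, U) \<noteq> (0 :: 'a)} = {}" using v by blast
    then show ?thesis by simp
  qed
qed

lemma ocomp_add_left: "ocomp (vadd a a') b = vadd (ocomp a b) (ocomp a' b)"
  by (auto simp: ocomp_def vadd_def fun_eq_iff distrib_left sum.distrib)

lemma ocomp_add_right:
  assumes "rowfin b" "rowfin b'"
  shows "ocomp a (vadd b b') = vadd (ocomp a b) (ocomp a b')"
proof
  fix t :: "nat set \<times> nat set"
  obtain T S where t: "t = (T, S)" by (cases t)
  define F where "F = {U. b (T, U) \<noteq> 0} \<union> {U. b' (T, U) \<noteq> 0}"
  have F: "finite F" using assms by (simp add: F_def rowfin_def)
  have eq: "ocomp a c (T, S) = (\<Sum>U\<in>F. c (T, U) * a (U, S))" if "{U. c (T, U) \<noteq> 0} \<subseteq> F" for c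
    unfolding ocomp_def prod.case by (rule sum.mono_neutral_left) (use F that in auto)
  have "ocomp a (vadd b b') (T, S) = (\<Sum>U\<in>F. vadd b b' (T, U) * a (U, S))"
    by (rule eq) (auto simp: F_def vadd_def)
  moreover have "ocomp a b (T, S) = (\<Sum>U\<in>F. b (T, U) * a (U, S))"
    by (rule eq) (auto simp: F_def)
  moreover have "ocomp a b' (T, S) = (\<Sum>U\<in>F. b' (T, U) * a (U, S))"
    by (rule eq) (auto simp: F_def)
  ultimately show "ocomp a (vadd b b') t = vadd (ocomp a b) (ocomp a b') t"
    unfolding t by (simp add: vadd_def distrib_right sum.distrib)
qed

lemma oddE_add: "oddE (vadd a b) = vadd (oddE a) (oddE b)"
  by (auto simp: oddE_def vsub_def vadd_def pe_op_def fun_eq_iff)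

definition admE :: "'k::field endo \<Rightarrow> bool" where
  "admE a \<longleftrightarrow> rowfin a \<and> supp a \<subseteq> goodE"

lemma admE_rowfin: "admE a \<Longrightarrow> rowfin a"
  and admE_supp: "admE a \<Longrightarrow> supp a \<subseteq> goodE"
  by (auto simp: admE_def)

lemma admE_subset: "admE a \<Longrightarrow> supp b \<subseteq> supp a \<Longrightarrow> admE b"
  unfolding admE_def using rowfin_subset[of a b] by auto

lemma admE_vadd: "admE a \<Longrightarrow> admE b \<Longrightarrow> admE (vadd a b)"
  unfolding admE_def using rowfin_vadd[of a b] supp_vadd[of a b] by auto

lemma admE_ocomp: "admE a \<Longrightarrow> admE b \<Longrightarrow> admE (ocomp a b)"
  unfolding admE_def using rowfin_ocomp[of a b] ocomp_supp_weight[of a b] by auto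

lemma admE_z0: "admE z0"
  by (simp add: admE_def rowfin_def z0_def supp_def)

lemma admE_oddE: "admE a \<Longrightarrow> admE (oddE a)"
  by (rule admE_subset[OF _ supp_oddE])

lemma admE_bracket: "admE a \<Longrightarrow> admE b \<Longrightarrow> admE (bracket_op a b)"
proof -
  assume a: "admE a" and b: "admE b"
  have "vsub (ocomp a b) (ocomp b a) = vadd (ocomp a b) (vsc (- 1) (ocomp b a))"
    by (simp add: vsub_def vadd_def vsc_def)
  then show ?thesis
    unfolding bracket_op_eq
    by (simp only:) (intro admE_vadd admE_ocomp admE_oddE admE_subset[OF _ supp_vsc] a b)
qed

lemma bracket_add_left:
  assumes "rowfin a" "rowfin a'"
  shows "bracket_op (vadd a a') b = vadd (bracket_op a b) (bracket_op a' b)"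
proof -
  have "rowfin (oddE a)" "rowfin (oddE a')"
    using rowfin_subset[OF assms(1) supp_oddE] rowfin_subset[OF assms(2) supp_oddE] .
  then show ?thesis
    unfolding bracket_op_eq oddE_add ocomp_add_left
    by (simp add: ocomp_add_right assms) (simp add: vadd_def vsub_def vsc_def fun_eq_iff algebra_simps)
qed

lemma bracket_add_right:
  assumes "rowfin b" "rowfin b'"
  shows "bracket_op a (vadd b b') = vadd (bracket_op a b) (bracket_op a b')"
  unfolding bracket_op_eq oddE_add ocomp_add_left
  by (simp add: ocomp_add_right assms) (simp add: vadd_def vsub_def vsc_def fun_eq_iff algebra_simps)

lemma admE_vop: "m \<le> 2 \<Longrightarrow> admE (vop m)"
proof -
  assume m: "m \<le> 2"
  have "(T, S) \<in> goodE" if "(T, S) \<in> vpat m" for T S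
    using vpat_finite[OF that] vpat_wcone[OF that m] vpat_rw[OF that] lam(1) by (simp add: goodE_def)
  then show ?thesis unfolding admE_def supp_vop by (simp add: rowfin_vop subset_iff)
qed

lemma homw_vpat: "supp a = vpat m \<Longrightarrow> homw wE a"
  unfolding homw_def wE_def by (auto simp: vpat_zw vpat_rw)

lemma homw_vop: "homw wE (vop m)"
  by (rule homw_vpat[OF supp_vop])

lemma wgraded_Q:
  "wgraded (\<lambda>(T, S). even (card T + card S)) pe_op [bracket_op] (\<lambda>a. ocomp a a)
     {vop 0, vop 1, vop 2 :: 'k::field endo} wE goodE admE"
proof
  fix a a' b b' :: "'k endo"
  show "pe_op a = (\<lambda>t. if (case t of (T, S) \<Rightarrow> even (card T + card S)) then a t else 0)"
    by (auto simp: pe_op_def fun_eq_iff)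
  show "admE (z0 :: 'k endo)" by (rule admE_z0)
  show "admE (vadd a b)" if "admE a" "admE b" by (rule admE_vadd[OF that])
  show "admE b" if "admE a" "supp b \<subseteq> supp a" by (rule admE_subset[OF that])
  show "admE (ocomp a a)" if "admE a" by (rule admE_ocomp[OF that that])
  show "supp a \<subseteq> goodE" if "admE a" by (rule admE_supp[OF that])
  show "additive_sq goodE wE (\<lambda>a :: 'k endo. ocomp a a)" by (rule ocomp_sq_additive)
  show "admE a \<and> homw wE a" if "a \<in> {vop 0, vop 1, vop 2}"
    using that by (elim insertE emptyE) (simp_all add: admE_vop homw_vop)
  show "admE (f a b)" if "f \<in> set [bracket_op]" "admE a" "admE b" for f
    using that by (simp add: admE_bracket)
  show "f (vadd a a') b = vadd (f a b) (f a' b)"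
    if "f \<in> set [bracket_op]" "admE a" "admE a'" "admE b" for f
    using that by (simp add: bracket_add_left admE_rowfin)
  show "f a (vadd b b') = vadd (f a b) (f a b')"
    if "f \<in> set [bracket_op]" "admE a" "admE b" "admE b'" for f
    using that by (simp add: bracket_add_right admE_rowfin)
  show "additive_op goodE wE f" if "f \<in> set [bracket_op]" for f :: "'k endo \<Rightarrow> 'k endo \<Rightarrow> 'k endo"
    using that by (simp add: bracket_op_additive)
  assume ab: "admE a" "admE b" "pe_op a = z0" "pe_op b = z0"
  have od: "oddE a = a" "oddE b = b" using ab by (simp_all add: oddE_def vsub_def z0_def)
  \<comment> \<open>On odd elements the correction term turns the commutator into the
    anticommutator, the polar form of the square.\<close>
  have "bracket_op a b = vadd (ocomp a b) (ocomp b a)"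
    unfolding bracket_op_eq od by (simp add: vadd_def vsub_def vsc_def fun_eq_iff)
  moreover have "ocomp (vadd a b) (vadd a b)
      = vadd (vadd (ocomp a a) (ocomp a b)) (vadd (ocomp b a) (ocomp b b))"
    using ab by (simp add: ocomp_add_left ocomp_add_right admE_rowfin)
  ultimately have "ocomp (vadd a b) (vadd a b) = vadd (ocomp a a) (vadd (bracket_op a b) (ocomp b b))"
    by (simp add: vadd_def fun_eq_iff algebra_simps)
  then show "\<exists>m. (m = (\<lambda>_ _. z0) \<or> m \<in> set [bracket_op]) \<and>
      ocomp (vadd a b) (vadd a b) = vadd (ocomp a a) (vadd (m a b) (ocomp b b))"
    by (intro exI[of _ bracket_op]) simp
qed

lemma wgraded_A:
  "wgraded (\<lambda>_. True) id [ocomp] (\<lambda>_. z0) {vop 0, vop 1, vop 2 :: 'k::field endo} wE goodE admE"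
proof
  fix a a' b b' :: "'k endo"
  show "id a = (\<lambda>t. if True then a t else 0)" by simp
  show "admE (z0 :: 'k endo)" "admE (z0 :: 'k endo)" by (rule admE_z0)+
  show "admE (vadd a b)" if "admE a" "admE b" by (rule admE_vadd[OF that])
  show "admE b" if "admE a" "supp b \<subseteq> supp a" by (rule admE_subset[OF that])
  show "supp a \<subseteq> goodE" if "admE a" by (rule admE_supp[OF that])
  show "additive_sq goodE wE (\<lambda>_ :: 'k endo. z0 :: 'k endo)" by (simp add: additive_sq_def)
  show "admE a \<and> homw wE a" if "a \<in> {vop 0, vop 1, vop 2}"
    using that by (elim insertE emptyE) (simp_all add: admE_vop homw_vop)
  show "admE (f a b)" if "f \<in> set [ocomp]" "admE a" "admE b" for f
    using that by (simp add: admE_ocomp)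
  show "f (vadd a a') b = vadd (f a b) (f a' b)"
    if "f \<in> set [ocomp]" "admE a" "admE a'" "admE b" for f
    using that by (simp add: ocomp_add_left)
  show "f a (vadd b b') = vadd (f a b) (f a b')"
    if "f \<in> set [ocomp]" "admE a" "admE b" "admE b'" for f
    using that by (simp add: ocomp_add_right admE_rowfin)
  show "additive_op goodE wE f" if "f \<in> set [ocomp]" for f :: "'k endo \<Rightarrow> 'k endo \<Rightarrow> 'k endo"
    using that by (simp add: ocomp_additive)
  show "\<exists>m. (m = (\<lambda>_ _. z0) \<or> m \<in> set [ocomp]) \<and> (z0 :: 'k endo) = vadd z0 (vadd (m a b) z0)"
    by (intro exI[of _ "\<lambda>_ _. z0"]) simp
qed

lemma goodE_bound: "t \<in> goodE \<Longrightarrow> (cmod (fst (wE t)))\<^sup>2 \<le> 130 * snd (wE t)"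
  by (auto simp: goodE_def wE_def intro!: wcone_square_bound)

lemma goodE_lin_nonzero: "t \<in> goodE \<Longrightarrow> s \<in> good_slopes \<Longrightarrow> lin s (fst (wE t)) \<noteq> 0"
  using wcone_lin_nonzero[of "(snd t, fst t)" s] by (auto simp: goodE_def wE_def)

text \<open>Only the support of \<open>[v\<^sub>n\<^sub>+\<^sub>1, v\<^sub>n\<^sup>2] = \<plusminus>v\<^sub>n\<^sub>+\<^sub>3\<close> matters, so no signs have to be computed.\<close>

lemma vpat_elements_induct:
  fixes L :: "'k::field endo set"
  assumes "vop 0 \<in> L" "vop 1 \<in> L" "vop 2 \<in> L"
    and step: "\<And>n a b. a \<in> L \<Longrightarrow> b \<in> L \<Longrightarrow> supp a = vpat n \<Longrightarrow> supp b = vpat (n + 1) \<Longrightarrow>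
      \<exists>c\<in>L. supp c = vpat (n + 3)"
  shows "\<exists>e\<in>L. supp e = vpat n"
proof (induction n rule: less_induct)
  case (less n)
  consider "n = 0" | "n = 1" | "n = 2" | "n = (n - 3) + 3" by linarith
  then show ?case
  proof cases
    case 4
    then have "\<exists>e\<in>L. supp e = vpat (n - 3)" "\<exists>e\<in>L. supp e = vpat (n - 3 + 1)"
      using less by (metis add_less_cancel_left less_add_same_cancel1 one_less_numeral_iff
          semiring_norm(77) zero_less_numeral)+
    with step show ?thesis using 4 by metis
  qed (use assms(1-3) supp_vop in \<open>metis+\<close>)
qed

text \<open>The square of the odd element \<open>a\<close> is again in \<open>Qalg\<close> and is
  even, so its bracket with \<open>b\<close> is an ordinary commutator.\<close>

lemma Qalg_vpat: "\<exists>e\<in>(Qalg :: 'k::field endo set). supp e = vpat n"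
proof (rule vpat_elements_induct)
  show "vop 0 \<in> (Qalg :: 'k endo set)" "vop 1 \<in> (Qalg :: 'k endo set)" "vop 2 \<in> (Qalg :: 'k endo set)"
    unfolding Qalg_def by (rule subsetD[OF generated_incl], simp)+
  fix m and a b :: "'k endo"
  assume ab: "a \<in> Qalg" "b \<in> Qalg" and s: "supp a = vpat m" "supp b = vpat (m + 1)"
  note sub = is_subalg_generated[of pe_op "[bracket_op]" "\<lambda>a. ocomp a a" "{vop 0, vop 1, vop 2 :: 'k endo}",
      folded Qalg_def]
  have odd: "odd (card T + card S)" if "a (T, S) \<noteq> 0" for T S
    using that s(1) vpat_odd unfolding supp_def by blast
  have "pe_op a = z0"
  proof
    fix t :: "nat set \<times> nat set"
    show "pe_op a t = z0 t" using odd[of "fst t" "snd t"] by (cases t) (auto simp: pe_op_def z0_def)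
  qed
  then have sq: "ocomp a a \<in> Qalg" by (rule is_subalgD(4)[OF sub ab(1)])
  have "even (card T + card S)" if nz: "ocomp a a (T, S) \<noteq> 0" for T S
  proof -
    obtain U where "a (T, U) \<noteq> 0" "a (U, S) \<noteq> 0" using nz by (rule ocomp_nonzero)
    then have "odd (card T + card U)" "odd (card U + card S)" using odd by blast+
    then show ?thesis by simp
  qed
  note even = this
  have "oddE (ocomp a a) = z0"
  proof
    fix t :: "nat set \<times> nat set"
    show "oddE (ocomp a a) t = z0 t" using even[of "fst t" "snd t"]
      by (cases t) (auto simp: oddE_def vsub_def pe_op_def z0_def)
  qed
  then have "bracket_op b (ocomp a a) = vsub (ocomp b (ocomp a a)) (ocomp (ocomp a a) b)"
    unfolding bracket_op_eq by (simp add: vadd_def vsc_def ocomp_def z0_def fun_eq_iff)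
  then have "supp (bracket_op b (ocomp a a)) = vpat (m + 3)" using supp_commutator_vpat[OF s] by simp
  moreover have "bracket_op b (ocomp a a) \<in> Qalg" by (rule is_subalgD(3)[OF sub _ ab(2) sq]) simp
  ultimately show "\<exists>c\<in>(Qalg :: 'k endo set). supp c = vpat (m + 3)" by (rule bexI)
qed

lemma Aalg_vpat: "\<exists>e\<in>(Aalg :: 'k::field endo set). supp e = vpat n"
proof (rule vpat_elements_induct)
  show "vop 0 \<in> (Aalg :: 'k endo set)" "vop 1 \<in> (Aalg :: 'k endo set)" "vop 2 \<in> (Aalg :: 'k endo set)"
    unfolding Aalg_def by (rule subsetD[OF generated_incl], simp)+
  fix m and a b :: "'k endo"
  assume ab: "a \<in> Aalg" "b \<in> Aalg" and s: "supp a = vpat m" "supp b = vpat (m + 1)"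
  note sub = is_subalg_generated[of id "[ocomp]" "\<lambda>_. z0" "{vop 0, vop 1, vop 2 :: 'k endo}",
      folded Aalg_def]
  have op: "ocomp x y \<in> Aalg" if "x \<in> Aalg" "y \<in> Aalg" for x y :: "'k endo"
    by (rule is_subalgD(3)[OF sub _ that]) simp
  have "vsub (ocomp b (ocomp a a)) (ocomp (ocomp a a) b) \<in> Aalg"
    by (intro lin_subD(4)[OF is_subalgD(1)[OF sub]] op ab)
  with supp_commutator_vpat[OF s] show "\<exists>c\<in>(Aalg :: 'k endo set). supp c = vpat (m + 3)" by (rule bexI)
qed

lemma vpat_nonempty: "({n}, {}) \<in> vpat n"
  by (subst vpat_rec) simp

lemma endo_continuum:
  fixes L :: "'k::field endo set"
  assumes gr: "wgraded E pe ops sq Gen wE goodE admE" and L: "L = generated pe ops sq Gen"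
    and e: "\<And>n. \<exists>e\<in>L. supp e = vpat n"
  shows "continuum_decomps pe ops sq L"
proof -
  interpret wgraded E pe ops sq Gen wE goodE admE by (rule gr)
  let ?zz = "\<lambda>t. fst (wE t)" and ?rr = "\<lambda>t. snd (wE t)"
  show ?thesis
  proof (rule double_continuum[OF _ _ additive_imp_double(1)[OF op_additive] additive_imp_double(2)[OF sq_additive]
        _ _ _ _ goodE_bound])
    show "is_subalg pe ops sq L" unfolding L by (rule L_sub)
    show "t \<in> supp (pe a) \<Longrightarrow> t \<in> supp a" for a t using pe_simps(3) by blast
    fix a assume a: "a \<in> L"
    then have a': "a \<in> generated pe ops sq Gen" by (simp add: L)
    show "supp a \<subseteq> goodE" by (rule L_supp[OF a'])
    show "finite (?zz ` supp a)" "finite (?rr ` supp a)"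
      using finite_imageI[OF L_finite_weights[OF a'], of fst] finite_imageI[OF L_finite_weights[OF a'], of snd]
      by (simp_all add: image_image)
    fix s assume s: "s \<in> good_slopes"
    show "(\<lambda>t. if t \<in> halfp ?zz {} s then a t else 0) \<in> L" "(\<lambda>t. if t \<in> halfm ?zz s then a t else 0) \<in> L"
      using L_restrict[OF a', of "\<lambda>y. 0 < lin s (fst y)"] L_restrict[OF a', of "\<lambda>y. 0 < - lin s (fst y)"]
      by (simp_all add: L halfp_def halfm_def)
    show "t \<in> {} \<or> lin s (?zz t) \<noteq> 0" if "t \<in> supp a" for t
      using that L_supp[OF a'] goodE_lin_nonzero[OF _ s] by blast
  next
    fix n
    obtain e where e: "e \<in> L" "supp e = vpat n" using e by blast
    have "\<forall>t\<in>supp e. ?zz t = mu ^ n" unfolding e wE_def by (auto simp: vpat_zw)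
    then show "\<exists>e\<in>L. supp e \<noteq> {} \<and> supp e \<subseteq> - {} \<and> (\<forall>t\<in>supp e. ?zz t = mu ^ n)"
      using e vpat_nonempty by blast
  qed auto
qed

lemma Q_continuum: "continuum_decomps pe_op [bracket_op] (\<lambda>a. ocomp a a) (Qalg :: 'k::field endo set)"
  by (rule endo_continuum[OF wgraded_Q Qalg_def Qalg_vpat])

lemma A_continuum: "continuum_decomps id [ocomp] (\<lambda>_. z0) (Aalg :: 'k::field endo set)"
  by (rule endo_continuum[OF wgraded_A Aalg_def Aalg_vpat])


section \<open>The Poisson superalgebra\<close>

lemma hmul_mono_nz:
  "hmul_mono (a1, b1) (a2, b2) (A, B) \<noteq> (0 :: 'k::field)
    \<longleftrightarrow> a1 \<inter> a2 = {} \<and> b1 \<inter> b2 = {} \<and> A = a1 \<union> a2 \<and> B = b1 \<union> b2"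
  by (simp add: hmul_mono_def gsgn_def)

lemma br_mono_nz_cases:
  assumes "br_mono (a1, b1) (a2, b2) (A, B) \<noteq> (0 :: 'k::field)"
  obtains i where "i \<in> b1" "i \<in> a2" "a1 \<inter> (a2 - {i}) = {}" "(b1 - {i}) \<inter> b2 = {}"
      "A = a1 \<union> (a2 - {i})" "B = (b1 - {i}) \<union> b2"
  | i where "i \<in> a1" "i \<in> b2" "(a1 - {i}) \<inter> a2 = {}" "b1 \<inter> (b2 - {i}) = {}"
      "A = (a1 - {i}) \<union> a2" "B = b1 \<union> (b2 - {i})"
proof -
  let ?S1 = "\<Sum>i\<in>b1 \<inter> a2. (-1) ^ card {b\<in>b1. i < b} * (-1) ^ card {a\<in>a2. a < i}
                     * hmul_mono (a1, b1 - {i}) (a2 - {i}, b2) (A, B) :: 'k"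
  let ?S2 = "\<Sum>i\<in>a1 \<inter> b2. (-1) ^ (card {a\<in>a1. i < a} + card b1) * (-1) ^ (card a2 + card {b\<in>b2. b < i})
                     * hmul_mono (a1 - {i}, b1) (a2, b2 - {i}) (A, B) :: 'k"
  have "?S1 + ?S2 \<noteq> 0" using assms by (simp add: br_mono_def)
  then consider "?S1 \<noteq> 0" | "?S2 \<noteq> 0" by force
  then show ?thesis
  proof cases
    case 1
    then obtain i where "i \<in> b1 \<inter> a2" "hmul_mono (a1, b1 - {i}) (a2 - {i}, b2) (A, B) \<noteq> (0 :: 'k)"
      by (metis (no_types, lifting) mult_zero_right sum.neutral)
    then show ?thesis using that(1) unfolding hmul_mono_nz by blast
  next
    case 2
    then obtain i where "i \<in> a1 \<inter> b2" "hmul_mono (a1 - {i}, b1) (a2, b2 - {i}) (A, B) \<noteq> (0 :: 'k)"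
      by (metis (no_types, lifting) mult_zero_right sum.neutral)
    then show ?thesis using that(2) unfolding hmul_mono_nz by blast
  qed
qed

text \<open>The domination of \<open>x\<close>-indices by \<open>y\<close>-indices is the condition
  of the completion; it makes the coefficient sums of the bracket finite. Only the monomial 1 may
  have \<open>rw = 0\<close>.\<close>

definition goodH :: "(nat set \<times> nat set) set" where
  "goodH = {(a, b). finite a \<and> finite b \<and> (\<forall>i\<in>a. \<exists>j\<in>b. i < j) \<and> wcone (a, b)
     \<and> ((a, b) = ({}, {}) \<or> 0 < rw (a, b))}"

definition wH :: "nat set \<times> nat set \<Rightarrow> complex \<times> real" where
  "wH t = (zw t, rw t)"

lemma rw_empty [simp]: "rw ({}, {}) = 0"
  by (simp add: rw_def wsum_def)

lemma goodH_rw_nonneg: "t \<in> goodH \<Longrightarrow> 0 \<le> rw t"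
  by (auto simp: goodH_def)

lemma hmul_mono_wsum:
  assumes "hmul_mono (a1, b1) (a2, b2) (A, B) \<noteq> (0 :: 'k::field)"
    and "finite a1" "finite b1" "finite a2" "finite b2"
  shows "wsum g (A, B) = wsum g (a1, b1) + wsum g (a2, b2)"
  using assms unfolding hmul_mono_nz by (simp add: wsum_def sum.union_disjoint)

text \<open>The contracted index occurs once among the \<open>y\<close> and once among the
  \<open>x\<close>, so its contributions cancel.\<close>

lemma br_mono_wsum:
  assumes nz: "br_mono (a1, b1) (a2, b2) (A, B) \<noteq> (0 :: 'k::field)"
    and fin: "finite a1" "finite b1" "finite a2" "finite b2"
  shows "wsum g (A, B) = wsum g (a1, b1) + wsum g (a2, b2)"
  using nz
proof (cases rule: br_mono_nz_cases)
  case (1 i)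
  have "sum g b1 = g i + sum g (b1 - {i})" "sum g a2 = g i + sum g (a2 - {i})"
    using fin 1 by (auto intro: sum.remove)
  moreover have "sum g A = sum g a1 + sum g (a2 - {i})" "sum g B = sum g (b1 - {i}) + sum g b2"
    unfolding 1(5,6) using fin 1(3,4) by (auto intro!: sum.union_disjoint)
  ultimately show ?thesis by (simp add: wsum_def)
next
  case (2 i)
  have "sum g a1 = g i + sum g (a1 - {i})" "sum g b2 = g i + sum g (b2 - {i})"
    using fin 2 by (auto intro: sum.remove)
  moreover have "sum g A = sum g (a1 - {i}) + sum g a2" "sum g B = sum g b1 + sum g (b2 - {i})"
    unfolding 2(5,6) using fin 2(3,4) by (auto intro!: sum.union_disjoint)
  ultimately show ?thesis by (simp add: wsum_def)
qed

lemma goodH_sum: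
  assumes "s \<in> goodH" "u \<in> goodH" "finite (fst t)" "finite (snd t)"
    and "\<forall>i\<in>fst t. \<exists>j\<in>snd t. i < j"
    and w: "\<And>i. wsum (chi i) t = wsum (chi i) s + wsum (chi i) u" "zw t = zw s + zw u" "rw t = rw s + rw u"
    and c: "s = ({}, {}) \<Longrightarrow> u = ({}, {}) \<Longrightarrow> t = ({}, {})"
  shows "t \<in> goodH \<and> wH t = wH s + wH u"
proof -
  have "wcone t" by (rule wcone_add[of s u]) (use assms w in \<open>auto simp: goodH_def\<close>)
  moreover have "t = ({}, {}) \<or> 0 < rw t"
    using c assms(1,2) w(3) goodH_rw_nonneg[OF assms(1)] goodH_rw_nonneg[OF assms(2)]
    by (auto simp: goodH_def)
  ultimately show ?thesis using assms by (cases t) (simp add: goodH_def wH_def)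
qed

lemma goodH_hmul_mono:
  assumes nz: "hmul_mono s u t \<noteq> (0 :: 'k::field)" and g: "s \<in> goodH" "u \<in> goodH"
  shows "t \<in> goodH \<and> wH t = wH s + wH u"
proof -
  obtain a1 b1 a2 b2 A B where e: "s = (a1, b1)" "u = (a2, b2)" "t = (A, B)" by (cases s, cases u, cases t)
  have fin: "finite a1" "finite b1" "finite a2" "finite b2" using g by (auto simp: e goodH_def)
  have AB: "A = a1 \<union> a2" "B = b1 \<union> b2" using nz unfolding e hmul_mono_nz by auto
  show ?thesis
  proof (rule goodH_sum[OF g])
    show "\<forall>i\<in>fst t. \<exists>j\<in>snd t. i < j" using g by (auto simp: e goodH_def AB)
  qed (use fin AB hmul_mono_wsum[OF nz[unfolded e] fin] in \<open>auto simp: e zw_def rw_def\<close>)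
qed

text \<open>The contracted index occurs as an \<open>x\<close>, hence lies below a
  \<open>y\<close>-index of the same factor, which survives. This preserves domination, and it
  bounds all indices of the factors in terms of \<open>t\<close>.\<close>

lemma goodH_br_mono:
  assumes nz: "br_mono s u t \<noteq> (0 :: 'k::field)" and g: "s \<in> goodH" "u \<in> goodH"
  shows "t \<in> goodH \<and> wH t = wH s + wH u" "s \<noteq> ({}, {})" "u \<noteq> ({}, {})"
    "fst s \<union> snd s \<union> fst u \<union> snd u \<subseteq> fst t \<union> snd t \<union> {i. \<exists>j\<in>snd t. i < j}"
proof -
  obtain a1 b1 a2 b2 A B where e: "s = (a1, b1)" "u = (a2, b2)" "t = (A, B)" by (cases s, cases u, cases t)
  have fin: "finite a1" "finite b1" "finite a2" "finite b2" using g by (auto simp: e goodH_def)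
  have dom: "\<forall>i\<in>a1. \<exists>j\<in>b1. i < j" "\<forall>i\<in>a2. \<exists>j\<in>b2. i < j" using g by (auto simp: e goodH_def)
  have *: "finite A \<and> finite B \<and> (\<forall>i\<in>A. \<exists>j\<in>B. i < j) \<and> s \<noteq> ({}, {}) \<and> u \<noteq> ({}, {})
    \<and> a1 \<union> b1 \<union> a2 \<union> b2 \<subseteq> A \<union> B \<union> {i. \<exists>j\<in>B. i < j}"
    using nz[unfolded e]
  proof (cases rule: br_mono_nz_cases)
    case (1 i)
    obtain j where j: "j \<in> b2" "i < j" using dom 1 by blast
    have "\<exists>l\<in>B. x < l" if "x \<in> A" for x
    proof (cases "x \<in> a1")
      case True
      then obtain l where "l \<in> b1" "x < l" using dom by blast
      then show ?thesis using j unfolding 1(6) by (cases "l = i") (auto intro: less_trans)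
    next
      case False
      then show ?thesis using that dom unfolding 1(5,6) by blast
    qed
    moreover have "a1 \<union> b1 \<union> a2 \<union> b2 \<subseteq> A \<union> B \<union> {i. \<exists>j\<in>B. i < j}" using j unfolding 1(5,6) by blast
    ultimately show ?thesis using 1 fin by (auto simp: e)
  next
    case (2 i)
    obtain j where j: "j \<in> b1" "i < j" using dom 2 by blast
    have "\<exists>l\<in>B. x < l" if "x \<in> A" for x
    proof (cases "x \<in> a2")
      case True
      then obtain l where "l \<in> b2" "x < l" using dom by blast
      then show ?thesis using j unfolding 2(6) by (cases "l = i") (auto intro: less_trans)
    next
      case False
      then show ?thesis using that dom unfolding 2(5,6) by blast
    qed
    moreover have "a1 \<union> b1 \<union> a2 \<union> b2 \<subseteq> A \<union> B \<union> {i. \<exists>j\<in>B. i < j}" using j unfolding 2(5,6) by blast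
    ultimately show ?thesis using 2 fin by (auto simp: e)
  qed
  then show "s \<noteq> ({}, {})" "u \<noteq> ({}, {})"
    "fst s \<union> snd s \<union> fst u \<union> snd u \<subseteq> fst t \<union> snd t \<union> {i. \<exists>j\<in>snd t. i < j}"
    by (simp_all add: e)
  show "t \<in> goodH \<and> wH t = wH s + wH u"
    by (rule goodH_sum[OF g])
      (use * br_mono_wsum[OF nz[unfolded e] fin] in \<open>auto simp: e zw_def rw_def\<close>)
qed

lemma bil_nonzero:
  assumes "bil F f g t \<noteq> 0"
  obtains s u where "f s \<noteq> 0" "g u \<noteq> 0" "F s u t \<noteq> 0"
proof -
  have "\<exists>p\<in>{(m1, m2). f m1 * g m2 * F m1 m2 t \<noteq> 0}. f (fst p) * g (snd p) * F (fst p) (snd p) t \<noteq> 0"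
    using assms unfolding bil_def by (meson sum.neutral)
  then show ?thesis using that by auto
qed

text \<open>The index set in \<open>bil\<close> depends on both arguments. A finite superset common
  to several arguments allows their sums to be added.\<close>

lemma bil_eq_sum:
  assumes "finite P" "\<And>s u. f s \<noteq> 0 \<Longrightarrow> g u \<noteq> 0 \<Longrightarrow> F s u t \<noteq> 0 \<Longrightarrow> (s, u) \<in> P"
  shows "bil F f g t = (\<Sum>p\<in>P. f (fst p) * g (snd p) * F (fst p) (snd p) t)"
  unfolding bil_def by (rule sum.mono_neutral_left) (use assms in auto)

lemma bil_singleton:
  assumes "f s \<noteq> 0" "g u \<noteq> 0" "F s u t \<noteq> 0"
    and "\<And>s' u'. f s' \<noteq> 0 \<Longrightarrow> g u' \<noteq> 0 \<Longrightarrow> F s' u' t \<noteq> 0 \<Longrightarrow> s' = s \<and> u' = u"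
  shows "bil F f g t \<noteq> 0"
proof -
  have "bil F f g t = (\<Sum>p\<in>{(s, u)}. f (fst p) * g (snd p) * F (fst p) (snd p) t)"
    by (rule bil_eq_sum) (simp, simp add: assms(4))
  then show ?thesis using assms(1-3) by simp
qed

lemma hmul_eq_bil: "hmul = bil hmul_mono" and hbr_eq_bil: "hbr = bil br_mono"
  by (simp_all add: hmul_def hbr_def fun_eq_iff)

lemma bil_additive:
  fixes F :: "nat set \<times> nat set \<Rightarrow> nat set \<times> nat set \<Rightarrow> 'k::field hel"
  assumes F: "\<And>s u t. F s u t \<noteq> 0 \<Longrightarrow> s \<in> goodH \<Longrightarrow> u \<in> goodH \<Longrightarrow> t \<in> goodH \<and> wH t = wH s + wH u"
  shows "additive_op goodH wH (bil F)"
  unfolding additive_op_def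
proof (intro allI impI)
  fix a b :: "'k hel" and t assume *: "supp a \<subseteq> goodH" "supp b \<subseteq> goodH" "t \<in> supp (bil F a b)"
  then have "bil F a b t \<noteq> 0" by (simp add: supp_def)
  then obtain s u where su: "a s \<noteq> 0" "b u \<noteq> 0" "F s u t \<noteq> 0" by (rule bil_nonzero)
  have "s \<in> supp a" "u \<in> supp b" using su by (simp_all add: supp_def)
  moreover from this have "s \<in> goodH" "u \<in> goodH" using *(1,2) by auto
  ultimately show "t \<in> goodH \<and> (\<exists>s\<in>supp a. \<exists>u\<in>supp b. wH t = wH s + wH u)"
    using F[OF su(3)] by blast
qed

lemma hmul_additive: "additive_op goodH wH hmul"
  unfolding hmul_eq_bil by (rule bil_additive[OF goodH_hmul_mono])

lemma hbr_additive: "additive_op goodH wH hbr"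
  unfolding hbr_eq_bil by (rule bil_additive[OF goodH_br_mono(1)])

lemma hsq_nonzero:
  fixes f :: "'k::field hel"
  assumes "hsq f t \<noteq> 0"
  obtains s u where "f s \<noteq> 0" "f u \<noteq> 0" "br_mono s u t \<noteq> (0 :: 'k)"
proof -
  have "\<exists>p\<in>{(m1, m2). mcode m1 < mcode m2 \<and> f m1 * f m2 * br_mono m1 m2 t \<noteq> 0}.
      f (fst p) * f (snd p) * br_mono (fst p) (snd p) t \<noteq> 0"
    using assms unfolding hsq_def by (meson sum.neutral)
  then show ?thesis using that by auto
qed

lemma hsq_additive: "additive_sq goodH wH hsq"
  unfolding additive_sq_def
proof (intro allI impI)
  fix a :: "'a hel" and t assume *: "supp a \<subseteq> goodH" "t \<in> supp (hsq a)"
  then have "hsq a t \<noteq> 0" by (simp add: supp_def)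
  then obtain s u where su: "a s \<noteq> 0" "a u \<noteq> 0" "br_mono s u t \<noteq> (0 :: 'a)" by (rule hsq_nonzero)
  have "s \<in> supp a" "u \<in> supp a" using su by (simp_all add: supp_def)
  moreover from this have "s \<in> goodH" "u \<in> goodH" using *(1) by auto
  ultimately show "t \<in> goodH \<and> (\<exists>s\<in>supp a. \<exists>u\<in>supp a. wH t = wH s + wH u)"
    using goodH_br_mono(1)[OF su(3)] by blast
qed

lemma finite_hmul_pairs:
  "finite {(s, u). s \<in> goodH \<and> u \<in> goodH \<and> hmul_mono s u t \<noteq> (0 :: 'k::field)}" (is "finite ?P")
proof (cases "finite (fst t \<union> snd t)")
  case True
  let ?Z = "Pow (fst t \<union> snd t) \<times> Pow (fst t \<union> snd t)"
  have "?P \<subseteq> ?Z \<times> ?Z"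
  proof
    fix p assume p: "p \<in> ?P"
    obtain a1 b1 a2 b2 where e: "p = ((a1, b1), (a2, b2))" by (metis prod.collapse)
    have "hmul_mono (a1, b1) (a2, b2) t \<noteq> (0 :: 'k)" using p by (simp add: e)
    then show "p \<in> ?Z \<times> ?Z" unfolding e by (cases t) (auto simp: hmul_mono_nz)
  qed
  then show ?thesis by (rule finite_subset) (use True in simp)
next
  case False
  have "t \<notin> goodH" using False by (auto simp: goodH_def)
  then have "?P = {}" using goodH_hmul_mono[where t = t and 'k = 'k] by blast
  then show ?thesis by (simp only: finite.emptyI)
qed

lemma finite_br_pairs:
  "finite {(s, u). s \<in> goodH \<and> u \<in> goodH \<and> br_mono s u t \<noteq> (0 :: 'k::field)}" (is "finite ?P")
proof (cases "t \<in> goodH")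
  case True
  define Z where "Z = fst t \<union> snd t \<union> {i. \<exists>j\<in>snd t. i < j}"
  have fin: "finite (fst t)" "finite (snd t)" using True by (auto simp: goodH_def split: prod.splits)
  have "{i. \<exists>j\<in>snd t. i < j} = (\<Union>j\<in>snd t. {..<j})" by auto
  then have Z: "finite Z" using fin by (simp add: Z_def)
  have "?P \<subseteq> (Pow Z \<times> Pow Z) \<times> (Pow Z \<times> Pow Z)"
  proof
    fix p assume p: "p \<in> ?P"
    obtain a1 b1 a2 b2 where e: "p = ((a1, b1), (a2, b2))" by (metis prod.collapse)
    have "br_mono (a1, b1) (a2, b2) t \<noteq> (0 :: 'k)" "(a1, b1) \<in> goodH" "(a2, b2) \<in> goodH"
      using p by (simp_all add: e)
    from goodH_br_mono(4)[OF this] show "p \<in> (Pow Z \<times> Pow Z) \<times> (Pow Z \<times> Pow Z)"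
      unfolding Z_def[symmetric] e by auto
  qed
  then show ?thesis by (rule finite_subset) (use Z in simp)
next
  case False
  have "?P = {}" using False goodH_br_mono(1)[where t = t and 'k = 'k] by blast
  then show ?thesis by (simp only: finite.emptyI)
qed

definition admH :: "'k::field hel \<Rightarrow> bool" where
  "admH a \<longleftrightarrow> supp a \<subseteq> goodH"

lemma admH_vadd: "admH a \<Longrightarrow> admH b \<Longrightarrow> admH (vadd a b)"
  unfolding admH_def using supp_vadd[of a b] by auto

lemma bil_add:
  fixes F :: "nat set \<times> nat set \<Rightarrow> nat set \<times> nat set \<Rightarrow> 'k::field hel"
  assumes fin: "\<And>t. finite {(s, u). s \<in> goodH \<and> u \<in> goodH \<and> F s u t \<noteq> 0}"
    and adm: "admH a" "admH a'" "admH b" "admH b'"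
  shows "bil F (vadd a a') b = vadd (bil F a b) (bil F a' b)" "bil F a (vadd b b') = vadd (bil F a b) (bil F a b')"
proof -
  let ?P = "\<lambda>t. {(s, u). s \<in> goodH \<and> u \<in> goodH \<and> F s u t \<noteq> 0}"
  have sum: "bil F f g t = (\<Sum>p\<in>?P t. f (fst p) * g (snd p) * F (fst p) (snd p) t)"
    if "admH f" "admH g" for f g t
    by (rule bil_eq_sum[OF fin]) (use that in \<open>auto simp: admH_def supp_def\<close>)
  show "bil F (vadd a a') b = vadd (bil F a b) (bil F a' b)"
  proof
    fix t
    show "bil F (vadd a a') b t = vadd (bil F a b) (bil F a' b) t"
      unfolding vadd_def[of "bil F a b"] sum[OF admH_vadd[OF adm(1,2)] adm(3)] sum[OF adm(1,3)]
        sum[OF adm(2,3)] sum.distrib[symmetric]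
      by (rule sum.cong) (simp_all add: vadd_def algebra_simps)
  qed
  show "bil F a (vadd b b') = vadd (bil F a b) (bil F a b')"
  proof
    fix t
    show "bil F a (vadd b b') t = vadd (bil F a b) (bil F a b') t"
      unfolding vadd_def[of "bil F a b"] sum[OF adm(1) admH_vadd[OF adm(3,4)]] sum[OF adm(1,3)]
        sum[OF adm(1,4)] sum.distrib[symmetric]
      by (rule sum.cong) (simp_all add: vadd_def algebra_simps)
  qed
qed

lemmas hmul_add = bil_add[where F = hmul_mono, OF finite_hmul_pairs, folded hmul_eq_bil]
lemmas hbr_add = bil_add[where F = br_mono, OF finite_br_pairs, folded hbr_eq_bil]

section \<open>Polarisation of the formal square\<close>

lemma card_less_greater:
  fixes i :: nat
  assumes "finite S" "i \<in> S"
  shows "card S = Suc (card {x\<in>S. x < i} + card {x\<in>S. i < x})"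
proof -
  have "S = insert i ({x\<in>S. x < i} \<union> {x\<in>S. i < x})" using assms(2) by auto
  then have "card S = card (insert i ({x\<in>S. x < i} \<union> {x\<in>S. i < x}))" by simp
  also have "\<dots> = Suc (card ({x\<in>S. x < i} \<union> {x\<in>S. i < x}))" using assms(1) by (intro card_insert_disjoint) auto
  also have "card ({x\<in>S. x < i} \<union> {x\<in>S. i < x}) = card {x\<in>S. x < i} + card {x\<in>S. i < x}"
    using assms(1) by (intro card_Un_disjoint) auto
  finally show ?thesis .
qed

text \<open>The inversions of \<open>(A, B)\<close> and those of \<open>(B, A)\<close> together make
  up all pairs of \<open>A \<times> B\<close>.\<close>

lemma gsgn_commute:
  assumes "finite A" "finite B" "A \<inter> B = {}"
  shows "gsgn B A = (- 1) ^ (card A * card B) * (gsgn A B :: 'k::field)"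
proof -
  let ?C = "{(a, b). a \<in> A \<and> b \<in> B \<and> b < a}" and ?D = "{(a, b). a \<in> A \<and> b \<in> B \<and> a < b}"
  have C: "finite ?C" by (rule finite_subset[of _ "A \<times> B"]) (use assms in auto)
  have D: "finite ?D" by (rule finite_subset[of _ "A \<times> B"]) (use assms in auto)
  have "card {(b, a). b \<in> B \<and> a \<in> A \<and> a < b} = card (prod.swap ` ?D)"
    by (rule arg_cong[where f = card]) (auto simp: image_iff)
  also have "\<dots> = card ?D" by (rule card_image) simp
  finally have sw: "card {(b, a). b \<in> B \<and> a \<in> A \<and> a < b} = card ?D" .
  have "A \<times> B = ?C \<union> ?D" using assms(3) by (auto simp: disjoint_iff) (metis nat_neq_iff)
  then have "card A * card B = card (?C \<union> ?D)" by (metis card_cartesian_product)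
  also have "\<dots> = card ?C + card ?D" using C D by (intro card_Un_disjoint) auto
  finally show ?thesis unfolding gsgn_def sw by (simp add: minus_one_power_iff)
qed

lemma hmul_mono_commute:
  assumes fin: "finite a1" "finite b1" "finite a2" "finite b2"
    and ev: "even (card a1 + card b1)" "even (card a2 + card b2)"
  shows "hmul_mono (a1, b1) (a2, b2) t = (hmul_mono (a2, b2) (a1, b1) t :: 'k::field)"
proof (cases "a1 \<inter> a2 = {} \<and> b1 \<inter> b2 = {}")
  case True
  obtain A B where t: "t = (A, B)" by (cases t)
  have g: "gsgn a2 a1 = (- 1) ^ (card a1 * card a2) * (gsgn a1 a2 :: 'k)"
    "gsgn b2 b1 = (- 1) ^ (card b1 * card b2) * (gsgn b1 b2 :: 'k)"
    using True fin by (auto intro: gsgn_commute)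
  have "(- 1) ^ (card b1 * card a2)
      = ((- 1) ^ (card b2 * card a1) * (- 1) ^ (card a1 * card a2) * (- 1) ^ (card b1 * card b2) :: 'k)"
    using ev by (auto simp: minus_one_power_iff)
  then show ?thesis using True unfolding t hmul_mono_def prod.case g
    by (auto simp: Un_commute Int_commute mult_ac)
next
  case False
  then show ?thesis by (cases t) (auto simp: hmul_mono_def)
qed

text \<open>Swapping the factors interchanges the two sums in \<open>br_mono\<close>; the odd
  parities make the signs agree termwise.\<close>

lemma br_mono_commute:
  assumes fin: "finite a1" "finite b1" "finite a2" "finite b2"
    and odd: "odd (card a1 + card b1)" "odd (card a2 + card b2)"
  shows "br_mono (a1, b1) (a2, b2) t = (br_mono (a2, b2) (a1, b1) t :: 'k::field)"
proof -
  have half: "(\<Sum>i\<in>b1 \<inter> a2. (-1) ^ card {b\<in>b1. i < b} * (-1) ^ card {a\<in>a2. a < i}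
                     * hmul_mono (a1, b1 - {i}) (a2 - {i}, b2) t)
    = (\<Sum>i\<in>a2 \<inter> b1. (-1) ^ (card {a\<in>a2. i < a} + card b2) * (-1) ^ (card a1 + card {b\<in>b1. b < i})
                     * (hmul_mono (a2 - {i}, b2) (a1, b1 - {i}) t :: 'k))"
    if fin: "finite a1" "finite b1" "finite a2" "finite b2"
      and odd: "odd (card a1 + card b1)" "odd (card a2 + card b2)" for a1 b1 a2 b2 :: "nat set"
  proof (rule sum.cong)
    show "b1 \<inter> a2 = a2 \<inter> b1" by blast
    fix i assume "i \<in> a2 \<inter> b1"
    then have i: "i \<in> b1" "i \<in> a2" by auto
    note c = card_less_greater[OF fin(2) i(1)] card_less_greater[OF fin(3) i(2)]
    have "card (b1 - {i}) = card {x\<in>b1. x < i} + card {x\<in>b1. i < x}"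
      "card (a2 - {i}) = card {x\<in>a2. x < i} + card {x\<in>a2. i < x}"
      using c i by simp_all
    then have "even (card a1 + card (b1 - {i}))" "even (card (a2 - {i}) + card b2)"
      using odd c by auto
    then have h: "hmul_mono (a1, b1 - {i}) (a2 - {i}, b2) t = (hmul_mono (a2 - {i}, b2) (a1, b1 - {i}) t :: 'k)"
      using fin by (intro hmul_mono_commute) auto
    have "even (card {b\<in>b1. i < b} + card {a\<in>a2. a < i})
        \<longleftrightarrow> even ((card {a\<in>a2. i < a} + card b2) + (card a1 + card {b\<in>b1. b < i}))"
      using odd c by auto
    then have "(-1) ^ card {b\<in>b1. i < b} * (-1) ^ card {a\<in>a2. a < i}
        = ((-1) ^ (card {a\<in>a2. i < a} + card b2) * (-1) ^ (card a1 + card {b\<in>b1. b < i}) :: 'k)"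
      unfolding power_add[symmetric] by (simp only: minus_one_power_iff)
    then show "(-1) ^ card {b\<in>b1. i < b} * (-1) ^ card {a\<in>a2. a < i} * hmul_mono (a1, b1 - {i}) (a2 - {i}, b2) t
      = (-1) ^ (card {a\<in>a2. i < a} + card b2) * (-1) ^ (card a1 + card {b\<in>b1. b < i})
        * (hmul_mono (a2 - {i}, b2) (a1, b1 - {i}) t :: 'k)"
      unfolding h by simp
  qed
  show ?thesis
    unfolding br_mono_def prod.case
    using half[OF fin odd] half[OF fin(3,4,1,2) odd(2,1)] by simp
qed

text \<open>Apart from the contracted pair every variable would occur twice, so a nonzero bracket
  leaves only \<open>x_i y_i\<close>, which is even.\<close>

lemma br_mono_self:
  assumes "odd (card (fst m) + card (snd m))"
  shows "br_mono m m t = (0 :: 'k::field)"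
proof (rule ccontr)
  obtain a b A B where e: "m = (a, b)" "t = (A, B)" by (cases m, cases t)
  assume "br_mono m m t \<noteq> (0 :: 'k)"
  then have "br_mono (a, b) (a, b) (A, B) \<noteq> (0 :: 'k)" by (simp add: e)
  then obtain i where "a = {i}" "b = {i}"
    by (cases rule: br_mono_nz_cases) blast+
  then show False using assms by (simp add: e)
qed

text \<open>The code is binary, with \<open>x\<close>-indices at even and \<open>y\<close>-indices
  at odd positions.\<close>

lemma mcode_inj:
  assumes "finite a" "finite b" "finite a'" "finite b'" "mcode (a, b) = mcode (a', b')"
  shows "(a, b) = (a', b')"
proof -
  let ?S = "\<lambda>a b. (\<lambda>x. 2 * x) ` a \<union> (\<lambda>x. 2 * x + 1) ` b :: nat set"
  have code: "mcode (a, b) = set_encode (?S a b)" if "finite a" "finite b" for a b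
  proof -
    have "set_encode (?S a b) = (\<Sum>x\<in>(\<lambda>x. 2 * x) ` a. 2 ^ x) + (\<Sum>x\<in>(\<lambda>x. 2 * x + 1) ` b. 2 ^ x)"
      unfolding set_encode_def using that by (intro sum.union_disjoint) (auto, presburger)
    also have "(\<Sum>x\<in>(\<lambda>x. 2 * x) ` a. 2 ^ x) = (\<Sum>x\<in>a. 2 ^ (2 * x))"
      by (subst sum.reindex) (auto simp: inj_on_def)
    also have "(\<Sum>x\<in>(\<lambda>x. 2 * x + 1) ` b. 2 ^ x) = (\<Sum>x\<in>b. 2 ^ (2 * x + 1))"
      by (subst sum.reindex) (auto simp: inj_on_def)
    finally show ?thesis by (simp add: mcode_def)
  qed
  have "?S a b = ?S a' b'"
    using assms code set_encode_eq[of "?S a b" "?S a' b'"] by simp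
  then have "x \<in> a \<longleftrightarrow> x \<in> a'" "x \<in> b \<longleftrightarrow> x \<in> b'" for x
  proof -
    assume eq: "?S a b = ?S a' b'"
    have "2 * x \<in> ?S a b \<longleftrightarrow> x \<in> a" "2 * x + 1 \<in> ?S a b \<longleftrightarrow> x \<in> b" for a b and x :: nat
      by (auto, presburger+)
    then show "x \<in> a \<longleftrightarrow> x \<in> a'" "x \<in> b \<longleftrightarrow> x \<in> b'" using eq by metis+
  qed
  then show ?thesis by blast
qed


lemma admH_supp: "admH a \<Longrightarrow> supp a \<subseteq> goodH"
  by (simp add: admH_def)

text \<open>The pairs of monomials split along the order by \<open>mcode\<close>. Symmetry of the
  bracket on odd monomials moves the upper pairs to the lower ones with \<open>a\<close> and
  \<open>b\<close> exchanged, and the diagonal vanishes by \<open>br_mono_self\<close>.\<close>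

lemma hsq_add:
  fixes a b :: "'k::field hel"
  assumes adm: "admH a" "admH b" and od: "pe_H a = z0" "pe_H b = z0"
  shows "hsq (vadd a b) = vadd (hsq a) (vadd (hbr a b) (hsq b))"
proof
  fix t
  define F where "F = {(m1, m2). m1 \<in> goodH \<and> m2 \<in> goodH \<and> br_mono m1 m2 t \<noteq> (0 :: 'k)
     \<and> odd (card (fst m1) + card (snd m1)) \<and> odd (card (fst m2) + card (snd m2))}"
  define lower where "lower = {p \<in> F. mcode (fst p) < mcode (snd p)}"
  define upper where "upper = {p \<in> F. mcode (snd p) < mcode (fst p)}"
  let ?br = "\<lambda>p. br_mono (fst p) (snd p) t :: 'k"
  have F: "finite F"
    by (rule finite_subset[OF _ finite_br_pairs[of t, where 'k = 'k]]) (auto simp: F_def)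
  have fin: "finite lower" "finite upper" using F by (simp_all add: lower_def upper_def)
  have odd_supp: "m \<in> goodH \<and> odd (card (fst m) + card (snd m))"
    if "admH c" "pe_H c = z0" "c m \<noteq> 0" for c :: "'k hel" and m
  proof -
    have "pe_H c m = 0" using that(2) by (simp add: z0_def)
    then have "odd (card (fst m) + card (snd m))"
      using that(3) by (cases m) (auto simp: pe_H_def split: if_splits)
    then show ?thesis using that(1,3) by (auto simp: admH_def supp_def)
  qed
  have comm: "br_mono m1 m2 t = (br_mono m2 m1 t :: 'k)"
    if "m1 \<in> goodH" "m2 \<in> goodH" "odd (card (fst m1) + card (snd m1))" "odd (card (fst m2) + card (snd m2))"
    for m1 m2
    using that by (cases m1; cases m2) (auto simp: goodH_def intro!: br_mono_commute)
  have sq: "hsq c t = (\<Sum>p\<in>lower. c (fst p) * c (snd p) * ?br p)" if "admH c" "pe_H c = z0" for c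
    unfolding hsq_def
  proof (rule sum.mono_neutral_left[OF fin(1)])
    show "{(m1, m2). mcode m1 < mcode m2 \<and> c m1 * c m2 * br_mono m1 m2 t \<noteq> 0} \<subseteq> lower"
      using odd_supp[OF that] unfolding lower_def F_def by auto
    show "\<forall>p\<in>lower - {(m1, m2). mcode m1 < mcode m2 \<and> c m1 * c m2 * br_mono m1 m2 t \<noteq> 0}.
        c (fst p) * c (snd p) * ?br p = 0"
      unfolding lower_def by auto
  qed
  have br: "hbr a b t = (\<Sum>p\<in>F. a (fst p) * b (snd p) * ?br p)"
    unfolding hbr_def
    by (rule bil_eq_sum[OF F]) (use odd_supp[OF adm(1) od(1)] odd_supp[OF adm(2) od(2)] in \<open>auto simp: F_def\<close>)
  have "?br p = 0" if "p \<in> F" "p \<notin> lower \<union> upper" for p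
  proof -
    obtain m1 m2 where p: "p = (m1, m2)" by (cases p)
    have "mcode m1 = mcode m2" using that by (auto simp: lower_def upper_def p)
    moreover have "finite (fst m1)" "finite (snd m1)" "finite (fst m2)" "finite (snd m2)"
      using that(1) by (auto simp: F_def p goodH_def)
    ultimately have "m1 = m2" using mcode_inj[of "fst m1" "snd m1" "fst m2" "snd m2"] by simp
    then show ?thesis using that(1) by (auto simp: p F_def br_mono_self)
  qed
  then have "hbr a b t = (\<Sum>p\<in>lower \<union> upper. a (fst p) * b (snd p) * ?br p)"
    unfolding br by (intro sum.mono_neutral_right) (use F in \<open>auto simp: lower_def upper_def\<close>)
  also have "\<dots> = (\<Sum>p\<in>lower. a (fst p) * b (snd p) * ?br p) + (\<Sum>p\<in>upper. a (fst p) * b (snd p) * ?br p)"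
    using fin by (intro sum.union_disjoint) (auto simp: lower_def upper_def)
  also have "(\<Sum>p\<in>upper. a (fst p) * b (snd p) * ?br p) = (\<Sum>p\<in>lower. a (snd p) * b (fst p) * ?br p)"
    by (rule sum.reindex_bij_witness[of _ prod.swap prod.swap])
      (auto simp: lower_def upper_def F_def comm)
  finally have br': "hbr a b t = (\<Sum>p\<in>lower. a (fst p) * b (snd p) * ?br p) + (\<Sum>p\<in>lower. a (snd p) * b (fst p) * ?br p)" .
  have ab: "admH (vadd a b)" "pe_H (vadd a b) = z0"
  proof -
    show "admH (vadd a b)" by (rule admH_vadd[OF adm])
    have "pe_H (vadd a b) = vadd (pe_H a) (pe_H b)" by (auto simp: pe_H_def vadd_def fun_eq_iff)
    then show "pe_H (vadd a b) = z0" using od by simp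
  qed
  show "hsq (vadd a b) t = vadd (hsq a) (vadd (hbr a b) (hsq b)) t"
    unfolding vadd_def[of "hsq a"] vadd_def[of "hbr a b"] sq[OF ab] sq[OF adm(1) od(1)] sq[OF adm(2) od(2)] br'
      sum.distrib[symmetric]
    by (rule sum.cong) (simp_all add: vadd_def algebra_simps)
qed

section \<open>The Poisson algebra is graded and contains analogues of all
  \<open>v_n\<close>\<close>

definition Vpat :: "nat \<Rightarrow> (nat set \<times> nat set) set" where
  "Vpat m = range (\<lambda>k. (Wset m k, {m + 3 * k}))"

lemma supp_Vgen: "supp (Vgen m :: 'k::field hel) = Vpat m"
  by (auto simp: supp_def Vgen_def Vpat_def split: if_splits)

lemma Vpat_weight: "t \<in> Vpat m \<Longrightarrow> wH t = (mu ^ m, lam ^ m)"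
  by (auto simp: Vpat_def wH_def zw_def rw_def wsum_power_Wset[OF mu_cubed] wsum_power_Wset[OF lam(3)])

lemma Vpat_good: "m \<le> 2 \<Longrightarrow> Vpat m \<subseteq> goodH"
proof
  fix t assume m: "m \<le> 2" and t: "t \<in> Vpat m"
  then obtain k where k: "t = (Wset m k, {m + 3 * k})" by (auto simp: Vpat_def)
  have "rw t = lam ^ m" using Vpat_weight[OF t] by (simp add: wH_def)
  then have "0 < rw t" using lam(1) by simp
  then show "t \<in> goodH" using wcone_Wset[OF m, of k] Wset_less unfolding k goodH_def by auto
qed

lemma hone_good: "supp (hone :: 'k::field hel) = {({}, {})}" "({}, {}) \<in> goodH"
proof -
  show "supp (hone :: 'k hel) = {({}, {})}" by (auto simp: supp_def hone_def)
  have "wcone_witness ({}, {}) (\<lambda>_. 0)" by (simp add: wcone_witness_def wsum_def)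
  then show "({}, {}) \<in> goodH" by (auto simp: goodH_def wcone_def)
qed

lemma additive_op_closed: "additive_op goodH wH f \<Longrightarrow> admH a \<Longrightarrow> admH b \<Longrightarrow> admH (f a b)"
  unfolding admH_def additive_op_def by (meson subsetI)

lemma wgraded_P:
  "wgraded (\<lambda>(a, b). even (card a + card b)) pe_H [hmul, hbr] hsq
     {hone, Vgen 0, Vgen 1, Vgen 2 :: 'k::field hel} wH goodH admH"
proof
  fix a a' b b' :: "'k hel"
  show "pe_H a = (\<lambda>t. if (case t of (a, b) \<Rightarrow> even (card a + card b)) then a t else 0)"
    by (auto simp: pe_H_def fun_eq_iff)
  show "admH (z0 :: 'k hel)" by (simp add: admH_def)
  show "admH (vadd a b)" if "admH a" "admH b" by (rule admH_vadd[OF that])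
  show "admH b" if "admH a" "supp b \<subseteq> supp a" using that by (auto simp: admH_def)
  show "supp a \<subseteq> goodH" if "admH a" by (rule admH_supp[OF that])
  show "additive_sq goodH wH (hsq :: 'k hel \<Rightarrow> 'k hel)" by (rule hsq_additive)
  show "admH (hsq a)" if "admH a"
    using that hsq_additive[where 'a = 'k] unfolding admH_def additive_sq_def by (meson subsetI)
  show add: "additive_op goodH wH f" if "f \<in> set [hmul, hbr]" for f :: "'k hel \<Rightarrow> 'k hel \<Rightarrow> 'k hel"
    using that hmul_additive hbr_additive by auto
  show "admH (f a b)" if "f \<in> set [hmul, hbr]" "admH a" "admH b" for f
    by (rule additive_op_closed[OF add[OF that(1)] that(2,3)])
  show "f (vadd a a') b = vadd (f a b) (f a' b)"
    if "f \<in> set [hmul, hbr]" "admH a" "admH a'" "admH b" for f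
    using that(1) hmul_add(1)[OF that(2,3,4,4)] hbr_add(1)[OF that(2,3,4,4)] by auto
  show "f a (vadd b b') = vadd (f a b) (f a b')"
    if "f \<in> set [hmul, hbr]" "admH a" "admH b" "admH b'" for f
    using that(1) hmul_add(2)[OF that(2,2,3,4)] hbr_add(2)[OF that(2,2,3,4)] by auto
  show "\<exists>m. (m = (\<lambda>_ _. z0) \<or> m \<in> set [hmul, hbr]) \<and> hsq (vadd a b) = vadd (hsq a) (vadd (m a b) (hsq b))"
    if "admH a" "admH b" "pe_H a = z0" "pe_H b = z0"
    using hsq_add[OF that] by (intro exI[of _ hbr]) simp
  have V: "admH (Vgen m :: 'k hel) \<and> homw wH (Vgen m :: 'k hel)" if "m \<le> 2" for m
    unfolding admH_def homw_def supp_Vgen using Vpat_good[OF that] by (auto simp: Vpat_weight)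
  have "admH (hone :: 'k hel) \<and> homw wH (hone :: 'k hel)"
    unfolding admH_def homw_def hone_good using hone_good(2) by simp
  then show "admH a \<and> homw wH a" if "a \<in> {hone, Vgen 0, Vgen 1, Vgen 2}"
    using that V[of 0] V[of 1] V[of 2] by (elim insertE emptyE) simp_all
qed

interpretation P: wgraded "\<lambda>(a, b). even (card a + card b)" pe_H "[hmul, hbr]" hsq
  "{hone, Vgen 0, Vgen 1, Vgen 2}" wH goodH admH
  by (rule wgraded_P)

lemma Palg_sub: "is_subalg pe_H [hmul, hbr] hsq Palg"
  unfolding Palg_def by (rule is_subalg_generated)

lemmas Palg_lin = lin_subD[OF is_subalgD(1)[OF Palg_sub]]

lemma Palg_supp: "a \<in> Palg \<Longrightarrow> supp a \<subseteq> goodH"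
  unfolding Palg_def by (rule P.L_supp)

lemma Palg_finite: "a \<in> Palg \<Longrightarrow> finite (wH ` supp a)"
  unfolding Palg_def by (rule P.L_finite_weights)

lemma Palg_restrict: "a \<in> Palg \<Longrightarrow> (\<lambda>t. if Q (wH t) then a t else 0) \<in> Palg"
  unfolding Palg_def by (rule P.L_restrict)

lemma Palg_op: "f \<in> set [hmul, hbr] \<Longrightarrow> a \<in> Palg \<Longrightarrow> b \<in> Palg \<Longrightarrow> f a b \<in> Palg"
  by (rule is_subalgD(3)[OF Palg_sub])

lemma Po_supp:
  assumes "a \<in> Po" "t \<in> supp a"
  shows "t \<in> goodH" "0 < rw t"
proof -
  have a: "a \<in> Palg" "a ({}, {}) = 0" using assms(1) by (simp_all add: Po_def)
  then show g: "t \<in> goodH" using Palg_supp assms(2) by blast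
  have "t \<noteq> ({}, {})" using a(2) assms(2) by (auto simp: supp_def)
  then show "0 < rw t" using g by (auto simp: goodH_def)
qed

text \<open>The constant monomial has \<open>rw = 0\<close>, whereas the values of \<open>rw\<close>
  on \<open>Po\<close> are positive and add up.\<close>

lemma const_notin_supp_op:
  assumes "additive_op goodH wH f" "a \<in> Po" "b \<in> Po"
  shows "f a b ({}, {}) = 0"
proof (rule ccontr)
  assume "f a b ({}, {}) \<noteq> 0"
  then have "({}, {}) \<in> supp (f a b)" by (simp add: supp_def)
  then obtain s u where "s \<in> supp a" "u \<in> supp b" "wH ({}, {}) = wH s + wH u"
    using additive_opD[OF assms(1)] Po_supp(1) assms(2,3) by (metis subsetI)
  moreover from this have "rw s + rw u = 0" by (simp add: wH_def)
  ultimately show False using Po_supp(2)[OF assms(2), of s] Po_supp(2)[OF assms(3), of u] by linarith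
qed

lemma Po_op: "f \<in> set [hmul, hbr] \<Longrightarrow> a \<in> Po \<Longrightarrow> b \<in> Po \<Longrightarrow> f a b \<in> Po"
  using const_notin_supp_op[of f a b] P.op_additive[of f] Palg_op[of f a b] by (simp add: Po_def)

lemma Po_sub: "is_subalg pe_H [hmul, hbr] hsq Po"
  unfolding is_subalg_def lin_sub_def
proof (intro conjI ballI allI impI)
  show "z0 \<in> Po" using Palg_lin(1) by (simp add: Po_def z0_def)
  show "vadd a b \<in> Po" if "a \<in> Po" "b \<in> Po" for a b :: "'a hel"
    using that Palg_lin(2)[of a b] by (simp add: Po_def vadd_def)
  show "vsc c a \<in> Po" if "a \<in> Po" for c and a :: "'a hel"
    using that Palg_lin(3)[of a c] by (simp add: Po_def vsc_def)
  show "pe_H a \<in> Po" if "a \<in> Po" for a :: "'a hel"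
    using that is_subalgD(2)[OF Palg_sub, of a] by (simp add: Po_def pe_H_def)
  show "f a b \<in> Po" if "f \<in> set [hmul, hbr]" "a \<in> Po" "b \<in> Po" for f and a b :: "'a hel"
    using that by (rule Po_op)
  show "hsq a \<in> Po" if "a \<in> Po" "pe_H a = z0" for a :: "'a hel"
  proof -
    have "hsq a ({}, {}) = 0"
    proof (rule ccontr)
      assume "hsq a ({}, {}) \<noteq> 0"
      then have "({}, {}) \<in> supp (hsq a)" by (simp add: supp_def)
      moreover have "supp a \<subseteq> goodH" using Po_supp(1)[OF that(1)] by blast
      ultimately obtain s u where "s \<in> supp a" "u \<in> supp a" "wH ({}, {}) = wH s + wH u"
        using additive_sqD[OF hsq_additive, of a "({}, {})"] by blast
      moreover from this have "rw s + rw u = 0" by (simp add: wH_def)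
      ultimately show False using Po_supp(2)[OF that(1), of s] Po_supp(2)[OF that(1), of u] by linarith
    qed
    then show ?thesis using that is_subalgD(4)[OF Palg_sub, of a] by (simp add: Po_def)
  qed
qed

lemma Po_restrict: "a \<in> Po \<Longrightarrow> (\<lambda>t. if Q (wH t) then a t else 0) \<in> Po"
  using Palg_restrict[of a Q] by (simp add: Po_def)

lemma goodH_bound: "t \<in> goodH \<Longrightarrow> (cmod (fst (wH t)))\<^sup>2 \<le> 130 * snd (wH t)"
  by (auto simp: goodH_def wH_def intro!: wcone_square_bound)

lemma goodH_lin_nonzero: "t \<in> goodH \<Longrightarrow> 0 < rw t \<Longrightarrow> s \<in> good_slopes \<Longrightarrow> lin s (fst (wH t)) \<noteq> 0"
  using wcone_lin_nonzero[of t s] by (auto simp: goodH_def wH_def)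

lemma Wset_mono: "k \<le> l \<Longrightarrow> Wset m k \<subseteq> Wset m l"
  unfolding Wset_def by (intro Un_mono Collect_mono) (auto intro: less_le_trans)

lemma Wset_nonempty: "k \<noteq> 0 \<Longrightarrow> m \<in> Wset m k"
  by (auto simp: mem_Wset)

text \<open>If neither term is the initial one \<open>y_m\<close>, then both contain
  \<open>x_m\<close>, which is not contracted, and the product vanishes.\<close>

lemma br_mono_Vpat:
  "br_mono (Wset m k, {m + 3 * k}) (Wset m l, {m + 3 * l}) t \<noteq> (0 :: 'k::field)
    \<longleftrightarrow> (k = 0 \<and> l \<noteq> 0 \<and> t = (Wset m l - {m}, {m + 3 * l}))
      \<or> (l = 0 \<and> k \<noteq> 0 \<and> t = (Wset m k - {m}, {m + 3 * k}))"
proof -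
  obtain A B where t: "t = (A, B)" by (cases t)
  have mem: "m + 3 * i \<in> Wset m j \<longleftrightarrow> i < j" for i j
    using mem_Wset_add[of 0 m i j] by simp
  have disj: "Wset m i \<inter> (Wset m j - {m + 3 * i}) = {} \<longleftrightarrow> i = 0" if "i < j" for i j
    using Wset_mono[of i j m] that Wset_nonempty[of i m] Wset_notin(1)[of m i] by (cases "i = 0") auto
  have main: "br_mono (Wset m k, {m + 3 * k}) (Wset m l, {m + 3 * l}) t \<noteq> (0 :: 'k)
      \<longleftrightarrow> k = 0 \<and> t = (Wset m l - {m}, {m + 3 * l})" if "k < l" for k l
  proof -
    have "{m + 3 * k} \<inter> Wset m l = {m + 3 * k}" "Wset m k \<inter> {m + 3 * l} = {}" using that mem by auto
    then have "br_mono (Wset m k, {m + 3 * k}) (Wset m l, {m + 3 * l}) t \<noteq> (0 :: 'k)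
        \<longleftrightarrow> hmul_mono (Wset m k, {}) (Wset m l - {m + 3 * k}, {m + 3 * l}) t \<noteq> (0 :: 'k)"
      by (simp add: br_mono_def)
    also have "\<dots> \<longleftrightarrow> k = 0 \<and> t = (Wset m l - {m}, {m + 3 * l})"
      unfolding t hmul_mono_nz using disj[OF that] by auto
    finally show ?thesis .
  qed
  consider "k < l" | "l < k" | "k = l" by linarith
  then show ?thesis
  proof cases
    case 1
    then show ?thesis using main[OF 1] by auto
  next
    case 2
    have "br_mono (Wset m k, {m + 3 * k}) (Wset m l, {m + 3 * l}) t
        = (br_mono (Wset m l, {m + 3 * l}) (Wset m k, {m + 3 * k}) t :: 'k)"
      by (rule br_mono_commute) (simp_all add: card_Wset)
    then show ?thesis using main[OF 2] 2 by auto
  next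
    case 3
    then show ?thesis
      using br_mono_self[of "(Wset m k, {m + 3 * k})" t, where 'k = 'k] by (auto simp: card_Wset)
  qed
qed

text \<open>The right-hand side is the support of \<open>x_(m+1) V_(m+3)\<close>. Each of its
  monomials comes from exactly one unordered pair of terms, the initial one and the one with index
  \<open>Suc l\<close>, so nothing cancels.\<close>

lemma hsq_Vpat:
  fixes a :: "'k::field hel"
  assumes "supp a = Vpat m"
  shows "supp (hsq a) = range (\<lambda>l. (Wset m (Suc l) - {m}, {m + 3 * Suc l}))"
proof -
  let ?V = "\<lambda>k. (Wset m k, {m + 3 * k})"
  have a: "a t \<noteq> 0 \<longleftrightarrow> (\<exists>k. t = ?V k)" for t using assms by (auto simp: supp_def Vpat_def)
  show ?thesis
  proof (intro set_eqI iffI)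
    fix t assume "t \<in> supp (hsq a)"
    then have "hsq a t \<noteq> 0" by (simp add: supp_def)
    then obtain s u where su: "a s \<noteq> 0" "a u \<noteq> 0" "br_mono s u t \<noteq> (0 :: 'k)" by (rule hsq_nonzero)
    then obtain k l where e: "s = ?V k" "u = ?V l" using a by blast
    from su(3) obtain i where i: "i \<noteq> 0" "t = (Wset m i - {m}, {m + 3 * i})" unfolding e br_mono_Vpat by blast
    then obtain j where "i = Suc j" by (cases i) auto
    with i(2) show "t \<in> range (\<lambda>l. (Wset m (Suc l) - {m}, {m + 3 * Suc l}))" by blast
  next
    fix t assume "t \<in> range (\<lambda>l. (Wset m (Suc l) - {m}, {m + 3 * Suc l}))"
    then obtain l' where "t = (Wset m (Suc l') - {m}, {m + 3 * Suc l'})" by blast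
    then obtain l where l: "l \<noteq> 0" "t = (Wset m l - {m}, {m + 3 * l})" by blast
    have ne: "mcode (?V 0) \<noteq> mcode (?V l)"
      using mcode_inj[of "Wset m 0" "{m + 3 * 0}" "Wset m l" "{m + 3 * l}"] l(1) by auto
    define p where "p = (if mcode (?V 0) < mcode (?V l) then (?V 0, ?V l) else (?V l, ?V 0))"
    let ?M = "{(m1, m2). mcode m1 < mcode m2 \<and> a m1 * a m2 * br_mono m1 m2 t \<noteq> 0}"
    have "?M = {p}"
    proof (intro set_eqI iffI)
      fix x assume x: "x \<in> ?M"
      then obtain i j where ij: "x = (?V i, ?V j)" "mcode (?V i) < mcode (?V j)"
        "br_mono (?V i) (?V j) t \<noteq> (0 :: 'k)" using a by auto
      then have "(i = 0 \<and> j = l) \<or> (j = 0 \<and> i = l)" unfolding br_mono_Vpat l(2) by auto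
      then show "x \<in> {p}" using ij by (auto simp: p_def)
    next
      fix x assume "x \<in> {p}"
      moreover have "a (?V 0) \<noteq> 0" "a (?V l) \<noteq> 0" using a by blast+
      moreover have "br_mono (?V 0) (?V l) t \<noteq> (0 :: 'k)" "br_mono (?V l) (?V 0) t \<noteq> (0 :: 'k)"
        unfolding br_mono_Vpat using l by auto
      ultimately show "x \<in> ?M"
        using ne unfolding p_def by (cases "mcode (?V 0) < mcode (?V l)") simp_all
    qed
    then have "p \<in> ?M"
      "hsq a t = a (fst p) * a (snd p) * br_mono (fst p) (snd p) t"
      unfolding hsq_def by simp_all
    then show "t \<in> supp (hsq a)" by (auto simp: supp_def)
  qed
qed

text \<open>Only the initial term \<open>y_(m+1)\<close> of \<open>V_(m+1)\<close> contributes. The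
  others contain \<open>x_(m+1)\<close>, as does the second factor, or find no index to
  contract.\<close>

lemma br_mono_Vpat_shift:
  "br_mono (Wset (m + 1) k, {m + 1 + 3 * k}) (Wset m (Suc l) - {m}, {m + 3 * Suc l}) t \<noteq> (0 :: 'k::field)
    \<longleftrightarrow> k = 0 \<and> t = (Wset (m + 3) l, {m + 3 + 3 * l})"
proof -
  obtain A B where t: "t = (A, B)" by (cases t)
  have mem: "m + 1 + 3 * k \<in> Wset m (Suc l) \<longleftrightarrow> k < Suc l"
    using mem_Wset_add[of 1 m k "Suc l"] by (simp add: add.commute add.left_commute)
  have "m + 3 * Suc l \<noteq> m + 1 + 3 * n" "m + 3 * Suc l \<noteq> m + 1 + 3 * n + 1" for n by presburger+
  then have no: "Wset (m + 1) k \<inter> {m + 3 * Suc l} = {}" by (auto simp: mem_Wset)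
  have shift: "Wset m (Suc l) - {m} - {m + 1} = Wset (m + 3) l"
    using Wset_notin(2,3)[of m l] by (auto simp: Wset_Suc)
  show ?thesis
  proof (cases "k < Suc l")
    case True
    have "{m + 1 + 3 * k} \<inter> (Wset m (Suc l) - {m}) = {m + 1 + 3 * k}" using True mem by auto
    then have "br_mono (Wset (m + 1) k, {m + 1 + 3 * k}) (Wset m (Suc l) - {m}, {m + 3 * Suc l}) t \<noteq> (0 :: 'k)
        \<longleftrightarrow> hmul_mono (Wset (m + 1) k, {}) (Wset m (Suc l) - {m} - {m + 1 + 3 * k}, {m + 3 * Suc l}) t \<noteq> (0 :: 'k)"
      unfolding br_mono_def prod.case no by simp
    also have "\<dots> \<longleftrightarrow> k = 0 \<and> t = (Wset (m + 3) l, {m + 3 + 3 * l})"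
    proof (cases "k = 0")
      case k: True
      have e: "m + 3 * Suc l = m + 3 + 3 * l" "m + 1 + 3 * 0 = m + 1" by simp_all
      show ?thesis unfolding t hmul_mono_nz k e shift Wset_0 by blast
    next
      case False
      have "m + 1 \<in> Wset (m + 1) k" "m + 1 \<in> Wset m (Suc l) - {m} - {m + 1 + 3 * k}"
        using Wset_nonempty[OF False] False by (auto simp: Wset_Suc)
      then show ?thesis unfolding t hmul_mono_nz using False by blast
    qed
    finally show ?thesis .
  next
    case False
    then have "{m + 1 + 3 * k} \<inter> (Wset m (Suc l) - {m}) = {}" using mem by auto
    then have "br_mono (Wset (m + 1) k, {m + 1 + 3 * k}) (Wset m (Suc l) - {m}, {m + 3 * Suc l}) t = (0 :: 'k)"
      unfolding br_mono_def prod.case no by simp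
    then show ?thesis using False by auto
  qed
qed

lemma hbr_Vpat:
  fixes b c :: "'k::field hel"
  assumes "supp b = Vpat (m + 1)" "supp c = range (\<lambda>l. (Wset m (Suc l) - {m}, {m + 3 * Suc l}))"
  shows "supp (hbr b c) = Vpat (m + 3)"
proof -
  let ?V = "\<lambda>k. (Wset (m + 1) k, {m + 1 + 3 * k})" and ?U = "\<lambda>l. (Wset m (Suc l) - {m}, {m + 3 * Suc l})"
  have b: "b t \<noteq> 0 \<longleftrightarrow> (\<exists>k. t = ?V k)" and c: "c t \<noteq> 0 \<longleftrightarrow> (\<exists>l. t = ?U l)" for t
    using assms by (auto simp: supp_def Vpat_def)
  show ?thesis
  proof (intro set_eqI iffI)
    fix t assume "t \<in> supp (hbr b c)"
    then have "bil br_mono b c t \<noteq> 0" by (simp add: supp_def hbr_def)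
    then obtain s u where su: "b s \<noteq> 0" "c u \<noteq> 0" "br_mono s u t \<noteq> (0 :: 'k)" by (rule bil_nonzero)
    then obtain k l where e: "s = ?V k" "u = ?U l" using b c by blast
    from su(3) have "t = (Wset (m + 3) l, {m + 3 + 3 * l})" unfolding e br_mono_Vpat_shift by blast
    then show "t \<in> Vpat (m + 3)" unfolding Vpat_def by blast
  next
    fix t assume "t \<in> Vpat (m + 3)"
    then obtain l where l: "t = (Wset (m + 3) l, {m + 3 + 3 * l})" by (auto simp: Vpat_def)
    have "bil br_mono b c t \<noteq> 0"
    proof (rule bil_singleton)
      show "b (?V 0) \<noteq> 0" using b by blast
      show "c (?U l) \<noteq> 0" using c by blast
      show "br_mono (?V 0) (?U l) t \<noteq> (0 :: 'k)" unfolding br_mono_Vpat_shift l by simp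
      fix s u assume su: "b s \<noteq> 0" "c u \<noteq> 0" "br_mono s u t \<noteq> (0 :: 'k)"
      then obtain k l' where e: "s = ?V k" "u = ?U l'" using b c by blast
      from su(3) have "k = 0" "l = l'" unfolding e br_mono_Vpat_shift l by auto
      then show "s = ?V 0 \<and> u = ?U l" using e by simp
    qed
    then show "t \<in> supp (hbr b c)" by (simp add: supp_def hbr_def)
  qed
qed

lemma Po_Vpat: "\<exists>e\<in>(Po :: 'k::field hel set). supp e = Vpat n"
proof -
  have "\<exists>e\<in>(Palg :: 'k hel set). supp e = Vpat n" for n
  proof (induction n rule: less_induct)
    case (less n)
    have gens: "Vgen 0 \<in> (Palg :: 'k hel set)" "Vgen 1 \<in> (Palg :: 'k hel set)" "Vgen 2 \<in> (Palg :: 'k hel set)"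
      unfolding Palg_def by (rule subsetD[OF generated_incl], simp)+
    show ?case
    proof (cases "n < 3")
      case True
      then have "n = 0 \<or> n = 1 \<or> n = 2" by linarith
      then have "Vgen n \<in> (Palg :: 'k hel set)" using gens by auto
      then show ?thesis by (intro bexI[of _ "Vgen n"] supp_Vgen)
    next
      case False
      define m where "m = n - 3"
      have n: "n = m + 3" using False by (simp add: m_def)
      obtain a b :: "'k hel" where ab: "a \<in> Palg" "supp a = Vpat m" "b \<in> Palg" "supp b = Vpat (m + 1)"
        using less[of m] less[of "m + 1"] n by auto
      have "pe_H a = z0"
      proof
        fix t :: "nat set \<times> nat set"
        show "pe_H a t = z0 t"
        proof (cases "a t = 0")
          case True
          then show ?thesis by (cases t) (simp add: pe_H_def z0_def)
        next
          case False
          then have "t \<in> Vpat m" using ab(2) by (auto simp: supp_def)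
          then show ?thesis by (auto simp: Vpat_def pe_H_def z0_def card_Wset)
        qed
      qed
      then have "hsq a \<in> Palg" by (rule is_subalgD(4)[OF Palg_sub ab(1)])
      then have "hbr b (hsq a) \<in> Palg" using Palg_op[of hbr b "hsq a"] ab(3) by simp
      moreover have "supp (hbr b (hsq a)) = Vpat n"
        unfolding n by (rule hbr_Vpat[OF ab(4) hsq_Vpat[OF ab(2)]])
      ultimately show ?thesis by (intro bexI[of _ "hbr b (hsq a)"])
    qed
  qed
  then obtain e :: "'k hel" where e: "e \<in> Palg" "supp e = Vpat n" by blast
  have "({}, {}) \<notin> supp e" unfolding e(2) by (auto simp: Vpat_def)
  then have "e \<in> Po" using e(1) by (simp add: Po_def supp_def)
  then show ?thesis by (intro bexI[of _ e] e(2))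
qed

lemma P_continuum: "continuum_decomps pe_H [hmul, hbr] hsq (Po :: 'k::field hel set)"
proof -
  let ?zz = "\<lambda>t. fst (wH t)" and ?rr = "\<lambda>t. snd (wH t)"
  show ?thesis
  proof (rule double_continuum[OF Po_sub _ additive_imp_double(1)[OF P.op_additive]
        additive_imp_double(2)[OF hsq_additive] _ _ _ _ goodH_bound])
    show "t \<in> supp (pe_H a) \<Longrightarrow> t \<in> supp a" for a :: "'k hel" and t
      by (cases t) (auto simp: supp_def pe_H_def split: if_splits)
    fix a :: "'k hel" assume a: "a \<in> Po"
    then have fin: "finite (wH ` supp a)" using Palg_finite[of a] by (simp add: Po_def)
    show "supp a \<subseteq> goodH" using Po_supp(1)[OF a] by blast
    show "finite (?zz ` supp a)" "finite (?rr ` supp a)"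
      using finite_imageI[OF fin, of fst] finite_imageI[OF fin, of snd] by (simp_all add: image_image)
    fix s assume s: "s \<in> good_slopes"
    show "(\<lambda>t. if t \<in> halfp ?zz {} s then a t else 0) \<in> Po" "(\<lambda>t. if t \<in> halfm ?zz s then a t else 0) \<in> Po"
      using Po_restrict[OF a, of "\<lambda>y. 0 < lin s (fst y)"] Po_restrict[OF a, of "\<lambda>y. 0 < - lin s (fst y)"]
      by (simp_all add: halfp_def halfm_def)
    show "t \<in> {} \<or> lin s (?zz t) \<noteq> 0" if "t \<in> supp a" for t
      using goodH_lin_nonzero[OF Po_supp[OF a that] s] by simp
  next
    fix n
    obtain e :: "'k hel" where e: "e \<in> Po" "supp e = Vpat n" using Po_Vpat by blast
    have "\<forall>t\<in>supp e. ?zz t = mu ^ n" unfolding e using Vpat_weight by simp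
    moreover have "supp e \<noteq> {}" unfolding e by (simp add: Vpat_def)
    ultimately show "\<exists>e\<in>(Po :: 'k hel set). supp e \<noteq> {} \<and> supp e \<subseteq> - {} \<and> (\<forall>t\<in>supp e. ?zz t = mu ^ n)"
      using e(1) by blast
  qed auto
qed


section \<open>The Jordan superalgebras\<close>

lemma supp_twist_H: "supp (twist_H x) \<subseteq> supp x"
proof
  fix t assume "t \<in> supp (twist_H x)"
  then show "t \<in> supp x" by (cases t) (auto simp: supp_def twist_H_def vsub_def vsc_def pe_H_def split: if_splits)
qed

lemma mem_supp_jpart: "m \<in> supp (jpart z c) \<longleftrightarrow> (c, m) \<in> supp z"
  by (simp add: supp_def jpart_def)

definition goodJ :: "(bool \<times> nat set \<times> nat set) set" where
  "goodJ = {t. snd t \<in> goodH}"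

text \<open>A nonzero bracket has no constant factor, by \<open>goodH_br_mono\<close>. This is what
  excludes 1-bar from products of two barred factors.\<close>

lemma jmul_double: "double_op goodJ fst (\<lambda>t. zw (snd t)) (\<lambda>t. rw (snd t)) {(True, {}, {})} jmul"
  unfolding double_op_def
proof (intro allI impI)
  fix z w :: "'k::field jel" and t assume zw: "supp z \<subseteq> goodJ" "supp w \<subseteq> goodJ" and t: "t \<in> supp (jmul z w)"
  obtain c m where cm: "t = (c, m)" by (cases t)
  let ?res = "\<lambda>s u. t \<in> goodJ \<and> s \<in> supp z \<and> u \<in> supp w
      \<and> zw (snd t) = zw (snd s) + zw (snd u) \<and> rw (snd t) = rw (snd s) + rw (snd u)"
  have good: "p \<in> goodH" if "(c', p) \<in> supp z \<or> (c', p) \<in> supp w" for c' p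
    using that zw by (auto simp: goodJ_def)
  have mul: "\<exists>p q. ?res (c1, p) (c2, q)"
    if "m \<in> supp (hmul (jpart z c1) y)" "supp y \<subseteq> supp (jpart w c2)" for c1 c2 y
  proof -
    have "bil hmul_mono (jpart z c1) y m \<noteq> 0" using that(1) by (simp add: supp_def hmul_def)
    then obtain p q where pq: "jpart z c1 p \<noteq> 0" "y q \<noteq> 0" "hmul_mono p q m \<noteq> (0 :: 'k)" by (rule bil_nonzero)
    then have in_supp: "(c1, p) \<in> supp z" "(c2, q) \<in> supp w"
      using that(2) mem_supp_jpart[of q w c2] by (auto simp: supp_def jpart_def)
    have "p \<in> goodH" "q \<in> goodH" using good in_supp by blast+
    from goodH_hmul_mono[OF pq(3) this] have "?res (c1, p) (c2, q)"
      using in_supp by (simp add: cm goodJ_def wH_def)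
    then show ?thesis by blast
  qed
  let ?pat = "\<lambda>s u. \<not> fst t \<and> \<not> fst s \<and> \<not> fst u
      \<or> \<not> fst t \<and> fst s \<and> fst u \<and> s \<notin> {(True, {}, {})} \<and> u \<notin> {(True, {}, {})} \<or> fst t \<and> fst s \<noteq> fst u"
  have "\<exists>s u. ?res s u \<and> ?pat s u"
  proof (cases c)
    case False
    then have "m \<in> supp (hmul (jpart z False) (jpart w False)) \<or> m \<in> supp (hbr (jpart z True) (twist_H (jpart w True)))"
      using t by (auto simp: cm supp_def jmul_def mkJ_def vadd_def)
    then show ?thesis
    proof
      assume "m \<in> supp (hmul (jpart z False) (jpart w False))"
      then obtain p q where "?res (False, p) (False, q)" using mul[of False "jpart w False" False] by blast
      moreover have "?pat (False, p) (False, q)" using False by (simp add: cm)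
      ultimately show ?thesis by blast
    next
      assume "m \<in> supp (hbr (jpart z True) (twist_H (jpart w True)))"
      then have "bil br_mono (jpart z True) (twist_H (jpart w True)) m \<noteq> 0" by (simp add: supp_def hbr_def)
      then obtain p q where pq: "jpart z True p \<noteq> 0" "twist_H (jpart w True) q \<noteq> 0" "br_mono p q m \<noteq> (0 :: 'k)"
        by (rule bil_nonzero)
      then have "q \<in> supp (jpart w True)" using supp_twist_H[of "jpart w True"] by (auto simp: supp_def)
      then have in_supp: "(True, p) \<in> supp z" "(True, q) \<in> supp w"
        using pq(1) mem_supp_jpart by (auto simp: supp_def jpart_def)
      have g: "p \<in> goodH" "q \<in> goodH" using good in_supp by blast+
      note * = goodH_br_mono[OF pq(3) g]
      have "?res (True, p) (True, q)" using *(1) in_supp by (simp add: cm goodJ_def wH_def)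
      moreover have "?pat (True, p) (True, q)" using False *(2,3) by (simp add: cm)
      ultimately show ?thesis by blast
    qed
  next
    case True
    then have "m \<in> supp (hmul (jpart z False) (jpart w True)) \<or> m \<in> supp (hmul (jpart z True) (twist_H (jpart w False)))"
      using t by (auto simp: cm supp_def jmul_def mkJ_def vadd_def)
    then have "(\<exists>p q. ?res (False, p) (True, q)) \<or> (\<exists>p q. ?res (True, p) (False, q))"
      using mul[of False "jpart w True" True] mul[of True "twist_H (jpart w False)" False]
        supp_twist_H[of "jpart w False"] by blast
    moreover have "?pat (False, p) (True, q)" "?pat (True, p) (False, q)" for p q using True by (simp_all add: cm)
    ultimately show ?thesis by blast
  qed
  then show "t \<in> goodJ \<and> (\<exists>s\<in>supp z. \<exists>u\<in>supp w.
      dbl fst (\<lambda>t. zw (snd t)) (\<lambda>t. rw (snd t)) {(True, {}, {})} t s u)"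
    unfolding dbl_def by blast
qed

text \<open>Cutting inside \<open>Palg\<close> is possible only by conditions on the weight; this
  expresses the index of 1-bar as such a condition.\<close>

lemma goodH_zero_weight: "m \<in> goodH \<Longrightarrow> wH m = 0 \<longleftrightarrow> m = ({}, {})"
  by (auto simp: goodH_def wH_def zw_def wsum_def zero_prod_def)

lemma Jo_supp:
  assumes "z \<in> Jo" "(c, m) \<in> supp z"
  shows "m \<in> goodH" "(c, m) = (True, {}, {}) \<or> 0 < rw m"
proof -
  have *: "jpart z False \<in> Po" "jpart z True \<in> Palg" using assms(1) by (simp_all add: Jo_def)
  have m: "m \<in> supp (jpart z c)" using assms(2) by (simp add: mem_supp_jpart)
  show g: "m \<in> goodH" using m Po_supp(1)[OF *(1), of m] Palg_supp[OF *(2)] by (cases c) auto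
  show "(c, m) = (True, {}, {}) \<or> 0 < rw m"
  proof (cases c)
    case True
    then show ?thesis using g by (auto simp: goodH_def)
  next
    case False
    then show ?thesis using Po_supp(2)[OF *(1)] m by simp
  qed
qed

lemma twist_H_Palg: "a \<in> Palg \<Longrightarrow> twist_H a \<in> Palg"
  unfolding twist_H_def by (intro Palg_lin is_subalgD(2)[OF Palg_sub])

text \<open>The barred part of an element of \<open>Jo\<close> may have a constant term. The bracket
  ignores constants, and all other weights are positive.\<close>

lemma hbr_Palg_Po:
  assumes "a \<in> Palg" "b \<in> Palg"
  shows "hbr a b \<in> Po"
proof -
  have "hbr a b ({}, {}) = 0"
  proof (rule ccontr)
    assume "hbr a b ({}, {}) \<noteq> 0"
    then have "bil br_mono a b ({}, {}) \<noteq> 0" by (simp add: hbr_def)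
    then obtain s u where su: "a s \<noteq> 0" "b u \<noteq> 0" "br_mono s u ({}, {}) \<noteq> (0 :: 'a)" by (rule bil_nonzero)
    have g: "s \<in> goodH" "u \<in> goodH"
      using su(1,2) Palg_supp[OF assms(1)] Palg_supp[OF assms(2)] by (auto simp: supp_def)
    note * = goodH_br_mono[OF su(3) g]
    have "0 < rw s" "0 < rw u" using g *(2,3) by (auto simp: goodH_def)
    moreover have "rw s + rw u = 0" using *(1) by (simp add: wH_def)
    ultimately show False by simp
  qed
  moreover have "hbr a b \<in> Palg" using Palg_op[of hbr a b] assms by simp
  ultimately show ?thesis by (simp add: Po_def)
qed

lemma jpart_simps:
  "jpart (mkJ a b) False = a" "jpart (mkJ a b) True = b" "jpart z0 c = z0"
  "jpart (vadd z w) c = vadd (jpart z c) (jpart w c)" "jpart (vsc k z) c = vsc k (jpart z c)"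
  by (auto simp: jpart_def mkJ_def z0_def vadd_def vsc_def)

lemmas Po_lin = lin_subD[OF is_subalgD(1)[OF Po_sub]]

lemma Jo_sub: "is_subalg pe_J [jmul] (\<lambda>_. z0) (Jo :: 'k::field jel set)"
  unfolding is_subalg_def lin_sub_def
proof (intro conjI ballI allI impI)
  show "z0 \<in> (Jo :: 'k jel set)" "z0 \<in> (Jo :: 'k jel set)"
    by (simp_all add: Jo_def jpart_simps Po_lin(1) Palg_lin(1))
  fix z w :: "'k jel" assume z: "z \<in> Jo"
  then have z': "jpart z False \<in> Po" "jpart z False \<in> Palg" "jpart z True \<in> Palg"
    by (simp_all add: Jo_def Po_def)
  show "vsc c z \<in> Jo" for c using z' by (simp add: Jo_def jpart_simps Po_lin(3) Palg_lin(3))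
  have "pe_H (jpart z False) \<in> Po" by (rule is_subalgD(2)[OF Po_sub z'(1)])
  moreover have "vsub (jpart z True) (pe_H (jpart z True)) \<in> Palg"
    by (rule Palg_lin(4)[OF z'(3) is_subalgD(2)[OF Palg_sub z'(3)]])
  ultimately show "pe_J z \<in> Jo" by (simp add: Jo_def pe_J_def jpart_simps)
  assume w: "w \<in> Jo"
  then have w': "jpart w False \<in> Po" "jpart w False \<in> Palg" "jpart w True \<in> Palg"
    by (simp_all add: Jo_def Po_def)
  show "vadd z w \<in> Jo" using z' w' by (simp add: Jo_def jpart_simps Po_lin(2) Palg_lin(2))
  have "vadd (hmul (jpart z False) (jpart w False)) (hbr (jpart z True) (twist_H (jpart w True))) \<in> Po"
    using Po_op[of hmul "jpart z False" "jpart w False"] z' w'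
    by (simp add: Po_lin(2) hbr_Palg_Po twist_H_Palg)
  moreover have "vadd (hmul (jpart z False) (jpart w True)) (hmul (jpart z True) (twist_H (jpart w False))) \<in> Palg"
    using Palg_op[of hmul "jpart z False" "jpart w True"]
      Palg_op[of hmul "jpart z True" "twist_H (jpart w False)"] z' w'
    by (simp add: Palg_lin(2) twist_H_Palg)
  ultimately have "jmul z w \<in> Jo" by (simp add: Jo_def jmul_def jpart_simps)
  then show "f z w \<in> Jo" if "f \<in> set [jmul]" for f using that by simp
qed

lemma J_continuum: "continuum_decomps pe_J [jmul] (\<lambda>_. z0) (Jo :: 'k::field jel set)"
proof (rule double_continuum[OF Jo_sub _ _ double_sq_z0])
  let ?zz = "\<lambda>t :: bool \<times> nat set \<times> nat set. zw (snd t)"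
  show "double_op goodJ fst ?zz (\<lambda>t. rw (snd t)) {(True, {}, {})} f"
    if "f \<in> set [jmul]" for f :: "'k jel \<Rightarrow> 'k jel \<Rightarrow> 'k jel"
    using that jmul_double by simp
  show "fst t \<and> ?zz t = 0" if "t \<in> {(True, {}, {})}" for t using that by (simp add: zw_def wsum_def)
  show "t \<in> supp z" if "t \<in> supp (pe_J z)" for z :: "'k jel" and t
    using that by (cases t) (auto simp: supp_def pe_J_def mkJ_def jpart_def vsub_def pe_H_def split: if_splits)
  show "supp z \<subseteq> goodJ" if "z \<in> Jo" for z :: "'k jel"
    using Jo_supp(1)[OF that] by (auto simp: goodJ_def)
  have fin: "finite (wH ` snd ` supp z)" if "z \<in> Jo" for z :: "'k jel"
  proof -
    have "jpart z False \<in> Palg" "jpart z True \<in> Palg" using that by (simp_all add: Jo_def Po_def)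
    then have "finite (wH ` supp (jpart z False) \<union> wH ` supp (jpart z True))"
      using Palg_finite[of "jpart z False"] Palg_finite[of "jpart z True"] by simp
    moreover have "snd ` supp z \<subseteq> supp (jpart z False) \<union> supp (jpart z True)"
    proof
      fix m assume "m \<in> snd ` supp z"
      then obtain c where "(c, m) \<in> supp z" by force
      then show "m \<in> supp (jpart z False) \<union> supp (jpart z True)"
        by (cases c) (simp_all add: mem_supp_jpart)
    qed
    then have "wH ` snd ` supp z \<subseteq> wH ` supp (jpart z False) \<union> wH ` supp (jpart z True)" by blast
    ultimately show ?thesis using finite_subset by blast
  qed
  show "finite (?zz ` supp z)" "finite ((\<lambda>t. rw (snd t)) ` supp z)" if "z \<in> Jo" for z :: "'k jel"
    using finite_imageI[OF fin[OF that], of fst] finite_imageI[OF fin[OF that], of snd]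
    by (simp_all add: image_image wH_def)
  show "(cmod (?zz t))\<^sup>2 \<le> 130 * rw (snd t)" if "t \<in> goodJ" for t
    using goodH_bound[of "snd t"] that by (simp add: goodJ_def wH_def)
  fix z :: "'k jel" and s assume z: "z \<in> Jo" and s: "s \<in> good_slopes"
  have z': "jpart z False \<in> Po" "jpart z True \<in> Palg" using z by (simp_all add: Jo_def)
  show "(\<lambda>t. if t \<in> halfp ?zz {(True, {}, {})} s then z t else 0) \<in> Jo"
  proof -
    let ?y = "\<lambda>t. if t \<in> halfp ?zz {(True, {}, {})} s then z t else 0"
    have "jpart ?y False
        = (\<lambda>m. if 0 < lin s (fst (wH m)) then jpart z False m else 0)"
      by (auto simp: jpart_def halfp_def wH_def)
    moreover have "jpart ?y True
        = (\<lambda>m. if 0 < lin s (fst (wH m)) \<or> wH m = 0 then jpart z True m else 0)"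
    proof
      fix m
      show "jpart ?y True m
          = (if 0 < lin s (fst (wH m)) \<or> wH m = 0 then jpart z True m else 0)"
      proof (cases "jpart z True m = 0")
        case True
        then show ?thesis by (simp add: jpart_def)
      next
        case False
        then have "m \<in> goodH" using Palg_supp[OF z'(2)] by (auto simp: supp_def)
        then have "wH m = 0 \<longleftrightarrow> m = ({}, {})" by (rule goodH_zero_weight)
        then show ?thesis by (simp add: jpart_def halfp_def wH_def)
      qed
    qed
    ultimately show ?thesis
      using Po_restrict[OF z'(1), of "\<lambda>y. 0 < lin s (fst y)"]
        Palg_restrict[OF z'(2), of "\<lambda>y. 0 < lin s (fst y) \<or> y = 0"]
      unfolding Jo_def mem_Collect_eq by metis
  qed
  show "(\<lambda>t. if t \<in> halfm ?zz s then z t else 0) \<in> Jo"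
  proof -
    have "jpart (\<lambda>t. if t \<in> halfm ?zz s then z t else 0) c
        = (\<lambda>m. if 0 < - lin s (fst (wH m)) then jpart z c m else 0)" for c
      by (auto simp: jpart_def halfm_def wH_def)
    then show ?thesis
      using Po_restrict[OF z'(1), of "\<lambda>y. 0 < - lin s (fst y)"]
        Palg_restrict[OF z'(2), of "\<lambda>y. 0 < - lin s (fst y)"]
      unfolding Jo_def mem_Collect_eq by metis
  qed
  fix t assume t: "t \<in> supp z"
  obtain c m where cm: "t = (c, m)" by (cases t)
  show "t \<in> {(True, {}, {})} \<or> lin s (?zz t) \<noteq> 0"
    using Jo_supp[OF z t[unfolded cm]] goodH_lin_nonzero[of m s] s unfolding cm by (auto simp: wH_def)
next
  fix n
  obtain e :: "'k hel" where e: "e \<in> Po" "supp e = Vpat n" using Po_Vpat by blast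
  have sup: "t \<in> supp (mkJ e z0) \<longleftrightarrow> \<not> fst t \<and> snd t \<in> Vpat n" for t
    unfolding e(2)[symmetric] by (cases t) (simp add: supp_def mkJ_def z0_def)
  have "mkJ e z0 \<in> Jo" using e(1) by (simp add: Jo_def jpart_simps Palg_lin(1))
  moreover have "(False, Wset n 0, {n + 3 * 0}) \<in> supp (mkJ e z0)" 
    unfolding sup Vpat_def fst_conv snd_conv by blast
  moreover have "zw (snd t) = mu ^ n" if "t \<in> supp (mkJ e z0)" for t
    using that Vpat_weight[of "snd t" n] unfolding sup by (simp add: wH_def)
  moreover have "supp (mkJ e z0) \<subseteq> - {(True, {}, {})}" using sup by auto
  ultimately show "\<exists>e\<in>(Jo :: 'k jel set). supp e \<noteq> {} \<and> supp e \<subseteq> - {(True, {}, {})}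
      \<and> (\<forall>t\<in>supp e. zw (snd t) = mu ^ n)" by (intro bexI[of _ "mkJ e z0"]) auto
qed

section \<open>The Jordan superalgebra built from \<open>Qalg\<close>\<close>

definition zK :: "bool \<times> (nat set \<times> nat set) option \<Rightarrow> complex" where
  "zK t = (case snd t of None \<Rightarrow> 0 | Some p \<Rightarrow> fst (wE p))"

definition rK :: "bool \<times> (nat set \<times> nat set) option \<Rightarrow> real" where
  "rK t = (case snd t of None \<Rightarrow> 0 | Some p \<Rightarrow> snd (wE p))"

text \<open>This leaves out \<open>(False, None)\<close>, the coordinate of the unit 1;
  \<open>(True, None)\<close> is the coordinate of 1-bar.\<close>

definition goodK :: "(bool \<times> (nat set \<times> nat set) option) set" where
  "goodK = {(b, x). case x of None \<Rightarrow> b | Some p \<Rightarrow> p \<in> goodE}"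

lemma supp_twist_op: "supp (twist_op x) \<subseteq> supp x"
proof
  fix t assume "t \<in> supp (twist_op x)"
  then show "t \<in> supp x" by (cases t) (auto simp: supp_def twist_op_def vsub_def vsc_def pe_op_def split: if_splits)
qed

text \<open>Without a unit component, products come only from brackets of barred operators and from
  1-bar times an unbarred operator.\<close>

lemma kmul_double: "double_op goodK fst zK rK {(True, None)} kmul"
  unfolding double_op_def
proof (intro allI impI)
  fix z w :: "'k::field kel" and t assume zw: "supp z \<subseteq> goodK" "supp w \<subseteq> goodK" and t: "t \<in> supp (kmul z w)"
  have "(False, None) \<notin> goodK" by (simp add: goodK_def)
  then have c0: "kc z = 0" "kc w = 0" using zw by (auto simp: supp_def kc_def)
  have mul: "kmul z w = mkK 0 (bracket_op (ky z) (ky w)) 0 (vadd (vsc (kd w) (kx z)) (vsc (kd z) (twist_op (kx w))))"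
    unfolding kmul_def c0 by (simp add: vsc_def vadd_def)
  have sy: "p \<in> supp (ky x) \<longleftrightarrow> (True, Some p) \<in> supp x" and sx: "p \<in> supp (kx x) \<longleftrightarrow> (False, Some p) \<in> supp x"
    and sd: "kd x \<noteq> 0 \<longleftrightarrow> (True, None) \<in> supp x" for x :: "'k kel" and p
    by (simp_all add: supp_def ky_def kx_def kd_def)
  have good: "p \<in> goodE" if "(c, Some p) \<in> supp z \<or> (c, Some p) \<in> supp w" for c p
    using that zw by (auto simp: goodK_def)
  obtain c p where cp: "t = (c, Some p)" using t unfolding mul by (cases t; cases "snd t") (auto simp: supp_def mkK_def)
  show "t \<in> goodK \<and> (\<exists>s\<in>supp z. \<exists>u\<in>supp w. dbl fst zK rK {(True, None)} t s u)"
  proof (cases c)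
    case False
    then have "p \<in> supp (bracket_op (ky z) (ky w))" using t unfolding mul cp by (simp add: supp_def mkK_def)
    moreover have "supp (ky z) \<subseteq> goodE" "supp (ky w) \<subseteq> goodE" using good sy by blast+
    ultimately obtain q q' where q: "p \<in> goodE" "q \<in> supp (ky z)" "q' \<in> supp (ky w)" "wE p = wE q + wE q'"
      using additive_opD[OF bracket_op_additive] by metis
    then have "(True, Some q) \<in> supp z" "(True, Some q') \<in> supp w" using sy by blast+
    then show ?thesis using q False
      by (intro conjI bexI[of _ "(True, Some q)"] bexI[of _ "(True, Some q')"]) (simp_all add: cp goodK_def zK_def rK_def dbl_def)
  next
    case True
    then have "kd w * kx z p + kd z * twist_op (kx w) p \<noteq> 0"
      using t unfolding mul cp by (simp add: supp_def mkK_def vadd_def vsc_def)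
    then have "(kd w \<noteq> 0 \<and> kx z p \<noteq> 0) \<or> (kd z \<noteq> 0 \<and> twist_op (kx w) p \<noteq> 0)" by auto
    then show ?thesis
    proof (elim disjE conjE)
      assume "kd w \<noteq> 0" "kx z p \<noteq> 0"
      then have *: "(True, None) \<in> supp w" "(False, Some p) \<in> supp z" using sd sx by (auto simp: supp_def)
      then show ?thesis using good[of False p] True
        by (intro conjI bexI[of _ "(False, Some p)"] bexI[of _ "(True, None)"]) (simp_all add: cp goodK_def zK_def rK_def dbl_def)
    next
      assume "kd z \<noteq> 0" "twist_op (kx w) p \<noteq> 0"
      then have "(True, None) \<in> supp z" "p \<in> supp (kx w)" using sd supp_twist_op[of "kx w"] by (auto simp: supp_def)
      then have "(True, None) \<in> supp z" "(False, Some p) \<in> supp w" using sx by blast+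
      then show ?thesis using good[of False p] True
        by (intro conjI bexI[of _ "(True, None)"] bexI[of _ "(False, Some p)"]) (simp_all add: cp goodK_def zK_def rK_def dbl_def)
    qed
  qed
qed

lemma Qalg_sub: "is_subalg pe_op [bracket_op] (\<lambda>a. ocomp a a) Qalg"
  unfolding Qalg_def by (rule is_subalg_generated)

lemmas Qalg_lin = lin_subD[OF is_subalgD(1)[OF Qalg_sub]]

lemma Qalg_supp: "a \<in> Qalg \<Longrightarrow> supp a \<subseteq> goodE"
  unfolding Qalg_def by (rule wgraded.L_supp[OF wgraded_Q])

lemma Qalg_finite: "a \<in> Qalg \<Longrightarrow> finite (wE ` supp a)"
  unfolding Qalg_def by (rule wgraded.L_finite_weights[OF wgraded_Q])

lemma Qalg_restrict: "a \<in> Qalg \<Longrightarrow> (\<lambda>t. if R (wE t) then a t else 0) \<in> Qalg"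
  unfolding Qalg_def by (rule wgraded.L_restrict[OF wgraded_Q])

lemma k_simps:
  "kc (mkK c x d y) = c" "kx (mkK c x d y) = x" "kd (mkK c x d y) = d" "ky (mkK c x d y) = y"
  "kc z0 = 0" "kx z0 = z0" "ky z0 = z0"
  "kc (vadd z w) = kc z + kc w" "kx (vadd z w) = vadd (kx z) (kx w)" "ky (vadd z w) = vadd (ky z) (ky w)"
  "kc (vsc k z) = k * kc z" "kx (vsc k z) = vsc k (kx z)" "ky (vsc k z) = vsc k (ky z)"
  by (simp_all add: kc_def kx_def kd_def ky_def mkK_def z0_def vadd_def vsc_def)

lemma Ko_sub: "is_subalg pe_K [kmul] (\<lambda>_. z0) (Ko :: 'k::field kel set)"
  unfolding is_subalg_def lin_sub_def
proof (intro conjI ballI allI impI)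
  show "z0 \<in> (Ko :: 'k kel set)" "z0 \<in> (Ko :: 'k kel set)" by (simp_all add: Ko_def k_simps Qalg_lin(1))
  fix z w :: "'k kel" assume z: "z \<in> Ko"
  then have z': "kc z = 0" "kx z \<in> Qalg" "ky z \<in> Qalg" by (simp_all add: Ko_def)
  show "vsc c z \<in> Ko" for c using z' by (simp add: Ko_def k_simps Qalg_lin(3))
  show "pe_K z \<in> Ko"
    using z' is_subalgD(2)[OF Qalg_sub z'(2)] Qalg_lin(4)[OF z'(3) is_subalgD(2)[OF Qalg_sub z'(3)]]
    by (simp add: Ko_def pe_K_def k_simps)
  assume "w \<in> Ko"
  then have w': "kc w = 0" "kx w \<in> Qalg" "ky w \<in> Qalg" by (simp_all add: Ko_def)
  show "vadd z w \<in> Ko" using z' w' by (simp add: Ko_def k_simps Qalg_lin(2))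
  have br: "bracket_op (ky z) (ky w) \<in> Qalg" by (rule is_subalgD(3)[OF Qalg_sub _ z'(3) w'(3)]) simp
  have tw: "twist_op (kx w) \<in> Qalg"
    unfolding twist_op_def by (rule Qalg_lin(4)[OF Qalg_lin(3)[OF is_subalgD(2)[OF Qalg_sub w'(2)]] w'(2)])
  have "kmul z w \<in> Ko"
    using z' w' br tw by (simp add: Ko_def kmul_def k_simps Qalg_lin(2,3))
  then show "f z w \<in> Ko" if "f \<in> set [kmul]" for f using that by simp
qed

lemma K_continuum: "continuum_decomps pe_K [kmul] (\<lambda>_. z0) (Ko :: 'k::field kel set)"
proof (rule double_continuum[OF Ko_sub _ _ double_sq_z0])
  show "double_op goodK fst zK rK {(True, None)} f" if "f \<in> set [kmul]" for f :: "'k kel \<Rightarrow> 'k kel \<Rightarrow> 'k kel"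
    using that kmul_double by simp
  show "fst t \<and> zK t = 0" if "t \<in> {(True, None)}" for t using that by (simp add: zK_def)
  show "t \<in> supp z" if "t \<in> supp (pe_K z)" for z :: "'k kel" and t
    using that by (cases t; cases "snd t")
      (auto simp: supp_def pe_K_def mkK_def kc_def kx_def ky_def vsub_def pe_op_def split: if_splits)
  have Ko: "kc z = 0" "kx z \<in> Qalg" "ky z \<in> Qalg" if "z \<in> Ko" for z :: "'k kel"
    using that by (simp_all add: Ko_def)
  have Ko_supp: "t = (True, None) \<or> (\<exists>p. t = (False, Some p) \<and> p \<in> supp (kx z)) \<or> (\<exists>p. t = (True, Some p) \<and> p \<in> supp (ky z))"
    if "z \<in> Ko" "t \<in> supp z" for z :: "'k kel" and t
  proof -
    obtain c x where t: "t = (c, x)" by (cases t)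
    show ?thesis using that(2) Ko(1)[OF that(1)] unfolding t
      by (cases c; cases x) (auto simp: supp_def kc_def kx_def ky_def)
  qed
  show "supp z \<subseteq> goodK" if z: "z \<in> Ko" for z :: "'k kel"
  proof
    fix t assume "t \<in> supp z"
    from Ko_supp[OF z this] show "t \<in> goodK"
      using Qalg_supp[OF Ko(2)[OF z]] Qalg_supp[OF Ko(3)[OF z]] by (auto simp: goodK_def)
  qed
  have fin: "finite ((\<lambda>t. (zK t, rK t)) ` supp z)" if z: "z \<in> Ko" for z :: "'k kel"
  proof (rule finite_subset)
    show "(\<lambda>t. (zK t, rK t)) ` supp z \<subseteq> insert (0, 0) (wE ` supp (kx z) \<union> wE ` supp (ky z))"
    proof
      fix y assume "y \<in> (\<lambda>t. (zK t, rK t)) ` supp z"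
      then obtain t where t: "t \<in> supp z" "y = (zK t, rK t)" by blast
      from Ko_supp[OF z t(1)] show "y \<in> insert (0, 0) (wE ` supp (kx z) \<union> wE ` supp (ky z))"
        unfolding t(2) by (auto simp: zK_def rK_def)
    qed
    show "finite (insert (0, 0) (wE ` supp (kx z) \<union> wE ` supp (ky z)))"
      using Qalg_finite[OF Ko(2)[OF z]] Qalg_finite[OF Ko(3)[OF z]] by simp
  qed
  show "finite (zK ` supp z)" "finite (rK ` supp z)" if "z \<in> Ko" for z :: "'k kel"
    using finite_imageI[OF fin[OF that], of fst] finite_imageI[OF fin[OF that], of snd]
    by (simp_all add: image_image)
  show "(cmod (zK t))\<^sup>2 \<le> 130 * rK t" if "t \<in> goodK" for t
    using that goodE_bound by (auto simp: goodK_def zK_def rK_def split: option.splits)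
  fix z :: "'k kel" and s assume z: "z \<in> Ko" and s: "s \<in> good_slopes"
  note z' = Ko[OF z]
  \<comment> \<open>\<open>Ko\<close> puts no condition on the coefficient of 1-bar, so only the
    indices \<open>Some p\<close> in \<open>I\<close> matter, and there \<open>I\<close> is given by
    the weight.\<close>
  have restr: "(\<lambda>t. if t \<in> I then z t else 0) \<in> Ko" if I: "\<And>b p. (b, Some p) \<in> I \<longleftrightarrow> R (wE p)" for I R
  proof -
    let ?y = "\<lambda>t. if t \<in> I then z t else 0"
    have "kc ?y = 0" "kx ?y = (\<lambda>p. if R (wE p) then kx z p else 0)"
      "ky ?y = (\<lambda>p. if R (wE p) then ky z p else 0)"
      using z'(1) I by (auto simp: kc_def kx_def ky_def)
    then show ?thesis using Qalg_restrict[OF z'(2), of R] Qalg_restrict[OF z'(3), of R] by (simp add: Ko_def)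
  qed
  show "(\<lambda>t. if t \<in> halfp zK {(True, None)} s then z t else 0) \<in> Ko"
    by (rule restr[where R = "\<lambda>y. 0 < lin s (fst y)"]) (simp add: halfp_def zK_def)
  show "(\<lambda>t. if t \<in> halfm zK s then z t else 0) \<in> Ko"
    by (rule restr[where R = "\<lambda>y. 0 < - lin s (fst y)"]) (simp add: halfm_def zK_def)
  fix t assume "t \<in> supp z"
  from Ko_supp[OF z this] show "t \<in> {(True, None)} \<or> lin s (zK t) \<noteq> 0"
    using Qalg_supp[OF z'(2)] Qalg_supp[OF z'(3)] goodE_lin_nonzero[OF _ s] by (auto simp: zK_def)
next
  fix n
  obtain e :: "'k endo" where e: "e \<in> Qalg" "supp e = vpat n" using Qalg_vpat by blast
  let ?e = "mkK 0 e 0 z0 :: 'k kel"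
  have sup: "t \<in> supp ?e \<longleftrightarrow> (\<exists>p\<in>vpat n. t = (False, Some p))" for t
    unfolding e(2)[symmetric] by (cases t; cases "snd t") (auto simp: supp_def mkK_def z0_def)
  have "?e \<in> Ko" using e(1) by (simp add: Ko_def k_simps Qalg_lin(1))
  moreover have "(False, Some ({n}, {})) \<in> supp ?e" unfolding sup using vpat_nonempty by blast
  moreover have "zK t = mu ^ n" if "t \<in> supp ?e" for t
    using that vpat_zw unfolding sup by (auto simp: zK_def wE_def)
  moreover have "supp ?e \<subseteq> - {(True, None)}" using sup by auto
  ultimately show "\<exists>e\<in>(Ko :: 'k kel set). supp e \<noteq> {} \<and> supp e \<subseteq> - {(True, None)}
      \<and> (\<forall>t\<in>supp e. zK t = mu ^ n)" by (intro bexI[of _ ?e]) auto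
qed

theorem theorem14p2:
  shows "continuum_decomps pe_op [bracket_op] (\<lambda>a. ocomp a a) (Qalg :: ('k::field) endo set)
       \<and> continuum_decomps id [ocomp] (\<lambda>_. z0) (Aalg :: 'k endo set)
       \<and> continuum_decomps pe_H [hmul, hbr] hsq (Po :: 'k hel set)
       \<and> ((2::'k) \<noteq> 0 \<longrightarrow>
            continuum_decomps pe_J [jmul] (\<lambda>_. z0) (Jo :: 'k jel set)
          \<and> continuum_decomps pe_K [kmul] (\<lambda>_. z0) (Ko :: 'k kel set))"
  by (intro conjI impI Q_continuum A_continuum P_continuum J_continuum K_continuum)

end
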